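(* Let $N,n\ge 1$ be integers and let $E$ be an $N$-dimensional normed space, i.e. $\mathbb{R}^N$ equipped with a norm. Let $f_1,\dots,f_N$ be probability densities on $\mathbb{R}^n$ (with respect to Lebesgue measure), and let $X_1,\dots,X_N$, $X_1^*,\dots,X_N^*$, $Z_1,\dots,Z_N$ be independent random vectors in $\mathbb{R}^n$ on a common probability space $(\Omega,\mathcal{F},\mathbb{P})$ such that $X_i$ has density $f_i$, $X_i^*$ has density $f_i^*$ (the symmetric decreasing rearrangement of $f_i$), and $Z_i$ is uniformly distributed in $\widetilde{B}$, the Euclidean ball in $\mathbb{R}^n$ of volume one centered at the origin. Let $\mathbf{X}=[X_1\cdots X_N]$, $\mathbf{X}^*=[X_1^*\cdots X_N^*]$, $\mathbf{Z}=[Z_1\cdots Z_N]$ be the corresponding $n\times N$ random matrices. Then for each $\alpha\ge 0$, $$\mathbb{P}\big(\|\mathbf{X}:E\to\ell_2^n\|\le\alpha\big)\ \le\ \mathbb{P}\big(\|\mathbf{X}^*:E\to\ell_2^n\|\le\alpha\big).$$ Moreover, if $\|f_i\|_\infty\le 1$ for each $i=1,\dots,N$, then for each $\alpha\ge 0$, $$\mathbb{P}\big(\|\mathbf{X}:E\to\ell_2^n\|\le\alpha\big)\ \le\ \mathbb{P}\big(\|\mathbf{Z}:E\to\ell_2^n\|\le\alpha\big).$$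
   Context: An $n\times N$ matrix is viewed as a linear operator from $\mathbb{R}^N$ to $\mathbb{R}^n$; $\|\mathbf{A}:E\to\ell_2^n\|=\sup\{\|\mathbf{A}v\|_2: v\in\mathbb{R}^N,\ \|v\|_E\le 1\}$ is its operator norm, where $\|\cdot\|_2$ is the Euclidean norm. For a Borel set $A\subseteq\mathbb{R}^n$ of finite measure, $A^*$ is the open Euclidean ball centered at the origin with the same measure as $A$; for integrable $f:\mathbb{R}^n\to[0,\infty)$, $f^*(x)=\int_0^\infty \mathbf{1}_{\{f>t\}^*}(x)\,dt$. *)

theory Defs
  imports "HOL-Probability.Probability"
begin

definition is_norm :: "('a::real_vector \<Rightarrow> real) \<Rightarrow> bool" where
  "is_norm p \<longleftrightarrow>
     (\<forall>v. 0 \<le> p v) \<and> (\<forall>v. p v = 0 \<longleftrightarrow> v = 0) \<and>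
     (\<forall>c v. p (c *\<^sub>R v) = \<bar>c\<bar> * p v) \<and> (\<forall>v w. p (v + w) \<le> p v + p w)"

text \<open>The supremum is taken in the reals. When \<open>p\<close> is a norm, the set is nonempty and bounded
  (all norms on a finite-dimensional space are equivalent), so this is a genuine supremum.\<close>

definition op_norm :: "(real ^ 'N \<Rightarrow> real) \<Rightarrow> real ^ 'N ^ 'n \<Rightarrow> real" where
  "op_norm p A = (SUP v\<in>{v. p v \<le> 1}. norm (A *v v))"

definition matrix_of_columns :: "('N \<Rightarrow> real ^ 'n) \<Rightarrow> real ^ 'N ^ 'n" where
  "matrix_of_columns x = (\<chi> j i. x i $ j)"

text \<open>Only meaningful for sets of finite measure; a null set gets radius \<open>0\<close>, so its
  rearrangement is empty.\<close>

definition sym_rearr_set :: "'a::euclidean_space set \<Rightarrow> 'a set" where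
  "sym_rearr_set A =
     ball 0 (THE r. 0 \<le> r \<and> emeasure lborel (ball (0::'a) r) = emeasure lborel A)"

text \<open>The rearrangement takes values in \<^typ>\<open>ennreal\<close> because the rearrangement of an
  unbounded function is infinite at the origin.\<close>

definition sym_rearr :: "('a::euclidean_space \<Rightarrow> real) \<Rightarrow> 'a \<Rightarrow> ennreal" where
  "sym_rearr f x = (\<integral>\<^sup>+t\<in>{0<..}. indicator (sym_rearr_set {y. t < f y}) x \<partial>lborel)"

definition unit_volume_ball :: "'a::euclidean_space set" where
  "unit_volume_ball = cball 0 (THE r. 0 \<le> r \<and> emeasure lborel (cball (0::'a) r) = 1)"

lemma ex1_radius:
  assumes "V < \<infinity>"
  shows "\<exists>!r. 0 \<le> r \<and> emeasure lborel (ball (0::'a::euclidean_space) r) = V"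
proof -
  let ?d = "DIM('a)"
  define c where "c = unit_ball_vol (real ?d)"
  have c: "c > 0" by (simp add: c_def)
  define v where "v = enn2real V"
  have v: "V = ennreal v" "v \<ge> 0"
    using assms by (auto simp: v_def less_top)
  have eq: "emeasure lborel (ball (0::'a) r) = V \<longleftrightarrow> r ^ ?d = v / c" if "0 \<le> r" for r
    using that v c by (simp add: emeasure_ball c_def [symmetric] field_simps)
  show ?thesis
  proof (rule ex1I)
    show "0 \<le> root ?d (v / c) \<and> emeasure lborel (ball (0::'a) (root ?d (v / c))) = V"
      using v c eq[of "root ?d (v / c)"] by simp
  next
    fix r assume r: "0 \<le> r \<and> emeasure lborel (ball (0::'a) r) = V"
    then show "r = root ?d (v / c)"
      using eq[of r] by (metis DIM_positive real_root_power_cancel)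
  qed
qed

lemma emeasure_sym_rearr_set:
  fixes A :: "'a::euclidean_space set"
  assumes "emeasure lborel A < \<infinity>"
  shows "emeasure lborel (sym_rearr_set A) = emeasure lborel A"
  using theI'[OF ex1_radius[OF assms, where 'a = 'a]] by (simp add: sym_rearr_set_def)

lemma emeasure_unit_volume_ball:
  "emeasure lborel (unit_volume_ball :: 'a::euclidean_space set) = 1"
proof -
  have "0 \<le> r \<and> emeasure lborel (cball (0::'a) r) = 1 \<longleftrightarrow>
        0 \<le> r \<and> emeasure lborel (ball (0::'a) r) = 1" for r
    by (auto simp: emeasure_ball emeasure_cball)
  then have "\<exists>!r. 0 \<le> r \<and> emeasure lborel (cball (0::'a) r) = 1"
    using ex1_radius[of 1, where 'a='a] by simp
  from theI'[OF this] show ?thesis by (simp add: unit_volume_ball_def)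
qed

end

theory Submission
  imports Defs
begin

text \<open>The set \<open>K\<close> of tuples of columns whose matrix has operator norm at most \<open>\<alpha>\<close> is convex and
  invariant under orthogonal maps applied to all columns simultaneously. Hence its slices along \<open>N\<close>
  parallel lines are symmetric convex sets in \<open>\<real>\<^sup>N\<close>, and a one-dimensional rearrangement inequality
  applies to them: by the Prekopa--Leindler inequality the volume of the intersection of such a
  set with a box grows when the centre of the box slides to the origin (Anderson), so for finite
  unions of intervals one slides all intervals until two touch, merges them, and repeats.
  Integrating over the lines, Steiner symmetrisation of all sets in a common direction
  increases the volume of \<open>K \<inter> A\<^sub>1 \<times> \<dots> \<times> A\<^sub>N\<close>. If the \<open>A\<^sub>i\<close> differ from the centred balls \<open>B\<^sub>i\<close> of the
  same volume, some shift \<open>w\<close> moves a definite amount of the \<open>A\<^sub>i - B\<^sub>i\<close> into the \<open>B\<^sub>i - A\<^sub>i\<close>, and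
  symmetrising in the direction \<open>w\<close> brings the \<open>A\<^sub>i\<close> closer to the balls by that amount; this replaces any
  compactness argument. Densities follow by the layer-cake formula. For densities bounded by one, the
  functional is linear in each density, so each density can be replaced by the indicator of a
  set of measure at most one (bathtub principle).\<close>

section \<open>The Brunn--Minkowski and Prekopa--Leindler inequalities\<close>

text \<open>Both probability inequalities concern \<open>multi_integral K g\<close>, the mass of
  \<open>K\<close> under a product density. All columns must be symmetrised in the same direction,
  because only simultaneous orthogonal maps preserve \<open>K\<close>; the reflection in that
  direction then reverses all line coordinates at once, so every slice is symmetric even when its
  lines avoid the origin. The obstacle is to reach the balls, since iterated symmetrisation along
  arbitrary directions need not converge. The useful shift comes from averaging: the overlap of the
  excess of \<open>A i\<close> with the translated deficit of its ball, integrated over all shifts,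
  is the product of the two measures. Excess and deficit have equal measure, so some shift recovers
  a multiple of the sum of squared deficits, which by Cauchy--Schwarz is controlled from below by
  the total deficit alone. The functional exceeds its value on the balls by at most a constant times
  the measure lying outside them, so approach in measure is enough.\<close>

abbreviation vol :: "'a::euclidean_space set \<Rightarrow> ennreal"
  where "vol \<equiv> emeasure lborel"

text \<open>Brunn--Minkowski is first proved for cut sets; this recovers the full sets without
  compactness. The segments cut at points of \<open>A\<close> exhaust \<open>A\<close>; if
  \<open>A\<close> has a maximum, one segment is already all of it.\<close>

lemma emeasure_le_of_initial_segments:
  fixes A :: "real set"
  assumes A[measurable]: "A \<in> sets borel" and le: "\<And>a. a \<in> A \<Longrightarrow> vol (A \<inter> {..a}) \<le> m"
  shows "vol A \<le> m"
proof (cases "\<exists>a\<in>A. \<forall>x\<in>A. x \<le> a")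
  case True
  then obtain a where a: "a \<in> A" "A \<inter> {..a} = A" by auto
  then show ?thesis using le[OF a(1)] by simp
next
  case False
  \<comment> \<open>Cut points rising to the supremum, or to infinity. Without a maximum, every
    point of \<open>A\<close> lies strictly below the supremum and hence below some
    \<open>s n\<close>, while a nonempty \<open>A\<close> has points above each
    \<open>s n\<close>.\<close>
  define s where "s n = (if bdd_above A then Sup A - 1 / real (Suc n) else real n)" for n
  have s_mono: "s n \<le> s (Suc n)" for n
    using divide_left_mono[of "real (Suc n)" "real (Suc (Suc n))" 1] by (simp add: s_def)
  have below: "\<exists>n. x \<le> s n" if x: "x \<in> A" for x
  proof (cases "bdd_above A")
    case True
    obtain y where "y \<in> A" "x < y" using False x by force
    then have "0 < Sup A - x" using cSup_upper[OF _ True, of y] by simp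
    then obtain n where "1 / real (Suc n) < Sup A - x" by (rule nat_approx_posE)
    then show ?thesis using True by (intro exI[of _ n]) (simp add: s_def)
  qed (simp add: s_def real_arch_simple)
  have above: "\<exists>a\<in>A. s n < a" if "A \<noteq> {}" for n
  proof (cases "bdd_above A")
    case True
    then show ?thesis using that less_cSup_iff[of A "s n"] by (simp add: s_def)
  next
    case False
    then show ?thesis unfolding bdd_above_def s_def by (meson linorder_not_le)
  qed
  have "A = (\<Union>n. A \<inter> {..s n})" using below by auto
  also have "vol \<dots> = (SUP n. vol (A \<inter> {..s n}))"
    using lift_Suc_mono_le[of s, OF s_mono]
    by (intro SUP_emeasure_incseq[symmetric]) (auto simp: incseq_def intro: order_trans)
  also have "\<dots> \<le> m"
  proof (rule SUP_least)
    fix n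
    show "vol (A \<inter> {..s n}) \<le> m"
    proof (cases "A = {}")
      case False
      then obtain a where a: "a \<in> A" "s n < a" using above by blast
      have "vol (A \<inter> {..s n}) \<le> vol (A \<inter> {..a})"
        using a by (intro emeasure_mono) auto
      also have "\<dots> \<le> m" using a by (intro le)
      finally show ?thesis .
    qed simp
  qed
  finally show ?thesis .
qed

lemma nn_integral_indicator_vimage:
  assumes "{t. h t \<in> A} \<in> sets borel"
  shows "(\<integral>\<^sup>+t. indicator A (h t) \<partial>lborel) = vol {t. h t \<in> A}"
proof -
  have "(\<integral>\<^sup>+t. indicator A (h t) \<partial>lborel) = (\<integral>\<^sup>+t. indicator {t. h t \<in> A} t \<partial>lborel)"
    by (intro nn_integral_cong) (simp add: indicator_def)
  then show ?thesis using assms by simp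
qed

lemma emeasure_affine_vimage:
  fixes A :: "real set"
  assumes [measurable]: "A \<in> sets borel" and c: "c \<noteq> 0"
  shows "vol A = ennreal \<bar>c\<bar> * vol {x. t + c * x \<in> A}"
proof -
  have "{x. t + c * x \<in> A} \<in> sets borel" by measurable
  then show ?thesis
    using nn_integral_real_affine[of "indicator A" c t] c by (simp add: nn_integral_indicator_vimage)
qed

lemma ennreal_le_minusI: "y + x \<le> c \<Longrightarrow> x \<le> c - (y::ennreal)"
  by (simp add: ennreal_le_minus_iff add.commute)

lemma ennreal_le_minusD: "x \<le> c - y \<Longrightarrow> y \<le> c \<Longrightarrow> y + x \<le> (c::ennreal)"
  by (auto simp add: ennreal_le_minus_iff add.commute)

text \<open>Cutting \<open>A\<close> at \<open>a \<in> A\<close> from above and \<open>B\<close> at \<open>b \<in> B\<close> from below, the midpoints of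
  \<open>b\<close> with \<open>A\<close> and of \<open>a\<close> with \<open>B\<close> overlap in a single point.\<close>

lemma brunn_minkowski_real:
  fixes A B C :: "real set"
  assumes [measurable]: "A \<in> sets borel" "B \<in> sets borel" "C \<in> sets borel"
    and ne: "A \<noteq> {}" "B \<noteq> {}"
    and mid: "\<And>a b. a \<in> A \<Longrightarrow> b \<in> B \<Longrightarrow> (a + b) / 2 \<in> C"
  shows "vol A + vol B \<le> 2 * vol C"
proof -
  have *: "vol (A \<inter> {..a}) + vol (B \<inter> {b..}) \<le> 2 * vol C"
    if ab: "a \<in> A" "b \<in> B" for a b
  proof -
    define D where "D = {x. - b + 2 * x \<in> A \<inter> {..a}}"
    define E where "E = {x. - a + 2 * x \<in> B \<inter> {b..}}"
    define E' where "E' = E - {(a+b)/2}"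
    have [measurable]: "D \<in> sets borel" "E \<in> sets borel" "E' \<in> sets borel"
      unfolding D_def E_def E'_def by measurable
    have 1: "vol (A \<inter> {..a}) = 2 * vol D"
      unfolding D_def by (subst emeasure_affine_vimage[where c=2 and t="-b"]) auto
    have 2: "vol (B \<inter> {b..}) = 2 * vol E"
      unfolding E_def by (subst emeasure_affine_vimage[where c=2 and t="-a"]) auto
    have 3: "vol E' = vol E"
      unfolding E'_def by (rule emeasure_Diff_null_set) auto
    have disj: "D \<inter> E' = {}" by (auto simp: D_def E'_def E_def)
    have D: "D \<subseteq> C"
    proof
      fix x assume "x \<in> D"
      then have "((- b + 2 * x) + b) / 2 \<in> C" using ab by (intro mid) (auto simp: D_def)
      then show "x \<in> C" by simp
    qed
    have E: "E' \<subseteq> C"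
    proof
      fix x assume "x \<in> E'"
      then have "(a + (- a + 2 * x)) / 2 \<in> C" using ab by (intro mid) (auto simp: E_def E'_def)
      then show "x \<in> C" by simp
    qed
    have "vol D + vol E' = vol (D \<union> E')"
      using disj by (intro plus_emeasure) auto
    also have "\<dots> \<le> vol C" using D E by (intro emeasure_mono) auto
    finally have "2 * (vol D + vol E') \<le> 2 * vol C"
      by (rule mult_left_mono) simp
    then show ?thesis by (simp add: 1 2 3 distrib_left)
  qed
  \<comment> \<open>The two cuts are removed one after the other by moving the other summand to the
    right-hand side; the subtraction is reversible because that summand is at most
    \<open>2 * vol C\<close>.\<close>
  have **: "vol (A \<inter> {..a}) + vol B \<le> 2 * vol C" if a: "a \<in> A" for a
  proof (cases "vol (A \<inter> {..a}) = \<infinity>")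
    case True
    then show ?thesis using *[OF a] ne by fastforce
  next
    case False
    obtain b where "b \<in> B" using ne by auto
    from *[OF a this] have le': "vol (A \<inter> {..a}) \<le> 2 * vol C"
      by (meson add_increasing2 order_trans zero_le le_iff_add)
    \<comment> \<open>Reflection turns the final segments of \<open>B\<close> into the initial
      segments that the exhaustion lemma handles.\<close>
    define B' where "B' = {x. 0 + (-1) * x \<in> B}"
    have B'm[measurable]: "B' \<in> sets borel" unfolding B'_def by measurable
    have "vol B' \<le> 2 * vol C - vol (A \<inter> {..a})"
    proof (rule emeasure_le_of_initial_segments[OF B'm])
      fix b assume b: "b \<in> B'"
      have "vol (B \<inter> {-b..}) = vol (B' \<inter> {..b})"
        by (subst emeasure_affine_vimage[where c="-1" and t=0])
           (auto simp: B'_def intro!: arg_cong[where f="vol"])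
      moreover have "vol (A \<inter> {..a}) + vol (B \<inter> {-b..}) \<le> 2 * vol C"
        using * a b by (auto simp: B'_def)
      ultimately show "vol (B' \<inter> {..b}) \<le> 2 * vol C - vol (A \<inter> {..a})"
        by (simp add: ennreal_le_minusI)
    qed
    moreover have "vol B = vol B'"
      unfolding B'_def by (subst emeasure_affine_vimage[where c="-1" and t=0]) auto
    ultimately show ?thesis
      using le' by (intro ennreal_le_minusD) auto
  qed
  show ?thesis
  proof (cases "vol B = \<infinity>")
    case True
    then show ?thesis using ** ne by fastforce
  next
    case False
    obtain a where "a \<in> A" using ne by auto
    from **[OF this] have le': "vol B \<le> 2 * vol C"
      by (metis add.commute order_trans le_iff_add)
    have "vol A \<le> 2 * vol C - vol B"
    proof (rule emeasure_le_of_initial_segments)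
      fix a assume "a \<in> A"
      from **[OF this] False show "vol (A \<inter> {..a}) \<le> 2 * vol C - vol B"
        by (simp add: ennreal_le_minusI add.commute)
    qed auto
    then show ?thesis
      using le' ennreal_le_minusD[of "vol A" "2 * vol C" "vol B"]
      by (simp add: add.commute)
  qed
qed

section \<open>Layer-cake formula and the Prekopa--Leindler inequality\<close>

lemma ennreal_layer_cake:
  fixes y :: ennreal
  shows "(\<integral>\<^sup>+t. indicator {0<..} t * indicator {t. ennreal t < y} t \<partial>lborel) = y"
proof -
  have "(\<integral>\<^sup>+t. indicator {0<..} t * indicator {t. ennreal t < y} t \<partial>lborel)
      = (\<integral>\<^sup>+t. indicator {t. 0 < t \<and> ennreal t < y} t \<partial>lborel)"
    by (intro nn_integral_cong) (auto simp: indicator_def)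
  also have "\<dots> = vol {t. 0 < t \<and> ennreal t < y}"
    by (rule nn_integral_indicator) measurable
  also have "\<dots> = y"
  proof (cases y)
    case (real r)
    then have "{t. 0 < t \<and> ennreal t < y} = {0<..<r}"
      by (auto simp: ennreal_less_iff)
    then show ?thesis using real by simp
  next
    case top
    then have "{t. 0 < t \<and> ennreal t < y} = {0<..}" by auto
    moreover have "vol {0::real<..} = \<infinity>"
    proof -
      have "ennreal (real n) \<le> vol {0::real<..}" for n
        using emeasure_mono[of "{0<..real n}" "{0::real<..}" lborel] by fastforce
      then show ?thesis
        by (metis ennreal_Ex_less_of_nat ennreal_of_nat_eq_real_of_nat infinity_ennreal_def leD less_top)
    qed
    ultimately show ?thesis using top by simp
  qed
  finally show ?thesis .
qed

lemma nn_integral_layer_cake: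
  assumes "sigma_finite_measure M" and [measurable]: "f \<in> borel_measurable M"
  shows "(\<integral>\<^sup>+x. f x \<partial>M) = (\<integral>\<^sup>+t. indicator {0<..} t * emeasure M {x\<in>space M. ennreal t < f x} \<partial>lborel)"
proof -
  interpret M: sigma_finite_measure M by fact
  interpret pair_sigma_finite M "lborel :: real measure" ..
  have "(\<integral>\<^sup>+x. f x \<partial>M) = (\<integral>\<^sup>+x. (\<integral>\<^sup>+t. indicator {0<..} t * indicator {t. ennreal t < f x} t \<partial>lborel) \<partial>M)"
    by (simp only: ennreal_layer_cake)
  also have "\<dots> = (\<integral>\<^sup>+x. (\<integral>\<^sup>+t. indicator {0<..} t * indicator {z. ennreal (snd z) < f (fst z)} (x, t) \<partial>lborel) \<partial>M)"
    by (intro nn_integral_cong) (auto simp: indicator_def)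
  also have "\<dots> = (\<integral>\<^sup>+t. (\<integral>\<^sup>+x. indicator {0<..} t * indicator {x\<in>space M. ennreal t < f x} x \<partial>M) \<partial>lborel)"
    apply (subst Fubini')
     apply (simp add: split_beta', measurable)
    apply (intro nn_integral_cong) apply (auto simp: indicator_def)
    done
  also have "\<dots> = (\<integral>\<^sup>+t. indicator {0<..} t * emeasure M {x\<in>space M. ennreal t < f x} \<partial>lborel)"
    by (intro nn_integral_cong) (simp add: nn_integral_cmult)
  finally show ?thesis .
qed

text \<open>The common supremum 1 makes the superlevel sets of \<open>f\<close> and \<open>g\<close>
  nonempty at every level \<open>0 < t < 1\<close>, as Brunn--Minkowski requires, and empty at
  levels from 1 on. Their midpoints fall into the superlevel set of \<open>h\<close>, because the
  product of two values above \<open>t\<close> exceeds the square of \<open>t\<close>. Integrating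
  over \<open>t\<close> bounds the sum of the integrals.\<close>

lemma prekopa_leindler_normalised:
  fixes f g h :: "real \<Rightarrow> ennreal"
  assumes [measurable]: "f \<in> borel_measurable borel" "g \<in> borel_measurable borel" "h \<in> borel_measurable borel"
    and sup: "(SUP x. f x) = 1" "(SUP x. g x) = 1"
    and mid: "\<And>x y. f x * g y \<le> (h ((x + y) / 2))\<^sup>2"
  shows "(\<integral>\<^sup>+x. f x \<partial>lborel) + (\<integral>\<^sup>+x. g x \<partial>lborel) \<le> 2 * (\<integral>\<^sup>+x. h x \<partial>lborel)"
proof -
  have f1: "f x \<le> 1" and g1: "g x \<le> 1" for x
    using SUP_upper[of x UNIV f] SUP_upper[of x UNIV g] sup by auto
  have *: "indicator {0<..} t * vol {x\<in>space lborel. ennreal t < f x}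
      + indicator {0<..} t * vol {x\<in>space lborel. ennreal t < g x}
    \<le> 2 * (indicator {0<..} t * vol {x\<in>space lborel. ennreal t < h x})" for t
  proof (cases "0 < t \<and> t < 1")
    case True
    then have t1: "ennreal t < 1" by (simp add: ennreal_less_one_iff)
    have ne: "{x. ennreal t < f x} \<noteq> {}" "{x. ennreal t < g x} \<noteq> {}"
      using t1 sup less_SUP_iff[of "ennreal t" f UNIV] less_SUP_iff[of "ennreal t" g UNIV] by auto
    have "vol {x. ennreal t < f x} + vol {x. ennreal t < g x}
      \<le> 2 * vol {x. ennreal t < h x}"
    proof (rule brunn_minkowski_real)
      fix a b assume ab: "a \<in> {x. ennreal t < f x}" "b \<in> {x. ennreal t < g x}"
      define u where "u = min (f a) (g b)"
      have "u \<le> f a" "u \<le> g b" "ennreal t < u" using ab by (auto simp: u_def)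
      moreover have "u \<noteq> \<infinity>" using f1[of a] \<open>u \<le> f a\<close> by (auto simp: top_unique)
      ultimately obtain v where v: "u = ennreal v" "t < v" "0 < v"
        using True by (cases u) (auto simp: ennreal_less_iff)
      have "(ennreal t)\<^sup>2 < u * u"
        using v True by (simp add: power2_eq_square ennreal_mult[symmetric] ennreal_less_iff mult_strict_mono)
      also have "\<dots> \<le> f a * g b"
        using \<open>u \<le> f a\<close> \<open>u \<le> g b\<close> by (intro mult_mono) auto
      also have "\<dots> \<le> (h ((a + b) / 2))\<^sup>2" by (rule mid)
      finally have "ennreal t < h ((a + b) / 2)"
        by (meson linorder_not_le power_mono zero_le)
      then show "(a + b) / 2 \<in> {x. ennreal t < h x}" by simp
    qed (use ne in auto)
    then show ?thesis using True by simp
  next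
    case False
    have "vol {x. ennreal t < f x} = 0" "vol {x. ennreal t < g x} = 0" if "t \<ge> 1"
    proof -
      have "1 \<le> ennreal t" using that by simp
      then have "\<not> ennreal t < f x" "\<not> ennreal t < g x" for x 
        using f1[of x] g1[of x] by (auto simp: not_less intro: order_trans)
      then show "vol {x. ennreal t < f x} = 0" "vol {x. ennreal t < g x} = 0"
        by simp_all
    qed
    then show ?thesis using False by (auto simp: indicator_def)
  qed
  have sf: "sigma_finite_measure (lborel :: real measure)" ..
  have "(\<integral>\<^sup>+x. f x \<partial>lborel) + (\<integral>\<^sup>+x. g x \<partial>lborel) =
     (\<integral>\<^sup>+t. indicator {0<..} t * vol {x\<in>space lborel. ennreal t < f x}
      + indicator {0<..} t * vol {x\<in>space lborel. ennreal t < g x} \<partial>lborel)"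
    by (subst (1 2) nn_integral_layer_cake[OF sf]) (auto intro!: nn_integral_add[symmetric])
  also have "\<dots> \<le> (\<integral>\<^sup>+t. 2 * (indicator {0<..} t * vol {x\<in>space lborel. ennreal t < h x}) \<partial>lborel)"
    by (intro nn_integral_mono *)
  also have "\<dots> = 2 * (\<integral>\<^sup>+t. indicator {0<..} t * vol {x\<in>space lborel. ennreal t < h x} \<partial>lborel)"
    by (intro nn_integral_cmult) auto
  also have "\<dots> = 2 * (\<integral>\<^sup>+x. h x \<partial>lborel)"
    by (subst nn_integral_layer_cake[OF sf, of h]) auto
  finally show ?thesis .
qed

text \<open>Dividing \<open>f\<close>, \<open>g\<close> and \<open>h\<close> by \<open>a\<close>,
  \<open>b\<close> and \<open>sqrt (a * b)\<close> preserves the midpoint hypothesis and reduces to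
  supremum 1. The bound on the sum gives one on the product because \<open>4 * (x * y)\<close> is at
  most the square of \<open>x + y\<close>, and the factors cancel.\<close>

lemma prekopa_leindler_bounded:
  fixes f g h :: "real \<Rightarrow> ennreal"
  assumes [measurable]: "f \<in> borel_measurable borel" "g \<in> borel_measurable borel" "h \<in> borel_measurable borel"
    and fin: "(SUP x. f x) < \<infinity>" "(SUP x. g x) < \<infinity>"
    and mid: "\<And>x y. f x * g y \<le> (h ((x + y) / 2))\<^sup>2"
  shows "(\<integral>\<^sup>+x. f x \<partial>lborel) * (\<integral>\<^sup>+x. g x \<partial>lborel) \<le> (\<integral>\<^sup>+x. h x \<partial>lborel)\<^sup>2"
proof (cases "(SUP x. f x) = 0 \<or> (SUP x. g x) = 0")
  case True
  then have "(\<forall>x. f x = 0) \<or> (\<forall>x. g x = 0)"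
    by (metis SUP_upper UNIV_I le_zero_eq)
  then show ?thesis by auto
next
  case False
  define a where "a = enn2real (SUP x. f x)"
  define b where "b = enn2real (SUP x. g x)"
  have a: "ennreal a = (SUP x. f x)" "a > 0"
    using fin False by (auto simp: a_def enn2real_positive_iff zero_less_iff_neq_zero)
  have b: "ennreal b = (SUP x. g x)" "b > 0"
    using fin False by (auto simp: b_def enn2real_positive_iff zero_less_iff_neq_zero)
  define r where "r = sqrt (a * b)"
  have r: "r > 0" "r * r = a * b" using a b by (auto simp: r_def)
  define F where "F = (\<integral>\<^sup>+x. f x \<partial>lborel)"
  define G where "G = (\<integral>\<^sup>+x. g x \<partial>lborel)"
  define H where "H = (\<integral>\<^sup>+x. h x \<partial>lborel)"
  have "(\<integral>\<^sup>+x. ennreal (1 / a) * f x \<partial>lborel) + (\<integral>\<^sup>+x. ennreal (1 / b) * g x \<partial>lborel)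
      \<le> 2 * (\<integral>\<^sup>+x. ennreal (1 / r) * h x \<partial>lborel)"
  proof (rule prekopa_leindler_normalised)
    show "(SUP x. ennreal (1 / a) * f x) = 1" 
      using a by (simp add: SUP_mult_left_ennreal[symmetric] a(1)[symmetric] ennreal_mult[symmetric])
    show "(SUP x. ennreal (1 / b) * g x) = 1" 
      using b by (simp add: SUP_mult_left_ennreal[symmetric] b(1)[symmetric] ennreal_mult[symmetric])
    fix x y
    have "ennreal (1 / a) * f x * (ennreal (1 / b) * g y) = ennreal (1 / (a * b)) * (f x * g y)"
    proof -
      have "ennreal (1 / (a * b)) = ennreal (1 / a) * ennreal (1 / b)"
        using a b by (simp flip: ennreal_mult)
      then show ?thesis by (simp add: ac_simps)
    qed
    also have "\<dots> \<le> ennreal (1 / (a * b)) * (h ((x + y) / 2))\<^sup>2"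
      by (intro mult_left_mono mid) simp
    also have "ennreal (1 / (a * b)) = (ennreal (1 / r))\<^sup>2"
      using r by (simp add: power2_eq_square ennreal_mult[symmetric])
    finally show "ennreal (1 / a) * f x * (ennreal (1 / b) * g y) \<le> (ennreal (1 / r) * h ((x + y) / 2))\<^sup>2"
      by (simp add: power_mult_distrib)
  qed auto
  then have *: "ennreal (1 / a) * F + ennreal (1 / b) * G \<le> 2 * (ennreal (1 / r) * H)"
    by (simp add: nn_integral_cmult F_def G_def H_def)
  have "F * G \<le> H\<^sup>2"
  proof (cases "H = \<infinity>")
    case True
    then show ?thesis by (simp add: power2_eq_square)
  next
    case False
    then have lt: "2 * (ennreal (1 / r) * H) < \<infinity>" by (simp add: ennreal_mult_less_top less_top)
    then have "ennreal (1 / a) * F < \<infinity>" "ennreal (1 / b) * G < \<infinity>"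
      using le_less_trans[OF * lt] by (simp_all only: infinity_ennreal_def ennreal_add_less_top)
    then have "F \<noteq> \<infinity>" "G \<noteq> \<infinity>"
      using a b by (auto simp: ennreal_mult_less_top ennreal_mult_top)
    then obtain u v w where uvw: "F = ennreal u" "G = ennreal v" "H = ennreal w" "u \<ge> 0" "v \<ge> 0" "w \<ge> 0"
      using False by (metis ennreal_cases infinity_ennreal_def)
    have "u / a + v / b \<le> 2 * (w / r)"
    proof -
      have "ennreal (u / a + v / b) = ennreal (1 / a) * F + ennreal (1 / b) * G"
        using uvw a b by (simp add: ennreal_mult'[symmetric])
      also have "\<dots> \<le> 2 * (ennreal (1 / r) * H)" by (rule *)
      also have "2 * (ennreal (1 / r) * H) = ennreal (2 * (w / r))"
      proof -
        have "ennreal (2 * (w / r)) = ennreal 2 * ennreal (1 / r * w)"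
          using uvw r by (subst ennreal_mult[symmetric]) auto
        also have "ennreal (1 / r * w) = ennreal (1 / r) * H"
          using uvw r by (subst ennreal_mult) auto
        finally show ?thesis by simp
      qed
      finally show ?thesis using uvw r by (subst (asm) ennreal_le_iff) auto
    qed
    moreover have "0 \<le> u / a + v / b" using uvw a b by simp
    ultimately have "(u / a + v / b)\<^sup>2 \<le> (2 * (w / r))\<^sup>2" by (rule power_mono)
    moreover have "4 * ((u / a) * (v / b)) \<le> (u / a + v / b)\<^sup>2"
    proof -
      have "4 * (x * y) \<le> (x + y)\<^sup>2" for x y :: real
        using zero_le_power2[of "x - y"] by (simp add: power2_eq_square algebra_simps)
      then show ?thesis .
    qed
    ultimately have "4 * ((u / a) * (v / b)) \<le> (2 * (w / r))\<^sup>2" by linarith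
    then have "u * v / (a * b) \<le> w\<^sup>2 / (r * r)" by (simp add: power2_eq_square)
    then have "u * v \<le> w\<^sup>2" using a b r by (simp add: divide_simps mult_pos_pos)
    then show ?thesis using uvw by (simp add: ennreal_mult[symmetric] ennreal_power)
  qed
  then show ?thesis by (simp add: F_def G_def H_def)
qed

text \<open>Truncating \<open>f\<close> and \<open>g\<close> at \<open>n\<close> keeps the midpoint
  hypothesis with the same \<open>h\<close>, so monotone convergence removes the
  boundedness.\<close>

lemma prekopa_leindler_real:
  fixes f g h :: "real \<Rightarrow> ennreal"
  assumes [measurable]: "f \<in> borel_measurable borel" "g \<in> borel_measurable borel" "h \<in> borel_measurable borel"
    and mid: "\<And>x y. f x * g y \<le> (h ((x + y) / 2))\<^sup>2"
  shows "(\<integral>\<^sup>+x. f x \<partial>lborel) * (\<integral>\<^sup>+x. g x \<partial>lborel) \<le> (\<integral>\<^sup>+x. h x \<partial>lborel)\<^sup>2"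
proof -
  define H where "H = (\<integral>\<^sup>+x. h x \<partial>lborel)"
  have SUPmin: "(SUP n. min y (of_nat n)) = y" for y :: ennreal
  proof (rule antisym)
    show "y \<le> (SUP n. min y (of_nat n))"
    proof (rule le_SUP_iff[THEN iffD2], intro allI impI)
      fix z assume z: "z < y"
      then obtain n where "z < of_nat n" by (metis ennreal_Ex_less_of_nat less_top order_less_le_trans top_greatest)
      then show "\<exists>n\<in>UNIV. z < min y (of_nat n)" using z by auto
    qed
  qed (auto intro!: SUP_least)
  have lim: "(\<integral>\<^sup>+x. k x \<partial>lborel) = (SUP n. \<integral>\<^sup>+x. min (k x) (of_nat n) \<partial>lborel)"
    if [measurable]: "k \<in> borel_measurable borel" for k :: "real \<Rightarrow> ennreal"
  proof -
    have "(\<integral>\<^sup>+x. k x \<partial>lborel) = (\<integral>\<^sup>+x. (SUP n. min (k x) (of_nat n)) \<partial>lborel)"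
      by (simp only: SUPmin)
    also have "\<dots> = (SUP n. \<integral>\<^sup>+x. min (k x) (of_nat n) \<partial>lborel)"
      by (rule nn_integral_monotone_convergence_SUP)
         (auto simp: incseq_def le_fun_def intro: min.mono min.coboundedI2)
    finally show ?thesis .
  qed
  have *: "(\<integral>\<^sup>+x. min (f x) (of_nat n) \<partial>lborel) * (\<integral>\<^sup>+x. min (g x) (of_nat n) \<partial>lborel) \<le> H\<^sup>2" for n
    unfolding H_def
  proof (rule prekopa_leindler_bounded)
    have "(SUP x. min (k x) (of_nat n)) < \<infinity>" for k :: "real \<Rightarrow> ennreal"
      by (rule le_less_trans[of _ "of_nat n"]) (auto intro!: SUP_least simp: less_top[symmetric])
    then show "(SUP x. min (f x) (of_nat n)) < \<infinity>" "(SUP x. min (g x) (of_nat n)) < \<infinity>" by auto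
    show "min (f x) (of_nat n) * min (g y) (of_nat n) \<le> (h ((x + y) / 2))\<^sup>2" for x y
      by (rule order_trans[OF _ mid]) (intro mult_mono, auto)
  qed auto
  \<comment> \<open>Independent truncation levels allow the two suprema to be taken one factor at a
    time.\<close>
  have **: "(\<integral>\<^sup>+x. min (f x) (of_nat m) \<partial>lborel) * (\<integral>\<^sup>+x. min (g x) (of_nat n) \<partial>lborel) \<le> H\<^sup>2" for m n
    by (rule order_trans[OF _ *[of "max m n"]])
       (intro mult_mono nn_integral_mono min.mono, auto)
  define A where "A n = (\<integral>\<^sup>+x. min (f x) (of_nat n) \<partial>lborel)" for n
  define B where "B n = (\<integral>\<^sup>+x. min (g x) (of_nat n) \<partial>lborel)" for n
  have "A m * (SUP n. B n) \<le> H\<^sup>2" for m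
    unfolding SUP_mult_left_ennreal using ** by (intro SUP_least) (simp add: A_def B_def)
  then have "(SUP m. A m) * (SUP n. B n) \<le> H\<^sup>2"
    unfolding SUP_mult_right_ennreal by (intro SUP_least)
  then show ?thesis
    by (simp add: lim[of f] lim[of g] A_def B_def H_def)
qed

text \<open>Integrating out one coordinate preserves the hypothesis: with the remaining coordinates
  fixed, this is the one-dimensional inequality along that coordinate. The arguments are extensional
  functions since these form the space of the product measure; over the empty index set a single
  point remains.\<close>

lemma prekopa_leindler_PiM:
  fixes f g h :: "('i \<Rightarrow> real) \<Rightarrow> ennreal"
  assumes "finite I"
    and "f \<in> borel_measurable (\<Pi>\<^sub>M i\<in>I. lborel)" "g \<in> borel_measurable (\<Pi>\<^sub>M i\<in>I. lborel)"
      "h \<in> borel_measurable (\<Pi>\<^sub>M i\<in>I. lborel)"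
    and "\<And>x y :: 'i \<Rightarrow> real. x \<in> extensional I \<Longrightarrow> y \<in> extensional I \<Longrightarrow> f x * g y \<le> (h (\<lambda>i\<in>I. (x i + y i) / 2))\<^sup>2"
  shows "(\<integral>\<^sup>+x. f x \<partial>(\<Pi>\<^sub>M i\<in>I. lborel)) * (\<integral>\<^sup>+x. g x \<partial>(\<Pi>\<^sub>M i\<in>I. lborel))
    \<le> (\<integral>\<^sup>+x. h x \<partial>(\<Pi>\<^sub>M i\<in>I. lborel))\<^sup>2"
  using assms
proof (induction I arbitrary: f g h rule: finite_induct)
  case empty
  interpret product_sigma_finite "\<lambda>_. lborel :: real measure" ..
  show ?case using empty.prems(4)[of "\<lambda>_. undefined" "\<lambda>_. undefined"]
    by (simp add: nn_integral_empty restrict_def)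
next
  case (insert i I)
  interpret product_sigma_finite "\<lambda>_. lborel :: real measure" ..
  note [measurable] = insert.prems(1-3)
  have upd[measurable]: "(\<lambda>(x, y). x(i := y)) \<in> (\<Pi>\<^sub>M i\<in>I. lborel) \<Otimes>\<^sub>M (lborel::real measure) \<rightarrow>\<^sub>M (\<Pi>\<^sub>M i\<in>insert i I. lborel)"
    by (rule measurable_add_dim)
  have m: "(\<lambda>x. \<integral>\<^sup>+y. k (x(i := y)) \<partial>lborel) \<in> borel_measurable (\<Pi>\<^sub>M i\<in>I. lborel)"
    if [measurable]: "k \<in> borel_measurable (\<Pi>\<^sub>M i\<in>insert i I. lborel)" for k :: "_ \<Rightarrow> ennreal"
    by measurable
  have m1: "(\<lambda>y. k (x(i := y))) \<in> borel_measurable borel"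
    if [measurable]: "k \<in> borel_measurable (\<Pi>\<^sub>M i\<in>insert i I. lborel)" and x: "x \<in> extensional I" for k :: "('i \<Rightarrow> real) \<Rightarrow> ennreal" and x
  proof -
    have "x \<in> space (\<Pi>\<^sub>M i\<in>I. lborel)" using x by (simp add: space_PiM PiE_def)
    from measurable_component_update[OF this insert.hyps(2)] 
    have [measurable]: "(\<lambda>y. x(i := y)) \<in> lborel \<rightarrow>\<^sub>M (\<Pi>\<^sub>M i\<in>insert i I. lborel)" by simp
    have "(\<lambda>y. k (x(i := y))) \<in> borel_measurable lborel" by measurable
    then show ?thesis by simp
  qed
  show ?case
    unfolding product_nn_integral_insert[OF insert.hyps insert.prems(1)]
      product_nn_integral_insert[OF insert.hyps insert.prems(2)]
      product_nn_integral_insert[OF insert.hyps insert.prems(3)]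
  proof (rule insert.IH)
    fix x y :: "'i \<Rightarrow> real" assume x: "x \<in> extensional I" and y: "y \<in> extensional I"
    let ?m = "\<lambda>i\<in>I. (x i + y i) / 2"
    show "(\<integral>\<^sup>+t. f (x(i := t)) \<partial>lborel) * (\<integral>\<^sup>+t. g (y(i := t)) \<partial>lborel) \<le> (\<integral>\<^sup>+t. h (?m(i := t)) \<partial>lborel)\<^sup>2"
    proof (rule prekopa_leindler_real)
      fix s t
      have "f (x(i := s)) * g (y(i := t)) \<le> (h (\<lambda>j\<in>insert i I. ((x(i := s)) j + (y(i := t)) j) / 2))\<^sup>2"
        using x y by (intro insert.prems(4)) (auto simp: extensional_def)
      also have "(\<lambda>j\<in>insert i I. ((x(i := s)) j + (y(i := t)) j) / 2) = ?m(i := (s + t) / 2)"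
        using insert.hyps(2) by (auto simp: fun_eq_iff)
      finally show "f (x(i := s)) * g (y(i := t)) \<le> (h (?m(i := (s + t) / 2)))\<^sup>2" .
    qed (use x y in \<open>auto intro!: m1\<close>)
  qed (intro m insert.prems(1-3))+
qed

section \<open>Anderson's theorem\<close>

text \<open>For densities \<open>g i\<close> of independent columns this is the probability that the
  tuple of columns lies in \<open>K\<close>; for indicators it is the volume of \<open>K\<close>
  inside a box. Tuples are functions under a product measure, so that Fubini can single out one
  column, or one line in every column.\<close>

definition multi_integral :: "('i::finite \<Rightarrow> 'a::euclidean_space) set \<Rightarrow> ('i \<Rightarrow> 'a \<Rightarrow> ennreal) \<Rightarrow> ennreal"
  where "multi_integral K g =
    (\<integral>\<^sup>+x. indicator K x * (\<Prod>i\<in>UNIV. g i (x i)) \<partial>(\<Pi>\<^sub>M i\<in>UNIV. lborel))"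

abbreviation multi_volume :: "('i::finite \<Rightarrow> 'a::euclidean_space) set \<Rightarrow> ('i \<Rightarrow> 'a set) \<Rightarrow> ennreal"
  where "multi_volume K A \<equiv> multi_integral K (\<lambda>i. indicator (A i))"

abbreviation lborel_PiM :: "('i \<Rightarrow> 'a::euclidean_space) measure"
  where "lborel_PiM \<equiv> (\<Pi>\<^sub>M i\<in>UNIV. lborel)"

lemma product_sigma_finite_lborel: "product_sigma_finite (\<lambda>_. lborel)"
  ..

lemma space_lborel_PiM [simp]: "space lborel_PiM = UNIV"
  by (simp add: space_PiM)

lemma prod_indicator:
  "finite I \<Longrightarrow> (\<Prod>i\<in>I. indicator (A i) (x i)) = (indicator {x. \<forall>i\<in>I. x i \<in> A i} x :: 'b::comm_semiring_1)"
  by (induction I rule: finite_induct) (auto simp: indicator_def)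

lemma sets_box [measurable]:
  fixes A :: "'i::finite \<Rightarrow> 'a::euclidean_space set"
  assumes [measurable]: "\<And>i. A i \<in> sets borel"
  shows "{x. \<forall>i. x i \<in> A i} \<in> sets lborel_PiM"
proof -
  have "{x\<in>space lborel_PiM. \<forall>i. x i \<in> A i} \<in> sets lborel_PiM"
    by measurable
  then show ?thesis by simp
qed

lemma emeasure_box:
  fixes A :: "'i::finite \<Rightarrow> 'a::euclidean_space set"
  assumes [measurable]: "\<And>i. A i \<in> sets borel"
  shows "emeasure lborel_PiM {x. \<forall>i. x i \<in> A i} = (\<Prod>i\<in>UNIV. vol (A i))"
proof -
  interpret product_sigma_finite "\<lambda>_::'i. lborel :: 'a measure" by (rule product_sigma_finite_lborel)
  have "{x. \<forall>i. x i \<in> A i} = Pi\<^sub>E UNIV A" by (auto simp: PiE_def Pi_def)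
  then show ?thesis by (simp add: emeasure_PiM)
qed

lemma multi_volume_eq:
  assumes [measurable]: "K \<in> sets lborel_PiM" "\<And>i. A i \<in> sets borel"
  shows "multi_volume K A = emeasure lborel_PiM (K \<inter> {x. \<forall>i. x i \<in> A i})"
proof -
  have "multi_volume K A = (\<integral>\<^sup>+x. indicator (K \<inter> {x. \<forall>i. x i \<in> A i}) x \<partial>lborel_PiM)"
    unfolding multi_integral_def
    by (intro nn_integral_cong) (auto simp: prod_indicator indicator_def)
  then show ?thesis by simp
qed

lemma multi_integral_mono:
  "(\<And>i x. g i x \<le> h i x) \<Longrightarrow> multi_integral K g \<le> multi_integral K h"
  unfolding multi_integral_def by (intro nn_integral_mono mult_left_mono prod_mono_ennreal) auto

lemma multi_volume_mono:
  "(\<And>i. A i \<subseteq> B i) \<Longrightarrow> multi_volume K A \<le> multi_volume K B"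
  by (intro multi_integral_mono) (auto simp: indicator_def)

text \<open>Fatou's lemma. Monotone convergence would not do, because the approximants need not
  increase with \<open>n\<close>: the grids used below are not nested.\<close>

lemma multi_integral_le_eventually:
  fixes K :: "('i::finite \<Rightarrow> 'a::euclidean_space) set"
  assumes [measurable]: "K \<in> sets lborel_PiM" "\<And>n i. h n i \<in> borel_measurable borel"
    and ev: "\<And>i x. \<forall>\<^sub>F n in sequentially. g i x \<le> h n i x"
    and le: "\<And>n. multi_integral K (h n) \<le> m"
  shows "multi_integral K g \<le> m"
proof -
  let ?G = "\<lambda>n x. indicator K x * (\<Prod>i\<in>UNIV. h n i (x i))"
  have "multi_integral K g \<le> (\<integral>\<^sup>+x. liminf (\<lambda>n. ?G n x) \<partial>lborel_PiM)"
    unfolding multi_integral_def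
  proof (rule nn_integral_mono)
    fix x :: "'i \<Rightarrow> 'a"
    have "\<forall>\<^sub>F n in sequentially. \<forall>i\<in>UNIV. g i (x i) \<le> h n i (x i)"
      by (intro eventually_ball_finite finite ballI ev)
    then have "\<forall>\<^sub>F n in sequentially. indicator K x * (\<Prod>i\<in>UNIV. g i (x i)) \<le> ?G n x"
      by eventually_elim (intro mult_left_mono prod_mono_ennreal, auto)
    then show "indicator K x * (\<Prod>i\<in>UNIV. g i (x i)) \<le> liminf (\<lambda>n. ?G n x)"
      by (rule Liminf_bounded)
  qed
  also have "\<dots> \<le> liminf (\<lambda>n. \<integral>\<^sup>+x. ?G n x \<partial>lborel_PiM)"
    by (intro nn_integral_liminf) measurable
  also have "\<dots> \<le> limsup (\<lambda>n. \<integral>\<^sup>+x. ?G n x \<partial>lborel_PiM)"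
    by (rule Liminf_le_Limsup) simp
  also have "\<dots> \<le> m"
    by (rule Limsup_bounded, rule always_eventually, rule allI)
       (use le in \<open>simp add: multi_integral_def\<close>)
  finally show ?thesis .
qed

text \<open>A point of the first box outside the second has some coordinate \<open>i\<close> in
  \<open>A i - B i\<close>; the corresponding summand bounds the volume of such points with
  \<open>K\<close> dropped.\<close>

lemma multi_volume_le:
  assumes [measurable]: "K \<in> sets lborel_PiM" "\<And>i. A i \<in> sets borel" "\<And>i. B i \<in> sets borel"
  shows "multi_volume K A \<le> multi_volume K B
    + (\<Sum>i\<in>UNIV. vol (A i - B i) * (\<Prod>j\<in>UNIV - {i}. vol (A j)))"
proof -
  let ?D = "\<lambda>i. {x. \<forall>j. x j \<in> (if j = i then A j - B j else A j)}"
  have D[measurable]: "?D i \<in> sets lborel_PiM" for i by (rule sets_box) auto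
  have U[measurable]: "(\<Union>i. ?D i) \<in> sets lborel_PiM" using D by (intro sets.finite_UN) auto
  have "K \<inter> {x. \<forall>i. x i \<in> A i} \<subseteq> (K \<inter> {x. \<forall>i. x i \<in> B i}) \<union> (\<Union>i. ?D i)"
    by auto
  then have "multi_volume K A \<le> emeasure lborel_PiM ((K \<inter> {x. \<forall>i. x i \<in> B i}) \<union> (\<Union>i. ?D i))"
    unfolding multi_volume_eq[OF assms(1,2)] by (rule emeasure_mono) measurable
  also have "\<dots> \<le> emeasure lborel_PiM (K \<inter> {x. \<forall>i. x i \<in> B i}) + emeasure lborel_PiM (\<Union>i. ?D i)"
    by (intro emeasure_subadditive) measurable
  also have "emeasure lborel_PiM (\<Union>i. ?D i) \<le> (\<Sum>i\<in>UNIV. emeasure lborel_PiM (?D i))"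
    by (rule emeasure_subadditive_finite[OF finite image_subsetI[OF D]])
  also have "\<dots> = (\<Sum>i\<in>UNIV. vol (A i - B i) * (\<Prod>j\<in>UNIV - {i}. vol (A j)))"
  proof (intro sum.cong refl)
    fix i
    have "emeasure lborel_PiM (?D i) = (\<Prod>j\<in>UNIV. vol (if j = i then A j - B j else A j))"
      by (rule emeasure_box) auto
    also have "\<dots> = vol (A i - B i) * (\<Prod>j\<in>UNIV - {i}. vol (A j))"
      by (subst prod.remove[of UNIV i]) (auto intro!: prod.cong arg_cong2[where f="(*)"])
    finally show "emeasure lborel_PiM (?D i) = vol (A i - B i) * (\<Prod>j\<in>UNIV - {i}. vol (A j))" .
  qed
  finally show ?thesis by (simp add: multi_volume_eq add_left_mono)
qed

text \<open>Only the part of \<open>D i\<close> outside \<open>B i\<close> has to be small: by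
  \<open>multi_volume_le\<close>, points of \<open>B i\<close> missing from \<open>D i\<close> do no
  harm. The bound \<open>b\<close> controls the other factors of the error uniformly in
  \<open>d\<close>.\<close>

lemma multi_volume_approx:
  fixes K :: "('i::finite \<Rightarrow> 'a::euclidean_space) set"
  assumes Km: "K \<in> sets lborel_PiM" and B: "\<And>i. B i \<in> sets borel" and b: "\<And>i. 0 \<le> b i"
    and approx: "\<And>d. 0 < d \<Longrightarrow> d \<le> 1 \<Longrightarrow> \<exists>D. (\<forall>i. D i \<in> sets borel \<and> vol (D i) \<le> ennreal (b i) \<and>
      vol (D i - B i) \<le> ennreal d) \<and> m \<le> multi_volume K D"
  shows "m \<le> multi_volume K B"
proof (rule ennreal_le_epsilon)
  fix e :: real assume e: "0 < e"
  define C where "C = (\<Sum>i\<in>(UNIV::'i set). \<Prod>j\<in>UNIV - {i}. b j)"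
  have C: "0 \<le> C" unfolding C_def using b by (intro sum_nonneg prod_nonneg) auto
  \<comment> \<open>\<open>C\<close> bounds the error per unit of \<open>d\<close>; the 1 added to
    the denominator covers \<open>C = 0\<close>.\<close>
  define d where "d = min 1 (e / (C + 1))"
  have d: "0 < d" "d \<le> 1" using e C by (auto simp: d_def)
  have "d * C \<le> e / (C + 1) * (C + 1)" using e C by (intro mult_mono) (auto simp: d_def)
  then have dC: "d * C \<le> e" using C by simp
  obtain D where D: "\<And>i. D i \<in> sets borel" "\<And>i. vol (D i) \<le> ennreal (b i)"
    "\<And>i. vol (D i - B i) \<le> ennreal d" "m \<le> multi_volume K D"
    using approx[OF d] by blast
  have "m \<le> multi_volume K B + (\<Sum>i\<in>UNIV. vol (D i - B i) * (\<Prod>j\<in>UNIV - {i}. vol (D j)))"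
    using D(4) multi_volume_le[OF Km D(1) B] by (rule order_trans)
  also have "(\<Sum>i\<in>UNIV. vol (D i - B i) * (\<Prod>j\<in>UNIV - {i}. vol (D j)))
      \<le> (\<Sum>i\<in>(UNIV::'i set). ennreal d * ennreal (\<Prod>j\<in>UNIV - {i}. b j))"
  proof (intro sum_mono mult_mono D(3))
    fix i
    have "(\<Prod>j\<in>UNIV - {i}. vol (D j)) \<le> (\<Prod>j\<in>UNIV - {i}. ennreal (b j))"
      by (intro prod_mono_ennreal D(2))
    also have "\<dots> = ennreal (\<Prod>j\<in>UNIV - {i}. b j)" using b by (intro prod_ennreal)
    finally show "(\<Prod>j\<in>UNIV - {i}. vol (D j)) \<le> ennreal (\<Prod>j\<in>UNIV - {i}. b j)" .
  qed auto
  also have "\<dots> = ennreal (d * C)"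
    unfolding C_def using b d
    by (simp add: sum_distrib_left[symmetric] ennreal_mult sum_nonneg prod_nonneg)
  also have "\<dots> \<le> ennreal e" using dC by (intro ennreal_leI)
  finally show "m \<le> multi_volume K B + ennreal e" by (simp add: add_left_mono)
qed

section \<open>Affine maps of real tuples\<close>

lemma lborel_PiM_affine:
  fixes b :: "'i::finite \<Rightarrow> real"
  assumes a: "a \<noteq> 0"
  shows "lborel_PiM = scale_measure (ennreal \<bar>a\<bar> ^ CARD('i)) (distr lborel_PiM lborel_PiM (\<lambda>x i. b i + a * x i))"
proof -
  interpret product_sigma_finite "\<lambda>_::'i. lborel :: real measure" by (rule product_sigma_finite_lborel)
  have [measurable]: "(\<lambda>x i. b i + a * x i) \<in> lborel_PiM \<rightarrow>\<^sub>M lborel_PiM"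
    by (rule measurable_PiM_single') auto
  show ?thesis
  proof (rule PiM_eqI[symmetric])
    fix A :: "'i \<Rightarrow> real set" assume "\<And>i. i \<in> UNIV \<Longrightarrow> A i \<in> sets lborel"
    then have [measurable]: "\<And>i. A i \<in> sets borel" by simp
    have eq: "Pi\<^sub>E UNIV A = {x. \<forall>i. x i \<in> A i}" by (auto simp: PiE_def Pi_def)
    have "emeasure (scale_measure (ennreal \<bar>a\<bar> ^ CARD('i)) (distr lborel_PiM lborel_PiM (\<lambda>x i. b i + a * x i))) (Pi\<^sub>E UNIV A)
      = ennreal \<bar>a\<bar> ^ CARD('i) * emeasure lborel_PiM {x. \<forall>i. x i \<in> {y. b i + a * y \<in> A i}}"
      unfolding eq by (simp add: emeasure_distr vimage_def)
    also have "\<dots> = (\<Prod>i\<in>UNIV. ennreal \<bar>a\<bar> * vol {y. b i + a * y \<in> A i})"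
      by (subst emeasure_box) (auto simp: prod.distrib)
    also have "\<dots> = (\<Prod>i\<in>UNIV. vol (A i))"
      using a by (intro prod.cong refl emeasure_affine_vimage[symmetric]) auto
    finally show "emeasure (scale_measure (ennreal \<bar>a\<bar> ^ CARD('i)) (distr lborel_PiM lborel_PiM (\<lambda>x i. b i + a * x i))) (Pi\<^sub>E UNIV A)
      = (\<Prod>i\<in>UNIV. vol (A i))" .
  qed auto
qed

text \<open>One formula for three uses below: reflection (\<open>a = -1\<close>), translation
  (\<open>a = 1\<close>) and shrinking towards a point (\<open>a\<close> between 1/2 and 1).\<close>

lemma emeasure_PiM_affine:
  fixes b :: "'i::finite \<Rightarrow> real"
  assumes a: "a \<noteq> 0" and [measurable]: "A \<in> sets lborel_PiM"
  shows "emeasure lborel_PiM A = ennreal \<bar>a\<bar> ^ CARD('i) * emeasure lborel_PiM {x. (\<lambda>i. b i + a * x i) \<in> A}"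
proof -
  have [measurable]: "(\<lambda>x i. b i + a * x i) \<in> lborel_PiM \<rightarrow>\<^sub>M lborel_PiM"
    by (rule measurable_PiM_single') auto
  show ?thesis
    by (subst lborel_PiM_affine[OF a, of b]) (simp add: emeasure_distr vimage_def)
qed

section \<open>Sliding a symmetric convex set to the centre\<close>

definition fun_convex :: "('i \<Rightarrow> 'a::real_vector) set \<Rightarrow> bool" where
  "fun_convex K \<longleftrightarrow> (\<forall>x\<in>K. \<forall>y\<in>K. \<forall>u\<in>{0..1}. (\<lambda>i. (1 - u) *\<^sub>R x i + u *\<^sub>R y i) \<in> K)"

definition fun_symmetric :: "('i \<Rightarrow> 'a::real_vector) set \<Rightarrow> bool" where
  "fun_symmetric K \<longleftrightarrow> (\<forall>x\<in>K. (\<lambda>i. - x i) \<in> K)"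

context
  fixes K L :: "('i::finite \<Rightarrow> real) set" and c :: "'i \<Rightarrow> real"
  assumes Km[measurable]: "K \<in> sets lborel_PiM" and Lm[measurable]: "L \<in> sets lborel_PiM"
    and conv: "fun_convex K" "fun_convex L"
    and sym: "fun_symmetric K" "fun_symmetric L"
    and fin: "emeasure lborel_PiM L < \<infinity>"
begin

private definition S where "S s = K \<inter> {x. (\<lambda>i. x i - s * c i) \<in> L}"
private definition H where "H s = emeasure lborel_PiM (S s)"

private lemma shift_measurable [measurable]: "(\<lambda>x i. x i - s * c i) \<in> lborel_PiM \<rightarrow>\<^sub>M lborel_PiM"
  by (rule measurable_PiM_single') auto

private lemma S_measurable [measurable]: "S s \<in> sets lborel_PiM"
proof -
  have "{x \<in> space lborel_PiM. (\<lambda>i. x i - s * c i) \<in> L} \<in> sets lborel_PiM" by measurable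
  then show ?thesis by (simp add: S_def)
qed

private lemma K_comb: "x \<in> K \<Longrightarrow> y \<in> K \<Longrightarrow> 0 \<le> u \<Longrightarrow> u \<le> 1 \<Longrightarrow> (\<lambda>i. (1 - u) * x i + u * y i) \<in> K"
  using conv(1) by (auto simp: fun_convex_def)

private lemma L_comb: "x \<in> L \<Longrightarrow> y \<in> L \<Longrightarrow> 0 \<le> u \<Longrightarrow> u \<le> 1 \<Longrightarrow> (\<lambda>i. (1 - u) * x i + u * y i) \<in> L"
  using conv(2) by (auto simp: fun_convex_def)

text \<open>The pairs \<open>(s, x)\<close> with \<open>x\<close> in \<open>S s\<close> form a
  convex set, since the shift is linear in \<open>s\<close>. Both the log-concavity of
  \<open>H\<close> and its lower bound come from this.\<close>

private lemma S_comb: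
  assumes "x \<in> S s" "y \<in> S t" "0 \<le> u" "u \<le> 1"
  shows "(\<lambda>i. (1 - u) * x i + u * y i) \<in> S ((1 - u) * s + u * t)"
proof -
  have "(\<lambda>i. (1 - u) * (x i - s * c i) + u * (y i - t * c i)) \<in> L"
    using assms by (intro L_comb) (auto simp: S_def)
  also have "(\<lambda>i. (1 - u) * (x i - s * c i) + u * (y i - t * c i)) =
     (\<lambda>i. ((1 - u) * x i + u * y i) - ((1 - u) * s + u * t) * c i)"
    by (auto simp: fun_eq_iff algebra_simps)
  finally show ?thesis using assms K_comb by (auto simp: S_def)
qed

private lemma S_uminus: "x \<in> S s \<Longrightarrow> (\<lambda>i. - x i) \<in> S (- s)"
proof -
  assume x: "x \<in> S s"
  then have "(\<lambda>i. - (x i - s * c i)) \<in> L" using sym by (auto simp: S_def fun_symmetric_def)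
  then show ?thesis using sym x by (auto simp: S_def fun_symmetric_def)
qed

text \<open>\<open>s\<close> is the midpoint of \<open>1\<close> and \<open>2 * s - 1\<close>, so
  midpoints of \<open>S 1\<close> and \<open>S (2 * s - 1)\<close> lie in \<open>S s\<close>, and
  Prekopa--Leindler applies to the three indicators. One argument stays at 1, the position from
  which \<open>anderson\<close> slides.\<close>

private lemma H_mid: "H 1 * H (2 * s - 1) \<le> (H s)\<^sup>2"
proof -
  have "(\<integral>\<^sup>+x. indicator (S 1) x \<partial>lborel_PiM) * (\<integral>\<^sup>+x. indicator (S (2 * s - 1)) x \<partial>lborel_PiM)
    \<le> (\<integral>\<^sup>+x. indicator (S s) x \<partial>lborel_PiM)\<^sup>2"
  proof (rule prekopa_leindler_PiM)
    fix x y :: "'i \<Rightarrow> real"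
    have "(\<lambda>i. (x i + y i) / 2) \<in> S s" if "x \<in> S 1" "y \<in> S (2 * s - 1)"
    proof -
      have "(\<lambda>i. (1 - 1/2) * x i + 1/2 * y i) \<in> S ((1 - 1/2) * 1 + 1/2 * (2 * s - 1))"
        using that by (intro S_comb) auto
      moreover have "(\<lambda>i. (1 - 1/2) * x i + 1/2 * y i) = (\<lambda>i. (x i + y i) / 2)"
        by (auto simp: fun_eq_iff field_simps)
      moreover have "(1 - 1/2) * 1 + 1/2 * (2 * s - 1) = s" by (simp add: field_simps)
      ultimately show ?thesis by metis
    qed
    then have "(\<lambda>i\<in>UNIV. (x i + y i) / 2) \<in> S s" if "x \<in> S 1" "y \<in> S (2 * s - 1)"
      using that by (simp add: restrict_def)
    then show "indicator (S 1) x * indicator (S (2 * s - 1)) y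
        \<le> (indicator (S s) (\<lambda>i\<in>UNIV. (x i + y i) / 2) :: ennreal)\<^sup>2"
      by (auto simp: indicator_def)
  qed auto
  then show ?thesis by (simp add: H_def)
qed

private lemma H_even: "H (- s) = H s"
proof -
  have "H s = ennreal \<bar>-1\<bar> ^ CARD('i) * emeasure lborel_PiM {x. (\<lambda>i. 0 + (-1) * x i) \<in> S s}"
    unfolding H_def by (rule emeasure_PiM_affine) auto
  also have "{x. (\<lambda>i. 0 + (-1) * x i) \<in> S s} = S (- s)"
    using S_uminus[of _ s] S_uminus[of _ "- s"] by fastforce
  finally show ?thesis by (simp add: H_def)
qed

private lemma H_finite: "H s < \<infinity>"
proof -
  have "H s \<le> emeasure lborel_PiM {x. (\<lambda>i. - s * c i + 1 * x i) \<in> L}"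
    unfolding H_def
  proof (rule emeasure_mono)
    have "{x \<in> space lborel_PiM. (\<lambda>i. x i - s * c i) \<in> L} \<in> sets lborel_PiM" by measurable
    then show "{x. (\<lambda>i. - s * c i + 1 * x i) \<in> L} \<in> sets lborel_PiM" by simp
  qed (auto simp: S_def)
  also have "\<dots> = emeasure lborel_PiM L"
    by (subst emeasure_PiM_affine[of 1 L "\<lambda>i. - s * c i"]) auto
  finally show ?thesis using fin by simp
qed

text \<open>With \<open>a\<close> in \<open>S 1\<close>, the reflected point lies in
  \<open>S (-1)\<close>, and shrinking \<open>S 1\<close> towards it by the factor \<open>u\<close>
  lands in \<open>S s\<close>. As \<open>u\<close> is at least 1/2, a fixed fraction of the volume
  survives; this makes the infimum in \<open>anderson\<close> positive.\<close>

private lemma H_lower: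
  assumes s: "0 \<le> s" "s \<le> 1"
  shows "ennreal ((1/2) ^ CARD('i)) * H 1 \<le> H s"
proof (cases "S 1 = {}")
  case True
  then show ?thesis by (simp add: H_def)
next
  case False
  then obtain a where a: "a \<in> S 1" by auto
  \<comment> \<open>The solution of \<open>(1 - u) * (-1) + u * 1 = s\<close>.\<close>
  define u where "u = (1 + s) / 2"
  have u: "1/2 \<le> u" "u \<le> 1" using s by (auto simp: u_def)
  let ?E = "{x. (\<lambda>i. (1 - u) * (- a i) + u * x i) \<in> S s}"
  have [measurable]: "(\<lambda>x i. (1 - u) * (- a i) + u * x i) \<in> lborel_PiM \<rightarrow>\<^sub>M lborel_PiM"
    by (rule measurable_PiM_single') auto
  have "{x\<in>space lborel_PiM. (\<lambda>i. (1 - u) * (- a i) + u * x i) \<in> S s} \<in> sets lborel_PiM"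
    by measurable
  then have Em: "?E \<in> sets lborel_PiM" by simp
  have "S 1 \<subseteq> ?E"
  proof
    fix x assume "x \<in> S 1"
    then have "(\<lambda>i. (1 - u) * (- a i) + u * x i) \<in> S ((1 - u) * (-1) + u * 1)"
      using S_uminus[OF a] u by (intro S_comb) auto
    also have "(1 - u) * (-1) + u * 1 = s" by (simp add: u_def field_simps)
    finally show "x \<in> ?E" by simp
  qed
  then have "H 1 \<le> emeasure lborel_PiM ?E" unfolding H_def using Em by (intro emeasure_mono) auto
  moreover have "H s = ennreal \<bar>u\<bar> ^ CARD('i) * emeasure lborel_PiM ?E"
    unfolding H_def using u by (intro emeasure_PiM_affine) auto
  moreover have "ennreal ((1/2) ^ CARD('i)) \<le> ennreal \<bar>u\<bar> ^ CARD('i)"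
    unfolding ennreal_power[OF abs_ge_zero] using u by (intro ennreal_leI power_mono) auto
  ultimately show ?thesis by (simp add: mult_mono)
qed

text \<open>Midpoint log-concavity alone suffices: with \<open>m = inf h\<close> over \<open>[0,1]\<close>, evenness gives
  \<open>h(s)\<^sup>2 \<ge> h(1) m\<close> for all \<open>s\<close>, hence \<open>m\<^sup>2 \<ge> h(1) m\<close>, and \<open>m > 0\<close>.\<close>

lemma anderson:
  assumes s: "0 \<le> s" "s \<le> 1"
  shows "emeasure lborel_PiM (K \<inter> {x. (\<lambda>i. x i - c i) \<in> L})
     \<le> emeasure lborel_PiM (K \<inter> {x. (\<lambda>i. x i - s * c i) \<in> L})"
proof -
  define h where "h t = enn2real (H t)" for t
  have Hh: "H t = ennreal (h t)" and h0: "h t \<ge> 0" for t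
    using H_finite[of t] by (auto simp: h_def)
  have mid: "h 1 * h (2 * t - 1) \<le> (h t)\<^sup>2" for t
    using H_mid[of t] h0 by (simp add: Hh ennreal_mult[symmetric] ennreal_power)
  have even: "h (- t) = h t" for t using H_even by (simp add: h_def)
  have low: "(1/2) ^ CARD('i) * h 1 \<le> h t" if "0 \<le> t" "t \<le> 1" for t
    using H_lower[OF that] h0 by (simp add: Hh ennreal_mult[symmetric])
  have "h 1 \<le> h s"
  proof (cases "h 1 = 0")
    case True then show ?thesis using h0 by simp
  next
    case False
    then have h1: "h 1 > 0" using h0[of 1] by simp
    define m where "m = (INF t\<in>{0..1}. h t)"
    have bdd: "bdd_below (h ` {0..1})" using h0 by (auto intro: bdd_belowI[of _ 0])
    have "(1/2) ^ CARD('i) * h 1 \<le> m"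
      unfolding m_def using low by (intro cINF_greatest) auto
    moreover have "(1/2) ^ CARD('i) * h 1 > 0" using h1 by simp
    ultimately have m0: "m > 0" by linarith
    have ml: "m \<le> h t" if "0 \<le> t" "t \<le> 1" for t
      unfolding m_def using that bdd by (intro cINF_lower) auto
    have "sqrt (h 1 * m) \<le> h t" if t: "0 \<le> t" "t \<le> 1" for t
    proof -
      have "m \<le> h (2 * t - 1)"
      proof (cases "2 * t - 1 \<ge> 0")
        case True then show ?thesis using t by (intro ml) auto
      next
        case False
        then have "m \<le> h (- (2 * t - 1))" using t by (intro ml) auto
        then show ?thesis using even[of "2 * t - 1"] by simp
      qed
      then have "h 1 * m \<le> (h t)\<^sup>2" using mid[of t] h1 by (meson mult_left_mono order_trans less_imp_le)
      then show ?thesis by (rule real_le_lsqrt[OF h0])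
    qed
    then have "sqrt (h 1 * m) \<le> m"
      unfolding m_def[of] by (intro cINF_greatest) (auto simp: m_def)
    then have "(sqrt (h 1 * m))\<^sup>2 \<le> m\<^sup>2" using h1 m0 by (intro power_mono) auto
    then have "h 1 * m \<le> m * m" using h1 m0 by (simp add: power2_eq_square)
    then have "h 1 \<le> m" using m0 by simp
    also have "m \<le> h s" using s by (rule ml)
    finally show ?thesis .
  qed
  then have "H 1 \<le> H s" unfolding Hh by (rule ennreal_leI)
  then show ?thesis by (simp add: H_def S_def)
qed

end

section \<open>Rearrangement on the line\<close>

lemma AE_lborel_PiM_component:
  fixes i :: "'i::finite"
  assumes "AE x in lborel. P (x::'a::euclidean_space)"
  shows "AE x in lborel_PiM. P (x i)"
proof -
  obtain N where "\<And>x. x \<in> space lborel - N \<Longrightarrow> P x" and N0: "N \<in> null_sets lborel"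
    using AE_E3[OF assms] by blast
  then have N: "{x. \<not> P x} \<subseteq> N" "N \<in> sets borel" "vol N = 0"
    by (auto simp: null_sets_def)
  have "emeasure lborel_PiM {x. \<forall>j. x j \<in> (if j = i then N else (UNIV::'a set))}
      = (\<Prod>j\<in>UNIV. vol (if j = i then N else (UNIV::'a set)))"
    by (rule emeasure_box) (use N in auto)
  also have "\<dots> = 0"
    by (rule prod_zero[OF finite]) (use N in \<open>auto intro!: bexI[of _ i]\<close>)
  finally have *: "emeasure lborel_PiM {x. \<forall>j. x j \<in> (if j = i then N else (UNIV::'a set))} = 0" .
  have "{x. \<forall>j. x j \<in> (if j = i then N else (UNIV::'a set))} \<in> null_sets lborel_PiM"
    by (rule null_setsI[OF * sets_box]) (use N in auto)
  moreover have "{x\<in>space lborel_PiM. \<not> P (x i)} \<subseteq> {x. \<forall>j. x j \<in> (if j = i then N else (UNIV::'a set))}"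
    using N by auto
  ultimately show ?thesis by (rule AE_I')
qed

text \<open>Two touching intervals count their common endpoint twice until they are merged, and a
  density with essential supremum at most 1 may exceed 1 on a null set; both call for comparison
  almost everywhere.\<close>

lemma multi_integral_mono_AE:
  assumes "\<And>i. AE x in lborel. g i x \<le> h i x"
  shows "multi_integral K g \<le> multi_integral K h"
proof -
  have "AE x in lborel_PiM. \<forall>i\<in>UNIV. g i (x i) \<le> h i (x i)"
    by (intro AE_finite_allI finite AE_lborel_PiM_component assms)
  then have "AE x in lborel_PiM. indicator K x * (\<Prod>i\<in>UNIV. g i (x i)) \<le> indicator K x * (\<Prod>i\<in>UNIV. h i (x i))"
    by eventually_elim (intro mult_left_mono prod_mono_ennreal, auto)
  then show ?thesis unfolding multi_integral_def by (rule nn_integral_mono_AE)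
qed

text \<open>A pair \<open>(c, r)\<close> stands for the interval of centre \<open>c\<close> and radius \<open>r\<close>, slid to the
  centre \<open>s c\<close>.\<close>

definition slid :: "real \<Rightarrow> real \<times> real \<Rightarrow> real set" where
  "slid s p = {s * fst p - snd p..s * fst p + snd p}"

text \<open>A sum of indicators rather than the indicator of the union: products of such sums expand
  into choices of one interval per column, and Anderson's theorem applies to each choice separately,
  even if slid intervals overlap.\<close>

definition slid_sum :: "real \<Rightarrow> (real \<times> real) set \<Rightarrow> real \<Rightarrow> ennreal" where
  "slid_sum s J x = (\<Sum>p\<in>J. indicator (slid s p) x)"

text \<open>Intervals may touch but not overlap: touching is the configuration in which sliding
  stops.\<close>

definition spaced :: "(real \<times> real) set \<Rightarrow> bool" where
  "spaced J \<longleftrightarrow> finite J \<and> (\<forall>p\<in>J. 0 < snd p) \<and>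
     (\<forall>p\<in>J. \<forall>q\<in>J. p \<noteq> q \<longrightarrow> snd p + snd q \<le> \<bar>fst p - fst q\<bar>)"

lemma slid_measurable [measurable]: "slid s p \<in> sets borel"
  by (simp add: slid_def)

lemma slid_sum_measurable [measurable]: "slid_sum s J \<in> borel_measurable borel"
  unfolding slid_sum_def by measurable

lemma spacedD:
  assumes "spaced J"
  shows "finite J" "p \<in> J \<Longrightarrow> 0 < snd p"
    "p \<in> J \<Longrightarrow> q \<in> J \<Longrightarrow> p \<noteq> q \<Longrightarrow> snd p + snd q \<le> \<bar>fst p - fst q\<bar>"
  using assms by (auto simp: spaced_def)

text \<open>Both sides expand into sums over the same choices \<open>\<sigma>\<close> of one
  interval per column. For a single choice all centres are scaled by the same factor, which is
  Anderson's theorem for the centred box \<open>L\<close> and the vector of centres.\<close>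

lemma multi_integral_slid_mono:
  fixes K :: "('i::finite \<Rightarrow> real) set"
  assumes Km[measurable]: "K \<in> sets lborel_PiM" and K: "fun_convex K" "fun_symmetric K"
    and J: "\<And>i. spaced (J i)" and s: "0 \<le> s" "s \<le> 1"
  shows "multi_integral K (\<lambda>i. slid_sum 1 (J i)) \<le> multi_integral K (\<lambda>i. slid_sum s (J i))"
proof -
  have exp: "multi_integral K (\<lambda>i. slid_sum t (J i))
    = (\<Sum>\<sigma>\<in>Pi\<^sub>E UNIV J. multi_volume K (\<lambda>i. slid t (\<sigma> i)))" for t
  proof -
    have "multi_integral K (\<lambda>i. slid_sum t (J i)) =
       (\<integral>\<^sup>+x. (\<Sum>\<sigma>\<in>Pi\<^sub>E UNIV J. indicator K x * (\<Prod>i\<in>UNIV. indicator (slid t (\<sigma> i)) (x i))) \<partial>lborel_PiM)"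
      unfolding multi_integral_def slid_sum_def
      using spacedD(1)[OF J] by (simp add: prod_sum_PiE sum_distrib_left)
    also have "\<dots> = (\<Sum>\<sigma>\<in>Pi\<^sub>E UNIV J. multi_volume K (\<lambda>i. slid t (\<sigma> i)))"
      unfolding multi_integral_def by (intro nn_integral_sum) measurable
    finally show ?thesis .
  qed
  show ?thesis
    unfolding exp
  proof (rule sum_mono)
    fix \<sigma> assume "\<sigma> \<in> Pi\<^sub>E UNIV J"
    then have \<sigma>: "\<sigma> i \<in> J i" for i by auto
    define L where "L = {x :: 'i \<Rightarrow> real. \<forall>i. x i \<in> {- snd (\<sigma> i)..snd (\<sigma> i)}}"
    have [measurable]: "L \<in> sets lborel_PiM" unfolding L_def by (rule sets_box) auto
    have "emeasure lborel_PiM L = (\<Prod>i\<in>UNIV. vol {- snd (\<sigma> i)..snd (\<sigma> i)})"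
      unfolding L_def by (rule emeasure_box) auto
    also have "\<dots> < \<infinity>"
      by (simp add: ennreal_prod_eq_top less_top[symmetric])
         (metis emeasure_lborel_Icc_eq ennreal_neq_top ennreal_0 linorder_not_less)
    finally have Lfin: "emeasure lborel_PiM L < \<infinity>" .
    have Lconv: "fun_convex L"
      unfolding fun_convex_def
    proof (intro ballI)
      fix x y u assume xyu: "x \<in> L" "y \<in> L" "u \<in> {0..1::real}"
      have "(1 - u) *\<^sub>R x i + u *\<^sub>R y i \<in> {- snd (\<sigma> i)..snd (\<sigma> i)}" for i
        using xyu convexD[of "{- snd (\<sigma> i)..snd (\<sigma> i)}" "x i" "y i" "1 - u" u] convex_real_interval(5)
        by (auto simp: L_def)
      then show "(\<lambda>i. (1 - u) *\<^sub>R x i + u *\<^sub>R y i) \<in> L" by (simp add: L_def)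
    qed
    have Lsym: "fun_symmetric L"
      by (auto simp: fun_symmetric_def L_def) (smt (verit, best))+
    have eq: "{x. \<forall>i. x i \<in> slid t (\<sigma> i)} = {x. (\<lambda>i. x i - t * fst (\<sigma> i)) \<in> L}" for t
      by (auto simp: slid_def L_def) (smt (verit, best))+
    have "multi_volume K (\<lambda>i. slid 1 (\<sigma> i)) = emeasure lborel_PiM (K \<inter> {x. (\<lambda>i. x i - fst (\<sigma> i)) \<in> L})"
      by (subst multi_volume_eq) (auto simp: eq)
    also have "\<dots> \<le> emeasure lborel_PiM (K \<inter> {x. (\<lambda>i. x i - s * fst (\<sigma> i)) \<in> L})"
      using K Lconv Lsym Lfin s by (intro anderson) auto
    also have "\<dots> = multi_volume K (\<lambda>i. slid s (\<sigma> i))"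
      by (subst multi_volume_eq) (auto simp: eq)
    finally show "multi_volume K (\<lambda>i. slid 1 (\<sigma> i)) \<le> multi_volume K (\<lambda>i. slid s (\<sigma> i))" .
  qed
qed

text \<open>After sliding to \<open>s\<close>, the process restarts with the scaled centres as a new
  family at parameter 1.\<close>

lemma spaced_scale:
  assumes J: "spaced J" and s: "0 < s"
    and sep: "\<And>p q. p \<in> J \<Longrightarrow> q \<in> J \<Longrightarrow> p \<noteq> q \<Longrightarrow> snd p + snd q \<le> s * \<bar>fst p - fst q\<bar>"
  defines "J' \<equiv> (\<lambda>p. (s * fst p, snd p)) ` J"
  shows "spaced J'" "slid_sum 1 J' = slid_sum s J" "card J' = card J" "sum snd J' = sum snd J"
proof -
  have inj: "inj_on (\<lambda>p. (s * fst p, snd p)) J" using s by (auto simp: inj_on_def prod_eq_iff)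
  show "card J' = card J" unfolding J'_def by (rule card_image[OF inj])
  show "sum snd J' = sum snd J" unfolding J'_def by (simp add: sum.reindex[OF inj] o_def)
  show "slid_sum 1 J' = slid_sum s J"
    unfolding J'_def slid_sum_def fun_eq_iff by (simp add: sum.reindex[OF inj] o_def slid_def)
  have "snd p + snd q \<le> \<bar>s * fst p - s * fst q\<bar>" if "p \<in> J" "q \<in> J" "p \<noteq> q" for p q
    using sep[OF that] s by (simp add: abs_mult flip: right_diff_distrib)
  then show "spaced J'" using J unfolding spaced_def J'_def by fastforce
qed

text \<open>\<open>m\<close> runs from the left end of \<open>p\<close> to the right end of
  \<open>q\<close>, so the radii add up. The shared endpoint is counted twice before the merge and
  once after, hence the comparison only almost everywhere.\<close>

lemma spaced_merge:
  assumes J: "spaced J" and pq: "p \<in> J" "q \<in> J" "p \<noteq> q" and touch: "fst q - fst p = snd p + snd q"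
  defines "m \<equiv> ((fst p - snd p + fst q + snd q) / 2, snd p + snd q)"
  defines "J' \<equiv> insert m (J - {p, q})"
  shows "spaced J'" "card J' < card J" "sum snd J' = sum snd J"
    "AE x in lborel. slid_sum 1 J x \<le> slid_sum 1 J' x"
proof -
  note D = spacedD[OF J]
  have pos: "0 < snd p" "0 < snd q" using D pq by auto
  \<comment> \<open>Positive radius leaves \<open>w\<close> no room between two touching intervals,
    so it lies to the left of \<open>p\<close> or to the right of \<open>q\<close>, and its distance
    to \<open>m\<close> is governed by that neighbour.\<close>
  have far: "snd m + snd w \<le> \<bar>fst m - fst w\<bar>" if w: "w \<in> J" "w \<noteq> p" "w \<noteq> q" for w
  proof -
    have "snd p + snd w \<le> \<bar>fst p - fst w\<bar>" "snd q + snd w \<le> \<bar>fst q - fst w\<bar>" "0 < snd w"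
      using D(3)[of p w] D(3)[of q w] D(2)[of w] w pq by auto
    then show ?thesis using touch pos unfolding m_def by (simp add: field_simps)
  qed
  have mJ: "m \<notin> J - {p, q}"
  proof
    assume "m \<in> J - {p, q}"
    then have "snd m + snd m \<le> 0" "0 < snd m" using far[of m] pos by (auto simp: m_def)
    then show False by simp
  qed
  show "spaced J'"
    unfolding spaced_def J'_def
  proof (intro conjI ballI impI)
    show "finite (insert m (J - {p, q}))" using D by simp
    show "0 < snd w" if "w \<in> insert m (J - {p, q})" for w using that D(2)[of w] pos by (auto simp: m_def)
    show "snd v + snd w \<le> \<bar>fst v - fst w\<bar>"
      if "v \<in> insert m (J - {p, q})" "w \<in> insert m (J - {p, q})" "v \<noteq> w" for v w
      using that D(3)[of v w] far[of v] far[of w] by (auto simp: abs_minus_commute add.commute)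
  qed
  have "card (J - {p, q}) = card J - 2" using pq D by (simp add: card_Diff_subset)
  moreover have "card {p, q} \<le> card J" using pq D by (intro card_mono) auto
  ultimately show "card J' < card J" using mJ D pq by (simp add: J'_def)
  have eq: "J = insert p (insert q (J - {p, q}))" using pq by auto
  have split: "sum f J = f p + f q + sum f (J - {p, q})" for f :: "_ \<Rightarrow> 'b::comm_monoid_add"
    by (subst eq) (use D pq in \<open>simp add: add.assoc\<close>)
  show "sum snd J' = sum snd J"
    unfolding J'_def split[of snd] using mJ D by (simp add: m_def)
  have "AE x in lborel. x \<noteq> fst p + snd p" by (rule AE_lborel_singleton)
  then show "AE x in lborel. slid_sum 1 J x \<le> slid_sum 1 J' x"
  proof eventually_elim
    case (elim x)
    have "indicator (slid 1 p) x + indicator (slid 1 q) x \<le> (indicator (slid 1 m) x :: ennreal)"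
      using elim touch pos by (auto simp: indicator_def slid_def m_def field_simps)
    then show ?case
      unfolding slid_sum_def split J'_def using mJ D by (simp add: add_right_mono)
  qed
qed

text \<open>Induction on the total number of intervals. Anderson's theorem scales the centres in all
  columns by one factor, so all families slide together until the first contact in any of them; the
  merge in that family lowers the count. When no family has two intervals, sliding to 0 centres them
  all.\<close>

lemma multi_integral_spaced_le:
  fixes K :: "('i::finite \<Rightarrow> real) set"
  assumes Km[measurable]: "K \<in> sets lborel_PiM" and K: "fun_convex K" "fun_symmetric K"
    and J: "\<And>i. spaced (J i)"
  shows "multi_integral K (\<lambda>i. slid_sum 1 (J i)) \<le> multi_volume K (\<lambda>i. {- sum snd (J i)..sum snd (J i)})"
  using J
proof (induction "\<Sum>i\<in>UNIV. card (J i)" arbitrary: J rule: less_induct)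
  case less
  note J = less.prems
  \<comment> \<open>The ratio is the parameter at which \<open>p\<close> and \<open>q\<close> touch.
    As the parameter falls from 1, the largest ratio is met first, and down to it the families stay
    spaced.\<close>
  define T where "T = (\<Union>i. \<Union>p\<in>J i. \<Union>q\<in>J i - {p}. {(snd p + snd q) / \<bar>fst p - fst q\<bar>})"
  have finT: "finite T"
    unfolding T_def using spacedD(1)[OF J] by (intro finite_UN_I) auto
  show ?case
  proof (cases "T = {}")
    case True
    have one: "p = q" if "p \<in> J i" "q \<in> J i" for p q i
    proof (rule ccontr)
      assume "p \<noteq> q"
      then have "(snd p + snd q) / \<bar>fst p - fst q\<bar> \<in> T" unfolding T_def using that by blast
      then show False using True by simp
    qed
    have le: "slid_sum 0 (J i) x \<le> indicator {- sum snd (J i)..sum snd (J i)} x" for i x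
    proof (cases "J i = {}")
      case True then show ?thesis by (simp add: slid_sum_def)
    next
      case False
      then obtain p where "J i = {p}" using one by blast
      then show ?thesis by (simp add: slid_sum_def slid_def)
    qed
    have "multi_integral K (\<lambda>i. slid_sum 1 (J i)) \<le> multi_integral K (\<lambda>i. slid_sum 0 (J i))"
      by (rule multi_integral_slid_mono) (use K J in auto)
    also have "\<dots> \<le> multi_volume K (\<lambda>i. {- sum snd (J i)..sum snd (J i)})"
      by (intro multi_integral_mono le)
    finally show ?thesis .
  next
    case False
    define s where "s = Max T"
    have "s \<in> T" using False finT by (simp add: s_def)
    then obtain k p q where pq: "p \<in> J k" "q \<in> J k" "p \<noteq> q" and s: "s = (snd p + snd q) / \<bar>fst p - fst q\<bar>"
      unfolding T_def by blast
    \<comment> \<open>Orders the touching pair from left to right, as \<open>spaced_merge\<close>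
      expects.\<close>
    have wit: "\<exists>p q. p \<in> J k \<and> q \<in> J k \<and> p \<noteq> q \<and> s = (snd p + snd q) / \<bar>fst p - fst q\<bar> \<and> fst p \<le> fst q"
    proof (cases "fst p \<le> fst q")
      case True then show ?thesis using pq s by blast
    next
      case False then show ?thesis using pq s by (intro exI[of _ q] exI[of _ p]) (auto simp: abs_minus_commute add.commute)
    qed
    then obtain p q where pq: "p \<in> J k" "q \<in> J k" "p \<noteq> q" and s: "s = (snd p + snd q) / \<bar>fst p - fst q\<bar>"
      and le: "fst p \<le> fst q" by blast
    have dist: "0 < \<bar>fst p - fst q\<bar>" if "p \<in> J i" "q \<in> J i" "p \<noteq> q" for p q i
      using spacedD(2)[OF J, of p i] spacedD(2)[OF J, of q i] spacedD(3)[OF J, of p i q] that by linarith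
    have s0: "0 < s" unfolding s
      using dist[OF pq] spacedD(2)[OF J pq(1)] spacedD(2)[OF J pq(2)] by (intro divide_pos_pos) auto
    have s1: "s \<le> 1" unfolding s
      using dist[OF pq] spacedD(3)[OF J pq] by (simp add: divide_le_eq)
    have sep: "snd p + snd q \<le> s * \<bar>fst p - fst q\<bar>" if h: "p \<in> J i" "q \<in> J i" "p \<noteq> q" for p q i
    proof -
      have "(snd p + snd q) / \<bar>fst p - fst q\<bar> \<in> T" unfolding T_def using h by blast
      then have "(snd p + snd q) / \<bar>fst p - fst q\<bar> \<le> s" using finT by (simp add: s_def)
      then show ?thesis using dist[OF h] by (simp add: divide_le_eq)
    qed
    define J' where "J' i = (\<lambda>p. (s * fst p, snd p)) ` J i" for i
    have sc: "spaced (J' i)" "slid_sum 1 (J' i) = slid_sum s (J i)" "card (J' i) = card (J i)"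
      "sum snd (J' i) = sum snd (J i)" for i
      unfolding J'_def by (rule spaced_scale[OF J s0], erule (2) sep)+
    let ?f = "\<lambda>p. (s * fst p, snd p)"
    have pq': "?f p \<in> J' k" "?f q \<in> J' k" "?f p \<noteq> ?f q"
      using pq s0 by (auto simp: J'_def prod_eq_iff)
    have touch: "fst (?f q) - fst (?f p) = snd (?f p) + snd (?f q)"
    proof -
      have "s * (fst q - fst p) = snd p + snd q" unfolding s using dist[OF pq] le by (simp add: field_simps)
      then show ?thesis by (simp add: right_diff_distrib)
    qed
    define m where "m = ((fst (?f p) - snd (?f p) + fst (?f q) + snd (?f q)) / 2, snd (?f p) + snd (?f q))"
    define J'' where "J'' = J'(k := insert m (J' k - {?f p, ?f q}))"
    note mg = spaced_merge[OF sc(1) pq' touch, folded m_def]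
    have sp: "spaced (J'' i)" for i using mg(1) sc(1) by (simp add: J''_def)
    have card: "(\<Sum>i\<in>UNIV. card (J'' i)) < (\<Sum>i\<in>UNIV. card (J i))"
    proof (rule sum_strict_mono_ex1)
      show "\<forall>i\<in>UNIV. card (J'' i) \<le> card (J i)"
        using mg(2) sc(3) by (auto simp: J''_def)
      show "\<exists>i\<in>UNIV. card (J'' i) < card (J i)"
        using mg(2) sc(3)[of k] by (intro bexI[of _ k]) (auto simp: J''_def)
    qed simp
    have sum: "sum snd (J'' i) = sum snd (J i)" for i
      using mg(3) sc(4) by (simp add: J''_def)
    have "multi_integral K (\<lambda>i. slid_sum 1 (J i)) \<le> multi_integral K (\<lambda>i. slid_sum s (J i))"
      by (rule multi_integral_slid_mono) (use K J s0 s1 in auto)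
    also have "\<dots> = multi_integral K (\<lambda>i. slid_sum 1 (J' i))" by (simp add: sc(2))
    also have "\<dots> \<le> multi_integral K (\<lambda>i. slid_sum 1 (J'' i))"
      using mg(4) by (intro multi_integral_mono_AE) (auto simp: J''_def)
    also have "\<dots> \<le> multi_volume K (\<lambda>i. {- sum snd (J'' i)..sum snd (J'' i)})"
      by (rule less.hyps[OF card sp])
    finally show ?thesis by (simp add: sum)
  qed
qed

section \<open>Exhausting an open set by grid intervals\<close>

lemma spaced_total_le:
  assumes J: "spaced J" and sub: "\<And>p. p \<in> J \<Longrightarrow> slid 1 p \<subseteq> U" and [measurable]: "U \<in> sets borel"
  shows "ennreal (2 * sum snd J) \<le> vol U"
proof -
  \<comment> \<open>Half-open, so that touching intervals are disjoint.\<close>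
  define I where "I p = {fst p - snd p..<fst p + snd p}" for p :: "real \<times> real"
  have "ennreal (2 * sum snd J) = (\<Sum>p\<in>J. ennreal (2 * snd p))"
    using spacedD(2)[OF J] by (subst sum_ennreal) (auto simp: sum_distrib_left less_imp_le)
  also have "\<dots> = (\<Sum>p\<in>J. vol (I p))"
    using spacedD(2)[OF J] by (intro sum.cong refl) (auto simp: I_def less_imp_le)
  also have "\<dots> = vol (\<Union>p\<in>J. I p)"
  proof (rule sum_emeasure)
    show "disjoint_family_on I J"
      unfolding disjoint_family_on_def
    proof (intro ballI impI)
      fix p q assume "p \<in> J" "q \<in> J" "p \<noteq> q"
      from spacedD(3)[OF J this] show "I p \<inter> I q = {}" by (auto simp: I_def)
    qed
  qed (use spacedD(1)[OF J] in \<open>auto simp: I_def\<close>)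
  also have "\<dots> \<le> vol U"
    using sub by (intro emeasure_mono) (fastforce simp: I_def slid_def)+
  finally show ?thesis .
qed

text \<open>Cell \<open>k\<close> is the closed interval from \<open>k / (n + 1)\<close> to
  \<open>(k + 1) / (n + 1)\<close>. Bounding the index by the square of \<open>n + 1\<close> leaves
  finitely many cells, while the window they cover still grows to the whole line.\<close>

definition grid :: "real set \<Rightarrow> nat \<Rightarrow> (real \<times> real) set" where
  "grid U n = {p \<in> (\<lambda>k::int. ((of_int k + 1/2) / Suc n, 1 / (2 * Suc n))) ` {- (int (Suc n))\<^sup>2..(int (Suc n))\<^sup>2}.
     slid 1 p \<subseteq> U}"

lemma spaced_grid: "spaced (grid U n)"
  unfolding spaced_def
proof (intro conjI ballI impI)
  show "finite (grid U n)" by (simp add: grid_def)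
  show "0 < snd p" if "p \<in> grid U n" for p using that by (auto simp: grid_def)
  show "snd p + snd q \<le> \<bar>fst p - fst q\<bar>" if "p \<in> grid U n" "q \<in> grid U n" "p \<noteq> q" for p q
  proof -
    obtain j k :: int where p: "p = ((of_int j + 1/2) / Suc n, 1 / (2 * Suc n))"
      and q: "q = ((of_int k + 1/2) / Suc n, 1 / (2 * Suc n))"
      using \<open>p \<in> grid U n\<close> \<open>q \<in> grid U n\<close> by (auto simp: grid_def)
    have "j \<noteq> k" using \<open>p \<noteq> q\<close> p q by auto
    then have "1 \<le> \<bar>j - k\<bar>" by linarith
    then have "(1::real) \<le> \<bar>of_int j - of_int k\<bar>" by (metis of_int_1_le_iff of_int_abs of_int_diff)
    have "fst p - fst q = (of_int j - of_int k) / real (Suc n)"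
      by (simp add: p q diff_divide_distrib[symmetric])
    then have "\<bar>fst p - fst q\<bar> = \<bar>of_int j - of_int k\<bar> / real (Suc n)" by (simp add: abs_divide)
    also have "\<dots> \<ge> 1 / real (Suc n)"
      using \<open>1 \<le> \<bar>of_int j - of_int k\<bar>\<close> by (intro divide_right_mono) auto
    also have "1 / real (Suc n) = snd p + snd q" by (simp add: p q field_simps)
    finally show ?thesis by simp
  qed
qed

text \<open>Once the mesh is smaller than the radius of a ball around \<open>x\<close> inside
  \<open>U\<close>, a cell containing \<open>x\<close> lies in \<open>U\<close>. The bound is an
  inequality because an endpoint shared by two cells counts twice.\<close>

lemma eventually_grid_covers:
  assumes "open U" "x \<in> U"
  shows "\<forall>\<^sub>F n in sequentially. 1 \<le> slid_sum 1 (grid U n) x"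
proof -
  obtain e where e: "e > 0" "cball x e \<subseteq> U"
    using assms open_contains_cball by blast
  have "\<forall>\<^sub>F n in sequentially. 1 / real (Suc n) < e"
    using e(1) by real_asymp
  moreover have "\<forall>\<^sub>F n in sequentially. \<bar>x\<bar> + 1 < real (Suc n)"
    by real_asymp
  ultimately show ?thesis
  proof eventually_elim
    case (elim n)
    define N where "N = real (Suc n)"
    have N: "N \<ge> 1" "1 / N < e" "\<bar>x\<bar> + 1 < N" using elim by (auto simp: N_def)
    define k where "k = \<lfloor>x * N\<rfloor>"
    have k: "of_int k \<le> x * N" "x * N < of_int k + 1" unfolding k_def by linarith+
    define p where "p = ((of_int k + 1/2) / N, 1 / (2 * N))"
    have xp: "x \<in> slid 1 p" using k N by (auto simp: slid_def p_def field_simps)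
    have "\<bar>x * N\<bar> \<le> (N - 1) * N" using N by (simp add: abs_mult mult_right_mono)
    then have "- (N * N) \<le> of_int k" "of_int k \<le> N * N" using k N by (auto simp: algebra_simps abs_le_iff)
    then have "- of_int ((int (Suc n))\<^sup>2) \<le> (of_int k :: real)" "of_int k \<le> (of_int ((int (Suc n))\<^sup>2) :: real)"
      by (auto simp: N_def power2_eq_square)
    then have "- (int (Suc n))\<^sup>2 \<le> k" "k \<le> (int (Suc n))\<^sup>2"
      by (metis of_int_le_iff of_int_minus)+
    moreover have "slid 1 p \<subseteq> U"
    proof
      fix y assume "y \<in> slid 1 p"
      then have "\<bar>x - y\<bar> \<le> 2 * snd p" using xp by (auto simp: slid_def)
      also have "2 * snd p = 1 / N" by (simp add: p_def)
      finally show "y \<in> U" using N e by (auto simp: subset_iff dist_real_def)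
    qed
    ultimately have "p \<in> grid U n" by (auto simp: grid_def p_def N_def)
    then have "indicator (slid 1 p) x \<le> slid_sum 1 (grid U n) x"
      unfolding slid_sum_def using spacedD(1)[OF spaced_grid]
      by (intro member_le_sum) auto
    then show ?case using xp by simp
  qed
qed

text \<open>Grid cells fill \<open>U i\<close> from inside with total length at most
  \<open>u i\<close>, so every stage obeys the same bound and Fatou's lemma passes to the
  limit.\<close>

lemma multi_volume_open_le:
  fixes K :: "('i::finite \<Rightarrow> real) set"
  assumes Km[measurable]: "K \<in> sets lborel_PiM" and K: "fun_convex K" "fun_symmetric K"
    and U: "\<And>i. open (U i)" and fin: "\<And>i. vol (U i) \<le> ennreal (u i)" and u0: "\<And>i. 0 \<le> u i"
  shows "multi_volume K U \<le> multi_volume K (\<lambda>i. {- (u i / 2)..u i / 2})"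
proof (rule multi_integral_le_eventually)
  have [measurable]: "U i \<in> sets borel" for i using U by auto
  fix n
  have "multi_integral K (\<lambda>i. slid_sum 1 (grid (U i) n))
      \<le> multi_volume K (\<lambda>i. {- sum snd (grid (U i) n)..sum snd (grid (U i) n)})"
    using K by (intro multi_integral_spaced_le spaced_grid) auto
  also have "\<dots> \<le> multi_volume K (\<lambda>i. {- (u i / 2)..u i / 2})"
  proof (rule multi_volume_mono)
    fix i
    have "ennreal (2 * sum snd (grid (U i) n)) \<le> vol (U i)"
      by (intro spaced_total_le spaced_grid) (auto simp: grid_def)
    also have "\<dots> \<le> ennreal (u i)" by (rule fin)
    finally have "2 * sum snd (grid (U i) n) \<le> u i" using u0[of i] by simp
    then show "{- sum snd (grid (U i) n)..sum snd (grid (U i) n)} \<subseteq> {- (u i / 2)..u i / 2}" by auto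
  qed
  finally show "multi_integral K (\<lambda>i. slid_sum 1 (grid (U i) n)) \<le> multi_volume K (\<lambda>i. {- (u i / 2)..u i / 2})" .
next
  fix i x
  show "\<forall>\<^sub>F n in sequentially. indicator (U i) x \<le> slid_sum 1 (grid (U i) n) x"
    using eventually_grid_covers[OF U, of x i] by (cases "x \<in> U i") auto
qed (use Km in auto)

lemma emeasure_halves:
  assumes "0 \<le> u"
  shows "vol {- (u / 2)..u / 2} = ennreal u" "vol {- (u / 2)<..<u / 2} = ennreal u"
  using assms by simp_all

text \<open>Outer regularity replaces each \<open>A i\<close> by an open set with at most
  \<open>d\<close> more measure, and \<open>multi_volume_approx\<close> removes the surplus. The
  centred interval is expressed through \<open>vol (A i)\<close> because the slices in
  \<open>steiner_slice\<close> have this form.\<close>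

lemma multi_volume_rearrange_real:
  fixes K :: "('i::finite \<Rightarrow> real) set"
  assumes Km[measurable]: "K \<in> sets lborel_PiM" and K: "fun_convex K" "fun_symmetric K"
    and A[measurable]: "\<And>i. A i \<in> sets borel" and fin: "\<And>i. vol (A i) < \<infinity>"
  shows "multi_volume K A \<le> multi_volume K (\<lambda>i. {t. ennreal (2 * \<bar>t\<bar>) < vol (A i)})"
proof -
  define a where "a i = measure lborel (A i)" for i
  have a: "vol (A i) = ennreal (a i)" "0 \<le> a i" for i
    using fin[of i] by (auto simp: a_def emeasure_eq_ennreal_measure)
  let ?B = "\<lambda>i. {t. ennreal (2 * \<bar>t\<bar>) < vol (A i)}"
  have B: "?B i = {- (a i / 2)<..<a i / 2}" for i
    using a(2)[of i] by (auto simp: a(1) ennreal_less_iff abs_less_iff)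
  show ?thesis
  proof (rule multi_volume_approx[OF Km, where b="\<lambda>i. a i + 1"])
    show "?B i \<in> sets borel" for i by (simp add: B)
    show "0 \<le> a i + 1" for i using a(2)[of i] by simp
    fix d :: real assume d: "0 < d" "d \<le> 1"
    have "\<exists>U. open U \<and> A i \<subseteq> U \<and> vol U \<le> ennreal (a i + d)" for i
    proof -
      obtain U where U: "open U" "A i \<subseteq> U" "vol (U - A i) < ennreal d"
        using outer_regular_lborel[OF A d(1)] by blast
      have "vol U = vol (A i \<union> (U - A i))" using U by (simp add: Un_absorb1)
      also have "\<dots> = vol (A i) + vol (U - A i)"
        using U by (intro plus_emeasure[symmetric]) auto
      also have "\<dots> \<le> ennreal (a i) + ennreal d" using U a by (intro add_mono) auto
      also have "\<dots> = ennreal (a i + d)" using a(2)[of i] d by simp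
      finally show ?thesis using U by blast
    qed
    then obtain U where U: "\<And>i. open (U i)" "\<And>i. A i \<subseteq> U i" "\<And>i. vol (U i) \<le> ennreal (a i + d)"
      by metis
    let ?D = "\<lambda>i. {- ((a i + d) / 2)..(a i + d) / 2}"
    have "multi_volume K A \<le> multi_volume K U" using U by (intro multi_volume_mono)
    also have "\<dots> \<le> multi_volume K ?D"
      using U K a(2) d by (intro multi_volume_open_le) (auto simp: add_nonneg_nonneg)
    finally have le: "multi_volume K A \<le> multi_volume K ?D" .
    have D: "vol (?D i) = ennreal (a i + d)" for i
      using a(2)[of i] d by (simp only: emeasure_halves add_nonneg_nonneg less_imp_le)
    have gap: "vol (?D i - ?B i) = ennreal d" for i
    proof -
      have "?B i \<subseteq> ?D i"
      proof
        fix x assume "x \<in> ?B i"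
        then have "- (a i / 2) < x" "x < a i / 2" unfolding B by auto
        then have "- ((a i + d) / 2) \<le> x" "x \<le> (a i + d) / 2" using d(1) by (simp_all add: field_simps)
        then show "x \<in> ?D i" by simp
      qed
      then have "vol (?D i - ?B i) = vol (?D i) - vol (?B i)"
        using a(2)[of i] by (intro emeasure_Diff) (auto simp: B)
      also have "\<dots> = ennreal (a i + d) - ennreal (a i)"
        using a(2)[of i] unfolding D unfolding B by (simp only: emeasure_halves)
      also have "\<dots> = ennreal d" using a(2)[of i] d by (simp add: ennreal_minus)
      finally show ?thesis .
    qed
    show "\<exists>D. (\<forall>i. D i \<in> sets borel \<and> vol (D i) \<le> ennreal (a i + 1) \<and> vol (D i - ?B i) \<le> ennreal d) \<and>
        multi_volume K A \<le> multi_volume K D"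
      using le d by (intro exI[of _ ?D] conjI allI) (simp_all only: D gap, auto intro: ennreal_leI)
  qed
qed

section \<open>Steiner symmetrisation\<close>

definition orth_invariant :: "('i \<Rightarrow> 'a::euclidean_space) set \<Rightarrow> bool" where
  "orth_invariant K \<longleftrightarrow> (\<forall>T. orthogonal_transformation T \<longrightarrow> (\<forall>x\<in>K. (\<lambda>i. T (x i)) \<in> K))"

text \<open>For \<open>u = 0\<close> the quotient is 0 and the map is the identity;
  \<open>reflection_to_axis\<close> meets this case when \<open>w\<close> already points along the
  axis.\<close>

lemma orthogonal_transformation_reflection:
  fixes u :: "'a::real_inner"
  shows "orthogonal_transformation (\<lambda>x. x - (2 * (x \<bullet> u) / (u \<bullet> u)) *\<^sub>R u)"
proof (cases "u = 0")
  case True then show ?thesis by (simp add: orthogonal_transformation_def linear_iff)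
next
  case False
  then have u: "u \<bullet> u \<noteq> 0" by simp
  show ?thesis
    unfolding orthogonal_transformation_def
  proof (intro conjI allI)
    show "linear (\<lambda>x. x - (2 * (x \<bullet> u) / (u \<bullet> u)) *\<^sub>R u)"
      by (auto simp: linear_iff algebra_simps inner_add_left add_divide_distrib scaleR_add_left)
    fix v w
    have "(v - (2 * (v \<bullet> u) / (u \<bullet> u)) *\<^sub>R u) \<bullet> (w - (2 * (w \<bullet> u) / (u \<bullet> u)) *\<^sub>R u)
      = v \<bullet> w - 2 * (w \<bullet> u) / (u \<bullet> u) * (v \<bullet> u) - 2 * (v \<bullet> u) / (u \<bullet> u) * (u \<bullet> w)
        + (2 * (v \<bullet> u) / (u \<bullet> u)) * (2 * (w \<bullet> u) / (u \<bullet> u)) * (u \<bullet> u)"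
      by (simp add: inner_diff_left inner_diff_right)
    also have "\<dots> = v \<bullet> w" using u by (simp add: inner_commute[of u w] field_simps)
    finally show "(v - (2 * (v \<bullet> u) / (u \<bullet> u)) *\<^sub>R u) \<bullet> (w - (2 * (w \<bullet> u) / (u \<bullet> u)) *\<^sub>R u) = v \<bullet> w" .
  qed
qed

section \<open>Slicing along parallel lines\<close>

abbreviation perp :: "'a::euclidean_space \<Rightarrow> ('a \<Rightarrow> real) measure" where
  "perp b \<equiv> (\<Pi>\<^sub>M c\<in>Basis - {b}. lborel)"

definition perp_embed :: "'a::euclidean_space \<Rightarrow> ('a \<Rightarrow> real) \<Rightarrow> 'a" where
  "perp_embed b q = (\<Sum>c\<in>Basis - {b}. q c *\<^sub>R c)"

lemma perp_embed_measurable [measurable]: "perp_embed b \<in> perp b \<rightarrow>\<^sub>M borel"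
  unfolding perp_embed_def by measurable

lemma inner_perp_embed [simp]: "b \<in> Basis \<Longrightarrow> perp_embed b q \<bullet> b = 0"
  unfolding perp_embed_def inner_sum_left by (intro sum.neutral) (auto simp: inner_Basis)

lemma sigma_finite_perp: "sigma_finite_measure (perp b)"
  by (intro product_sigma_finite.sigma_finite product_sigma_finite_lborel) auto

lemma nn_integral_slice:
  fixes b :: "'a::euclidean_space"
  assumes b: "b \<in> Basis" and [measurable]: "F \<in> borel_measurable borel"
  shows "(\<integral>\<^sup>+x. F x \<partial>lborel) = (\<integral>\<^sup>+q. (\<integral>\<^sup>+t. F (perp_embed b q + t *\<^sub>R b) \<partial>lborel) \<partial>perp b)"
proof -
  interpret product_sigma_finite "\<lambda>_. lborel :: real measure" ..
  have ins: "Basis = insert b (Basis - {b})" using b by auto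
  have "(\<integral>\<^sup>+x. F x \<partial>lborel) = (\<integral>\<^sup>+f. F (\<Sum>c\<in>Basis. f c *\<^sub>R c) \<partial>(\<Pi>\<^sub>M c\<in>Basis. lborel))"
    by (subst lborel_eq) (simp add: nn_integral_distr)
  also have "\<dots> = (\<integral>\<^sup>+f. F (\<Sum>c\<in>insert b (Basis - {b}). f c *\<^sub>R c) \<partial>(\<Pi>\<^sub>M c\<in>insert b (Basis - {b}). lborel))"
    by (simp only: ins[symmetric])
  also have "\<dots> = (\<integral>\<^sup>+q. (\<integral>\<^sup>+t. F (\<Sum>c\<in>insert b (Basis - {b}). (q(b := t)) c *\<^sub>R c) \<partial>lborel) \<partial>perp b)"
    by (rule product_nn_integral_insert) auto
  also have "\<dots> = (\<integral>\<^sup>+q. (\<integral>\<^sup>+t. F (perp_embed b q + t *\<^sub>R b) \<partial>lborel) \<partial>perp b)"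
  proof (intro nn_integral_cong arg_cong[where f=F])
    fix q t
    have "(\<Sum>c\<in>insert b (Basis - {b}). (q(b := t)) c *\<^sub>R c) = t *\<^sub>R b + (\<Sum>c\<in>Basis - {b}. (q(b := t)) c *\<^sub>R c)"
      by (subst sum.insert) auto
    also have "(\<Sum>c\<in>Basis - {b}. (q(b := t)) c *\<^sub>R c) = perp_embed b q"
      unfolding perp_embed_def by (intro sum.cong) auto
    finally show "(\<Sum>c\<in>insert b (Basis - {b}). (q(b := t)) c *\<^sub>R c) = perp_embed b q + t *\<^sub>R b" by simp
  qed
  finally show ?thesis .
qed

lemma emeasure_slice:
  fixes b :: "'a::euclidean_space"
  assumes b: "b \<in> Basis" and [measurable]: "A \<in> sets borel"
  shows "vol A = (\<integral>\<^sup>+q. vol {t. perp_embed b q + t *\<^sub>R b \<in> A} \<partial>perp b)"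
proof -
  have "{t. perp_embed b q + t *\<^sub>R b \<in> A} \<in> sets borel" for q by measurable
  then show ?thesis
    using nn_integral_slice[OF b, of "indicator A"] by (simp add: nn_integral_indicator_vimage)
qed

text \<open>Each column is cut along its own line in direction \<open>b\<close>, all at once. The
  map from pairs \<open>(q, t)\<close> to tuples carries the product measure to
  \<open>lborel_PiM\<close>, because the two agree on boxes, where the integrals factor over the
  columns.\<close>

lemma nn_integral_PiM_slice:
  fixes b :: "'a::euclidean_space" and F :: "('i::finite \<Rightarrow> 'a) \<Rightarrow> ennreal"
  assumes b: "b \<in> Basis" and F[measurable]: "F \<in> borel_measurable lborel_PiM"
  shows "(\<integral>\<^sup>+x. F x \<partial>lborel_PiM) =
    (\<integral>\<^sup>+q. (\<integral>\<^sup>+t. F (\<lambda>i. perp_embed b (q i) + t i *\<^sub>R b) \<partial>lborel_PiM) \<partial>(\<Pi>\<^sub>M i\<in>UNIV. perp b))"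
proof -
  interpret A: product_sigma_finite "\<lambda>_::'i. lborel :: 'a measure" by (rule product_sigma_finite_lborel)
  interpret R: product_sigma_finite "\<lambda>_::'i. lborel :: real measure" by (rule product_sigma_finite_lborel)
  interpret Q: product_sigma_finite "\<lambda>_::'i. perp b"
    by (intro product_sigma_finite.intro sigma_finite_perp)
  interpret RP: sigma_finite_measure "lborel_PiM :: ('i \<Rightarrow> real) measure"
    by (rule R.sigma_finite) simp
  let ?Q = "\<Pi>\<^sub>M i\<in>(UNIV::'i set). perp b"
  let ?R = "lborel_PiM :: ('i \<Rightarrow> real) measure"
  let ?h = "\<lambda>(q, t) i. perp_embed b (q i) + t i *\<^sub>R b"
  have h[measurable]: "?h \<in> ?Q \<Otimes>\<^sub>M ?R \<rightarrow>\<^sub>M lborel_PiM"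
    unfolding split_beta'
    by (rule measurable_PiM_single') (auto intro!: borel_measurable_add)
  have eq: "distr (?Q \<Otimes>\<^sub>M ?R) lborel_PiM ?h = lborel_PiM"
  proof (rule A.PiM_eqI)
    fix A :: "'i \<Rightarrow> 'a set" assume "\<And>i. i \<in> UNIV \<Longrightarrow> A i \<in> sets lborel"
    then have A[measurable]: "A i \<in> sets borel" for i by simp
    have box: "Pi\<^sub>E UNIV A = {x. \<forall>i. x i \<in> A i}" by (auto simp: PiE_def Pi_def)
    have "emeasure (distr (?Q \<Otimes>\<^sub>M ?R) lborel_PiM ?h) (Pi\<^sub>E UNIV A)
      = (\<integral>\<^sup>+x. indicator {x. \<forall>i. x i \<in> A i} x \<partial>distr (?Q \<Otimes>\<^sub>M ?R) lborel_PiM ?h)"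
      unfolding box by simp
    also have "\<dots> = (\<integral>\<^sup>+z. indicator {x. \<forall>i. x i \<in> A i} (?h z) \<partial>(?Q \<Otimes>\<^sub>M ?R))"
      by (rule nn_integral_distr) auto
    also have "\<dots> = (\<integral>\<^sup>+q. (\<integral>\<^sup>+t. indicator {x. \<forall>i. x i \<in> A i} (?h (q, t)) \<partial>?R) \<partial>?Q)"
      by (rule RP.nn_integral_fst[symmetric]) measurable
    also have "\<dots> = (\<integral>\<^sup>+q. (\<integral>\<^sup>+t. (\<Prod>i\<in>UNIV. indicator (A i) (perp_embed b (q i) + t i *\<^sub>R b)) \<partial>?R) \<partial>?Q)"
      by (intro nn_integral_cong) (auto simp: prod_indicator[OF finite, of A])
    also have "\<dots> = (\<integral>\<^sup>+q. (\<Prod>i\<in>UNIV. \<integral>\<^sup>+t. indicator (A i) (perp_embed b (q i) + t *\<^sub>R b) \<partial>lborel) \<partial>?Q)"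
      by (intro nn_integral_cong R.product_nn_integral_prod) auto
    also have "\<dots> = (\<Prod>i\<in>UNIV. \<integral>\<^sup>+q. (\<integral>\<^sup>+t. indicator (A i) (perp_embed b q + t *\<^sub>R b) \<partial>lborel) \<partial>perp b)"
      by (intro Q.product_nn_integral_prod) auto
    also have "\<dots> = (\<Prod>i\<in>UNIV. vol (A i))"
      by (intro prod.cong refl) (subst nn_integral_slice[OF b, symmetric], auto)
    finally show "emeasure (distr (?Q \<Otimes>\<^sub>M ?R) lborel_PiM ?h) (Pi\<^sub>E UNIV A) = (\<Prod>i\<in>UNIV. vol (A i))" .
  qed auto
  have "(\<integral>\<^sup>+x. F x \<partial>lborel_PiM) = (\<integral>\<^sup>+z. F (?h z) \<partial>(?Q \<Otimes>\<^sub>M ?R))"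
    by (subst eq[symmetric]) (rule nn_integral_distr, auto)
  also have "\<dots> = (\<integral>\<^sup>+q. (\<integral>\<^sup>+t. F (?h (q, t)) \<partial>?R) \<partial>?Q)"
    by (rule RP.nn_integral_fst[symmetric]) measurable
  finally show ?thesis by simp
qed

section \<open>Steiner symmetrisation and its effect on volumes\<close>

definition line_measure :: "'a::euclidean_space \<Rightarrow> 'a set \<Rightarrow> 'a \<Rightarrow> ennreal" where
  "line_measure b A x = vol {t. x + (t - x \<bullet> b) *\<^sub>R b \<in> A}"

text \<open>A section of finite length becomes an open centred interval of the same length; the
  strict inequality makes null sections empty, as for \<open>sym_rearr_set\<close>. In
  \<open>line_measure\<close>, the variable \<open>t\<close> is the coordinate along
  \<open>b\<close>, so its value is constant on each line.\<close>

definition steiner :: "'a::euclidean_space \<Rightarrow> 'a set \<Rightarrow> 'a set" where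
  "steiner b A = {x. ennreal (2 * \<bar>x \<bullet> b\<bar>) < line_measure b A x}"

lemma line_measure_measurable [measurable]:
  assumes [measurable]: "A \<in> sets borel"
  shows "line_measure b A \<in> borel_measurable borel"
proof -
  have "{t. x + (t - x \<bullet> b) *\<^sub>R b \<in> A} \<in> sets borel" for x by measurable
  then have "line_measure b A = (\<lambda>x. \<integral>\<^sup>+t. indicator A (x + (t - x \<bullet> b) *\<^sub>R b) \<partial>lborel)"
    by (simp add: fun_eq_iff line_measure_def nn_integral_indicator_vimage)
  also have "\<dots> \<in> borel_measurable borel" by measurable
  finally show ?thesis .
qed

lemma steiner_measurable [measurable]:
  assumes [measurable]: "A \<in> sets borel"
  shows "steiner b A \<in> sets borel"
proof -
  have "{x \<in> space borel. ennreal (2 * \<bar>x \<bullet> b\<bar>) < line_measure b A x} \<in> sets borel" by measurable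
  then show ?thesis by (simp add: steiner_def)
qed

lemma steiner_slice:
  assumes "b \<in> Basis"
  shows "{t. perp_embed b q + t *\<^sub>R b \<in> steiner b A}
    = {t. ennreal (2 * \<bar>t\<bar>) < vol {t. perp_embed b q + t *\<^sub>R b \<in> A}}"
  using assms by (simp add: steiner_def line_measure_def inner_add_left scaleR_left_distrib[symmetric] add.assoc)

lemma emeasure_centred_interval:
  assumes "c < \<infinity>"
  shows "vol {t. ennreal (2 * \<bar>t\<bar>) < c} = c"
proof -
  obtain r where r: "c = ennreal r" "0 \<le> r" using assms by (cases c) auto
  have "{t. ennreal (2 * \<bar>t\<bar>) < c} = {- (r / 2)<..<r / 2}"
    using r by (auto simp: ennreal_less_iff abs_less_iff)
  then show ?thesis using r by simp
qed

lemma line_in_ball: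
  assumes "A \<subseteq> ball 0 R" "b \<in> Basis"
  shows "{t. perp_embed b q + t *\<^sub>R b \<in> A} \<subseteq> {-R<..<R}"
proof
  fix t assume "t \<in> {t. perp_embed b q + t *\<^sub>R b \<in> A}"
  then have "norm (perp_embed b q + t *\<^sub>R b) < R" using assms(1) by auto
  moreover have "\<bar>(perp_embed b q + t *\<^sub>R b) \<bullet> b\<bar> \<le> norm (perp_embed b q + t *\<^sub>R b)"
    using Basis_le_norm[OF assms(2)] .
  moreover have "(perp_embed b q + t *\<^sub>R b) \<bullet> b = t" using assms(2) by (simp add: inner_add_left)
  ultimately have "\<bar>t\<bar> < R" by linarith
  then show "t \<in> {-R<..<R}" by auto
qed

text \<open>Boundedness makes every section finite; for a set of merely finite measure this could
  fail on a null set of lines.\<close>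

lemma line_finite:
  assumes "A \<subseteq> ball 0 R" "b \<in> Basis"
  shows "vol {t. perp_embed b q + t *\<^sub>R b \<in> A} < \<infinity>"
proof -
  have "vol {t. perp_embed b q + t *\<^sub>R b \<in> A} \<le> vol {-R<..<R}"
    by (intro emeasure_mono line_in_ball assms) auto
  also have "\<dots> < \<infinity>" by (cases "R \<ge> 0") auto
  finally show ?thesis .
qed

lemma emeasure_steiner:
  assumes b: "b \<in> Basis" and [measurable]: "A \<in> sets borel" and A: "A \<subseteq> ball 0 R"
  shows "vol (steiner b A) = vol A"
  unfolding emeasure_slice[OF b steiner_measurable[OF assms(2)]] emeasure_slice[OF b assms(2)] steiner_slice[OF b]
  by (intro nn_integral_cong emeasure_centred_interval line_finite[OF A b])

text \<open>The line through \<open>x\<close> meets the ball in a centred interval of half-length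
  \<open>w\<close>. The section of \<open>A\<close> lies inside it, so its length is at most
  \<open>2 * w\<close>, and the open centred interval of that length lies in the ball too.\<close>

lemma steiner_subset_ball:
  assumes b: "b \<in> Basis" and A: "A \<subseteq> ball 0 R"
  shows "steiner b A \<subseteq> ball 0 R"
proof
  fix x assume x: "x \<in> steiner b A"
  define y where "y = x - (x \<bullet> b) *\<^sub>R b"
  have yb: "y \<bullet> b = 0" using b by (simp add: y_def inner_diff_left)
  have nrm: "(norm (y + t *\<^sub>R b))\<^sup>2 = (norm y)\<^sup>2 + t\<^sup>2" for t
    using yb b unfolding power2_norm_eq_inner
    by (simp add: inner_add_left inner_add_right inner_commute power2_eq_square)
  have xy: "x + (t - x \<bullet> b) *\<^sub>R b = y + t *\<^sub>R b" for t by (simp add: y_def algebra_simps)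
  define L where "L = {t. y + t *\<^sub>R b \<in> A}"
  have gt: "ennreal (2 * \<bar>x \<bullet> b\<bar>) < vol L"
    using x by (simp add: steiner_def line_measure_def xy L_def)
  have L: "(norm y)\<^sup>2 + t\<^sup>2 < R\<^sup>2" "R > 0" if "t \<in> L" for t
  proof -
    have "norm (y + t *\<^sub>R b) < R" using A that by (auto simp: L_def)
    then show "R > 0" by (meson le_less_trans norm_ge_zero)
    show "(norm y)\<^sup>2 + t\<^sup>2 < R\<^sup>2"
      unfolding nrm[symmetric] using \<open>norm (y + t *\<^sub>R b) < R\<close> by (intro power_strict_mono) auto
  qed
  define w where "w = sqrt (R\<^sup>2 - (norm y)\<^sup>2)"
  have "L \<noteq> {}" using gt by auto
  then obtain t0 where "t0 \<in> L" by auto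
  then have R: "R > 0" "(norm y)\<^sup>2 < R\<^sup>2" using L[of t0] by (auto simp: intro: le_less_trans[rotated])
  have "L \<subseteq> {-w..w}"
  proof
    fix t assume "t \<in> L"
    then have "t\<^sup>2 \<le> R\<^sup>2 - (norm y)\<^sup>2" using L[of t] by linarith
    then have "\<bar>t\<bar> \<le> w" unfolding w_def by (metis real_sqrt_abs real_sqrt_le_mono)
    then show "t \<in> {-w..w}" by auto
  qed
  then have "vol L \<le> vol {-w..w}" by (intro emeasure_mono) auto
  moreover have w: "w \<ge> 0" unfolding w_def using R(2) by (intro real_sqrt_ge_zero) linarith
  ultimately have "ennreal (2 * \<bar>x \<bullet> b\<bar>) < ennreal (2 * w)" using gt by (simp add: less_le_trans)
  then have "\<bar>x \<bullet> b\<bar> < w" by (simp add: ennreal_less_iff)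
  then have "(x \<bullet> b)\<^sup>2 < w\<^sup>2" by (metis abs_ge_zero power2_abs power_strict_mono pos2)
  moreover have "w\<^sup>2 = R\<^sup>2 - (norm y)\<^sup>2" unfolding w_def using R(2) by (intro real_sqrt_pow2) linarith
  moreover have "(norm x)\<^sup>2 = (norm y)\<^sup>2 + (x \<bullet> b)\<^sup>2" using nrm[of "x \<bullet> b"] by (simp add: y_def)
  ultimately have "(norm x)\<^sup>2 < R\<^sup>2" by linarith
  then have "norm x < R" using R(1) by (intro power2_less_imp_less[of "norm x" R]) auto
  then show "x \<in> ball 0 R" by simp
qed

text \<open>The reflection in the hyperplane orthogonal to \<open>b\<close> fixes the foot of every
  line and changes the sign of all \<open>t i\<close> at once; invariance of \<open>K\<close> under
  it makes the slice \<open>Kq q\<close> symmetric. The one-dimensional inequality then applies for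
  every \<open>q\<close>.\<close>

lemma multi_volume_steiner:
  fixes K :: "('i::finite \<Rightarrow> 'a::euclidean_space) set"
  assumes Km[measurable]: "K \<in> sets lborel_PiM" and conv: "fun_convex K" and inv: "orth_invariant K"
    and b: "b \<in> Basis"
    and A[measurable]: "\<And>i. A i \<in> sets borel" and bd: "\<And>i. A i \<subseteq> ball 0 R"
  shows "multi_volume K A \<le> multi_volume K (\<lambda>i. steiner b (A i))"
proof -
  define Kq where "Kq q = {t. (\<lambda>i. perp_embed b (q i) + t i *\<^sub>R b) \<in> K}" for q :: "'i \<Rightarrow> 'a \<Rightarrow> real"
  have slice: "multi_volume K D = (\<integral>\<^sup>+q. multi_volume (Kq q) (\<lambda>i. {t. perp_embed b (q i) + t *\<^sub>R b \<in> D i}) \<partial>(\<Pi>\<^sub>M i\<in>UNIV. perp b))"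
    if [measurable]: "\<And>i. D i \<in> sets borel" for D
    unfolding multi_integral_def
    by (subst nn_integral_PiM_slice[OF b], measurable)
       (auto intro!: nn_integral_cong simp: indicator_def Kq_def)
  have inv': "(\<lambda>i. T (x i)) \<in> K" if "orthogonal_transformation T" "x \<in> K" for T x
    using inv that by (simp add: orth_invariant_def)
  show ?thesis
    unfolding slice[OF A] slice[OF steiner_measurable[OF A]] steiner_slice[OF b]
  proof (rule nn_integral_mono)
    fix q
    have m: "(\<lambda>t i. perp_embed b (q i) + t i *\<^sub>R b) \<in> (lborel_PiM :: ('i \<Rightarrow> real) measure) \<rightarrow>\<^sub>M lborel_PiM"
      by (rule measurable_PiM_single') auto
    have Kqm: "Kq q \<in> sets lborel_PiM"
      using measurable_sets[OF m Km] by (simp add: Kq_def vimage_def)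
    have c: "fun_convex (Kq q)"
      unfolding fun_convex_def
    proof (intro ballI)
      fix x y u assume x: "x \<in> Kq q" and y: "y \<in> Kq q" and u: "u \<in> {0..1::real}"
      have "(\<lambda>i. (1 - u) *\<^sub>R (perp_embed b (q i) + x i *\<^sub>R b) + u *\<^sub>R (perp_embed b (q i) + y i *\<^sub>R b)) \<in> K"
        using conv x y u by (auto simp: fun_convex_def Kq_def)
      also have "(\<lambda>i. (1 - u) *\<^sub>R (perp_embed b (q i) + x i *\<^sub>R b) + u *\<^sub>R (perp_embed b (q i) + y i *\<^sub>R b))
        = (\<lambda>i. perp_embed b (q i) + ((1 - u) *\<^sub>R x i + u *\<^sub>R y i) *\<^sub>R b)"
        by (auto simp: fun_eq_iff algebra_simps)
      finally show "(\<lambda>i. (1 - u) *\<^sub>R x i + u *\<^sub>R y i) \<in> Kq q" by (simp add: Kq_def)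
    qed
    have s: "fun_symmetric (Kq q)"
      unfolding fun_symmetric_def
    proof (intro ballI)
      fix x assume x: "x \<in> Kq q"
      let ?T = "\<lambda>x. x - (2 * (x \<bullet> b) / (b \<bullet> b)) *\<^sub>R b"
      have "(\<lambda>i. ?T (perp_embed b (q i) + x i *\<^sub>R b)) \<in> K"
        using x by (intro inv'[OF orthogonal_transformation_reflection]) (simp add: Kq_def)
      also have "(\<lambda>i. ?T (perp_embed b (q i) + x i *\<^sub>R b)) = (\<lambda>i. perp_embed b (q i) + (- x i) *\<^sub>R b)"
        using b by (auto simp: fun_eq_iff inner_add_left algebra_simps scaleR_2[symmetric])
      finally show "(\<lambda>i. - x i) \<in> Kq q" by (simp add: Kq_def)
    qed
    show "multi_volume (Kq q) (\<lambda>i. {t. perp_embed b (q i) + t *\<^sub>R b \<in> A i}) \<le>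
      multi_volume (Kq q) (\<lambda>i. {t. ennreal (2 * \<bar>t\<bar>) < vol {t. perp_embed b (q i) + t *\<^sub>R b \<in> A i}})"
    proof (rule multi_volume_rearrange_real[OF Kqm c s])
      show "{t. perp_embed b (q i) + t *\<^sub>R b \<in> A i} \<in> sets borel" for i by measurable
      show "vol {t. perp_embed b (q i) + t *\<^sub>R b \<in> A i} < \<infinity>" for i
        by (rule line_finite[OF bd b])
    qed
  qed
qed

text \<open>On each line, the symmetrised slice and the slice of the ball are nested centred intervals,
  so their intersection is the smaller of the two.\<close>

lemma steiner_gain:
  assumes b: "b \<in> Basis" and A[measurable]: "A \<in> sets borel" and bd: "A \<subseteq> ball 0 R"
    and W[measurable]: "W \<in> sets borel" and W1: "W \<subseteq> A - ball 0 r"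
    and W2: "\<And>x. x \<in> W \<Longrightarrow> x + l *\<^sub>R b \<in> ball 0 r - A"
  shows "vol (A \<inter> ball 0 r) + vol W \<le> vol (steiner b A \<inter> ball 0 r)"
proof -
  let ?s = "\<lambda>q A. {t. perp_embed b q + t *\<^sub>R b \<in> A}"
  have [measurable]: "?s q D \<in> sets borel" if [measurable]: "D \<in> sets borel" for q D by measurable
  have meas: "(\<lambda>q. vol (?s q D)) \<in> borel_measurable (perp b)" if D[measurable]: "D \<in> sets borel" for D
  proof -
    have "?s q D \<in> sets borel" for q by measurable
    then have "(\<lambda>q. vol (?s q D)) = (\<lambda>q. \<integral>\<^sup>+t. indicator D (perp_embed b q + t *\<^sub>R b) \<partial>lborel)"
      by (simp add: nn_integral_indicator_vimage)
    also have "\<dots> \<in> borel_measurable (perp b)" by measurable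
    finally show ?thesis .
  qed
  have "vol (A \<inter> ball 0 r) + vol W
    = (\<integral>\<^sup>+q. vol (?s q (A \<inter> ball 0 r)) + vol (?s q W) \<partial>perp b)"
  proof -
    have "vol (A \<inter> ball 0 r) + vol W
      = (\<integral>\<^sup>+q. vol (?s q (A \<inter> ball 0 r)) \<partial>perp b) + (\<integral>\<^sup>+q. vol (?s q W) \<partial>perp b)"
      by (intro arg_cong2[where f="(+)"] emeasure_slice[OF b]) auto
    also have "\<dots> = (\<integral>\<^sup>+q. vol (?s q (A \<inter> ball 0 r)) + vol (?s q W) \<partial>perp b)"
      by (intro nn_integral_add[symmetric] meas) auto
    finally show ?thesis .
  qed
  also have "\<dots> \<le> (\<integral>\<^sup>+q. vol (?s q (steiner b A \<inter> ball 0 r)) \<partial>perp b)"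
  proof (rule nn_integral_mono)
    fix q
    define X where "X = {t. ennreal (2 * \<bar>t\<bar>) < vol (?s q A)}"
    define Y where "Y = ?s q (ball 0 r)"
    have XY: "?s q (steiner b A \<inter> ball 0 r) = X \<inter> Y"
      unfolding X_def Y_def steiner_slice[OF b, symmetric] by auto
    have bp: "b \<bullet> perp_embed b q = 0" using b by (subst inner_commute) simp
    have nrm: "(norm (perp_embed b q + t *\<^sub>R b))\<^sup>2 = (norm (perp_embed b q))\<^sup>2 + t\<^sup>2" for t
      using b unfolding power2_norm_eq_inner
      by (simp add: inner_add_left inner_add_right bp power2_eq_square)
    have Ydown: "s \<in> Y" if "t \<in> Y" "\<bar>s\<bar> \<le> \<bar>t\<bar>" for s t
    proof -
      have "s\<^sup>2 \<le> t\<^sup>2" using that(2) by (simp add: abs_le_square_iff)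
      then have "(norm (perp_embed b q + s *\<^sub>R b))\<^sup>2 \<le> (norm (perp_embed b q + t *\<^sub>R b))\<^sup>2" by (simp add: nrm)
      then have "norm (perp_embed b q + s *\<^sub>R b) \<le> norm (perp_embed b q + t *\<^sub>R b)" by (rule power2_le_imp_le) simp
      then show ?thesis using that(1) by (auto simp: Y_def)
    qed
    have Xdown: "s \<in> X" if "t \<in> X" "\<bar>s\<bar> \<le> \<bar>t\<bar>" for s t
    proof -
      have "ennreal (2 * \<bar>s\<bar>) \<le> ennreal (2 * \<bar>t\<bar>)" using that(2) by (intro ennreal_leI) simp
      then show ?thesis using that(1) unfolding X_def mem_Collect_eq by (rule le_less_trans)
    qed
    have nested: "X \<subseteq> Y \<or> Y \<subseteq> X"
    proof (rule ccontr)
      assume "\<not> (X \<subseteq> Y \<or> Y \<subseteq> X)"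
      then obtain s t where "s \<in> X" "s \<notin> Y" "t \<in> Y" "t \<notin> X" by auto
      then show False using Xdown[of s t] Ydown[of t s] by linarith
    qed
    have "vol (?s q (A \<inter> ball 0 r)) + vol (?s q W) \<le> vol (X \<inter> Y)"
      using nested
    proof
      \<comment> \<open>Here the two parts are disjoint pieces of the section of \<open>A\<close>,
        whose length is that of \<open>X\<close>.\<close>
      assume "X \<subseteq> Y"
      have "vol (?s q (A \<inter> ball 0 r)) + vol (?s q W)
        = vol (?s q (A \<inter> ball 0 r) \<union> ?s q W)"
        using W1 by (intro plus_emeasure) auto
      also have "\<dots> \<le> vol (?s q A)" using W1 by (intro emeasure_mono) auto
      also have "\<dots> = vol X"
        unfolding X_def by (intro emeasure_centred_interval[symmetric] line_finite[OF bd b])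
      also have "X = X \<inter> Y" using \<open>X \<subseteq> Y\<close> by auto
      finally show ?thesis .
    next
      assume "Y \<subseteq> X"
      \<comment> \<open>The section of \<open>W\<close> moved by \<open>l\<close> along the line: it
        lands in the part of the ball that \<open>A\<close> leaves free.\<close>
      define V where "V = {t. - l + 1 * t \<in> ?s q W}"
      have [measurable]: "V \<in> sets borel"
      unfolding V_def by measurable
      have V: "vol (?s q W) = vol V"
        unfolding V_def by (subst emeasure_affine_vimage[where c=1 and t="-l"]) auto
      have VY: "V \<subseteq> ?s q (ball 0 r - A)"
      proof
        fix t assume "t \<in> V"
        then have "perp_embed b q + (- l + t) *\<^sub>R b \<in> W" by (simp add: V_def)
        from W2[OF this] show "t \<in> ?s q (ball 0 r - A)" by (simp add: algebra_simps)
      qed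
      have "vol (?s q (A \<inter> ball 0 r)) + vol V
        = vol (?s q (A \<inter> ball 0 r) \<union> V)"
        using VY by (intro plus_emeasure) auto
      also have "\<dots> \<le> vol Y" unfolding Y_def using VY by (intro emeasure_mono) auto
      also have "Y = X \<inter> Y" using \<open>Y \<subseteq> X\<close> by auto
      finally show ?thesis by (simp add: V)
    qed
    then show "vol (?s q (A \<inter> ball 0 r)) + vol (?s q W)
      \<le> vol (?s q (steiner b A \<inter> ball 0 r))" unfolding XY .
  qed
  also have "\<dots> = vol (steiner b A \<inter> ball 0 r)"
    by (rule emeasure_slice[OF b, symmetric]) measurable
  finally show ?thesis .
qed

section \<open>Rearrangement of sets\<close>

lemma orthogonal_transformation_measurable:
  fixes T :: "'a::euclidean_space \<Rightarrow> 'a"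
  assumes "orthogonal_transformation T"
  shows "T \<in> borel \<rightarrow>\<^sub>M borel"
proof -
  have "bounded_linear T"
    using orthogonal_transformation_linear[OF assms] linear_conv_bounded_linear by blast
  then show ?thesis by (intro borel_measurable_continuous_onI linear_continuous_on)
qed

lemma nn_integral_lborel_shift:
  fixes g :: "'a::euclidean_space \<Rightarrow> ennreal"
  assumes [measurable]: "g \<in> borel_measurable borel"
  shows "(\<integral>\<^sup>+x. g (c + x) \<partial>lborel) = (\<integral>\<^sup>+x. g x \<partial>lborel)"
proof -
  have "(\<integral>\<^sup>+x. g x \<partial>distr lborel borel ((+) c)) = (\<integral>\<^sup>+x. g (c + x) \<partial>lborel)"
    by (rule nn_integral_distr) auto
  then show ?thesis unfolding lborel_distr_plus by (rule sym)
qed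

lemma nn_integral_lborel_minus:
  fixes g :: "'a::euclidean_space \<Rightarrow> ennreal"
  assumes [measurable]: "g \<in> borel_measurable borel"
  shows "(\<integral>\<^sup>+x. g (c - x) \<partial>lborel) = (\<integral>\<^sup>+x. g x \<partial>lborel)"
proof -
  have "lborel = density (distr lborel borel (\<lambda>x. c + (-1) *\<^sub>R x)) (\<lambda>_. 1)"
    using lborel_affine[of "-1" c] by simp
  then have eq: "lborel = distr lborel borel (\<lambda>x. c - x)"
    by (simp add: density_1)
  have "(\<integral>\<^sup>+x. g x \<partial>distr lborel borel (\<lambda>x. c - x)) = (\<integral>\<^sup>+x. g (c - x) \<partial>lborel)"
    by (rule nn_integral_distr) auto
  then show ?thesis unfolding eq[symmetric] by (rule sym)
qed

text \<open>Uniqueness of translation-invariant measures: integrate \<open>1\<^sub>A(T x) 1\<^sub>B(T x + y)\<close>, where \<open>B\<close> is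
  the unit ball, over \<open>x\<close> and \<open>y\<close> in both orders.\<close>

lemma emeasure_orthogonal_vimage:
  fixes T :: "'a::euclidean_space \<Rightarrow> 'a"
  assumes T: "orthogonal_transformation T" and A[measurable]: "A \<in> sets borel"
  shows "vol {x. T x \<in> A} = vol A"
proof -
  note [measurable] = orthogonal_transformation_measurable[OF T]
  have TB: "T x \<in> ball 0 1 \<longleftrightarrow> x \<in> ball 0 1" for x
    using orthogonal_transformation_norm[OF T] by simp
  let ?B = "ball 0 1 :: 'a set"
  have [measurable]: "?B \<in> sets borel" by simp
  have [measurable]: "{x. T x \<in> A} \<in> sets borel"
    using measurable_sets[OF orthogonal_transformation_measurable[OF T] A] by (simp add: vimage_def)
  have lin: "T (x + y) = T x + T y" for x y
    using orthogonal_transformation_linear[OF T] by (simp add: linear_add)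
  have "vol {x. T x \<in> A} * vol ?B
    = (\<integral>\<^sup>+x. indicator A (T x) * vol ?B \<partial>lborel)"
    by (simp add: nn_integral_multc nn_integral_indicator_vimage)
  also have "\<dots> = (\<integral>\<^sup>+x. (\<integral>\<^sup>+y. indicator A (T x) * indicator ?B (T x + y) \<partial>lborel) \<partial>lborel)"
  proof (intro nn_integral_cong)
    fix x
    have "(\<integral>\<^sup>+y. indicator ?B (T x + y) \<partial>lborel) = (\<integral>\<^sup>+y. indicator ?B y \<partial>lborel)"
      by (rule nn_integral_lborel_shift) measurable
    then show "indicator A (T x) * vol ?B = (\<integral>\<^sup>+y. indicator A (T x) * indicator ?B (T x + y) \<partial>lborel)"
      by (subst nn_integral_cmult) auto
  qed
  also have "\<dots> = (\<integral>\<^sup>+y. (\<integral>\<^sup>+x. indicator A (T x) * indicator ?B (T x + y) \<partial>lborel) \<partial>lborel)"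
    by (rule lborel_pair.Fubini') measurable
  also have "\<dots> = (\<integral>\<^sup>+y. (\<integral>\<^sup>+x. indicator A (T x - y) * indicator ?B (T x) \<partial>lborel) \<partial>lborel)"
  proof (rule nn_integral_cong)
    fix y
    obtain z where z: "y = T z"
      using orthogonal_transformation_surj[OF T] by (meson surjE)
    have "(\<integral>\<^sup>+x. indicator A (T x - y) * indicator ?B (T x) \<partial>lborel)
      = (\<integral>\<^sup>+x. indicator A (T (z + x) - y) * indicator ?B (T (z + x)) \<partial>lborel)"
      by (rule nn_integral_lborel_shift[symmetric]) measurable
    then show "(\<integral>\<^sup>+x. indicator A (T x) * indicator ?B (T x + y) \<partial>lborel)
      = (\<integral>\<^sup>+x. indicator A (T x - y) * indicator ?B (T x) \<partial>lborel)"
      by (simp add: lin z add.commute[of "T z"])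
  qed
  also have "\<dots> = (\<integral>\<^sup>+x. (\<integral>\<^sup>+y. indicator A (T x - y) * indicator ?B (T x) \<partial>lborel) \<partial>lborel)"
    by (rule lborel_pair.Fubini') measurable
  also have "\<dots> = (\<integral>\<^sup>+x. vol A * indicator ?B x \<partial>lborel)"
  proof (intro nn_integral_cong)
    fix x
    have "(\<integral>\<^sup>+y. indicator A (T x - y) \<partial>lborel) = (\<integral>\<^sup>+y. indicator A y \<partial>lborel)"
      by (rule nn_integral_lborel_minus) measurable
    moreover have "indicator ?B (T x) = (indicator ?B x :: ennreal)"
      using TB[of x] by (auto simp: indicator_def)
    ultimately show "(\<integral>\<^sup>+y. indicator A (T x - y) * indicator ?B (T x) \<partial>lborel) = vol A * indicator ?B x"
      by (subst nn_integral_multc) auto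
  qed
  also have "\<dots> = vol A * vol ?B"
    by (simp add: nn_integral_cmult)
  finally have "vol {x. T x \<in> A} * vol ?B = vol A * vol ?B" .
  moreover have B: "vol ?B = ennreal (unit_ball_vol (real DIM('a)))"
    using emeasure_ball[of 1 "0::'a"] by simp
  moreover have "0 < unit_ball_vol (real DIM('a))" by simp
  then have "vol ?B \<noteq> 0" unfolding B by (metis ennreal_eq_0_iff leD)
  moreover have "vol ?B < \<infinity>" by (simp add: B)
  ultimately show ?thesis
    by (metis mult_divide_eq_ennreal infinity_ennreal_def less_irrefl)
qed

lemma lborel_PiM_orthogonal:
  fixes T :: "'a::euclidean_space \<Rightarrow> 'a"
  assumes T: "orthogonal_transformation T"
  shows "distr lborel_PiM lborel_PiM (\<lambda>(x::'i::finite \<Rightarrow> 'a) i. T (x i)) = lborel_PiM"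
proof -
  interpret product_sigma_finite "\<lambda>_::'i. lborel :: 'a measure" by (rule product_sigma_finite_lborel)
  note Tm[measurable] = orthogonal_transformation_measurable[OF T]
  have [measurable]: "(\<lambda>(x::'i \<Rightarrow> 'a) i. T (x i)) \<in> lborel_PiM \<rightarrow>\<^sub>M lborel_PiM"
    by (rule measurable_PiM_single') auto
  show ?thesis
  proof (rule PiM_eqI)
    fix A :: "'i \<Rightarrow> 'a set" assume "\<And>i. i \<in> UNIV \<Longrightarrow> A i \<in> sets lborel"
    then have A[measurable]: "A i \<in> sets borel" for i by simp
    have TA: "{x. T x \<in> A i} \<in> sets borel" for i
      using measurable_sets[OF Tm A] by (simp add: vimage_def)
    have eq: "Pi\<^sub>E UNIV A = {x. \<forall>i. x i \<in> A i}" by (auto simp: PiE_def Pi_def)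
    have "emeasure (distr lborel_PiM lborel_PiM (\<lambda>x i. T (x i))) (Pi\<^sub>E UNIV A)
      = emeasure lborel_PiM {x. \<forall>i. x i \<in> {y. T y \<in> A i}}"
      unfolding eq by (simp add: emeasure_distr vimage_def)
    also have "\<dots> = (\<Prod>i\<in>UNIV. vol {y. T y \<in> A i})"
      by (rule emeasure_box[OF TA])
    finally show "emeasure (distr lborel_PiM lborel_PiM (\<lambda>x i. T (x i))) (Pi\<^sub>E UNIV A)
      = (\<Prod>i\<in>UNIV. vol (A i))"
      by (simp add: emeasure_orthogonal_vimage[OF T])
  qed auto
qed

lemma multi_volume_orthogonal:
  fixes K :: "('i::finite \<Rightarrow> 'a::euclidean_space) set"
  assumes [measurable]: "K \<in> sets lborel_PiM" and inv: "orth_invariant K"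
    and T: "orthogonal_transformation T" and TT: "\<And>x. T (T x) = x"
    and [measurable]: "\<And>i. A i \<in> sets borel"
  shows "multi_volume K (\<lambda>i. {x. T x \<in> A i}) = multi_volume K A"
proof -
  note Tm[measurable] = orthogonal_transformation_measurable[OF T]
  have [measurable]: "(\<lambda>(x::'i \<Rightarrow> 'a) i. T (x i)) \<in> lborel_PiM \<rightarrow>\<^sub>M lborel_PiM"
    by (rule measurable_PiM_single') auto
  have inv': "(\<lambda>i. T (x i)) \<in> K" if "x \<in> K" for x
    using inv T that by (simp add: orth_invariant_def)
  \<comment> \<open>\<open>T\<close> is an involution, so the one-sided invariance of
    \<open>K\<close> becomes an equivalence.\<close>
  have K: "(\<lambda>i. T (x i)) \<in> K \<longleftrightarrow> x \<in> K" for x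
  proof
    assume "(\<lambda>i. T (x i)) \<in> K"
    from inv'[OF this] show "x \<in> K" by (simp add: TT)
  qed (rule inv')
  have "multi_volume K A = (\<integral>\<^sup>+x. indicator K x * (\<Prod>i\<in>UNIV. indicator (A i) (x i))
      \<partial>distr lborel_PiM lborel_PiM (\<lambda>x i. T (x i)))"
    by (simp add: multi_integral_def lborel_PiM_orthogonal[OF T])
  also have "\<dots> = (\<integral>\<^sup>+x. indicator K (\<lambda>i. T (x i)) * (\<Prod>i\<in>UNIV. indicator (A i) (T (x i))) \<partial>lborel_PiM)"
    by (rule nn_integral_distr) measurable
  also have "\<dots> = multi_volume K (\<lambda>i. {x. T x \<in> A i})"
    unfolding multi_integral_def by (intro nn_integral_cong) (simp add: indicator_def K)
  finally show ?thesis by simp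
qed

text \<open>The vectors \<open>w\<close> and \<open>norm w *\<^sub>R b\<close> have equal length, so
  the reflection in the hyperplane orthogonal to their difference exchanges them. Symmetrisation in
  any direction is thereby reduced to a basis vector, where slicing is by coordinates.\<close>

lemma reflection_to_axis:
  fixes w b :: "'a::euclidean_space"
  assumes b: "b \<in> Basis"
  obtains T where "orthogonal_transformation T" "\<And>x. T (T x) = x" "T w = norm w *\<^sub>R b"
proof
  define u where "u = w - norm w *\<^sub>R b"
  define T where "T x = x - (2 * (x \<bullet> u) / (u \<bullet> u)) *\<^sub>R u" for x
  show "orthogonal_transformation T"
    unfolding T_def[abs_def] by (rule orthogonal_transformation_reflection)
  show "T (T x) = x" for x
  proof (cases "u = 0")
    case False
    then have "u \<bullet> u \<noteq> 0" by simp
    then have "T x \<bullet> u = - (x \<bullet> u)" by (simp add: T_def inner_diff_left)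
    then have "T (T x) = T x + (2 * (x \<bullet> u) / (u \<bullet> u)) *\<^sub>R u" by (simp add: T_def[of "T x"])
    then show ?thesis by (simp add: T_def)
  qed (simp add: T_def)
  show "T w = norm w *\<^sub>R b"
  proof (cases "u = 0")
    case False
    have "w \<bullet> w = norm w * norm w" by (simp add: dot_square_norm power2_eq_square)
    moreover have "u \<bullet> u = w \<bullet> w - 2 * (norm w * (w \<bullet> b)) + norm w * norm w"
      using b unfolding u_def inner_diff_left inner_diff_right by (simp add: inner_commute[of b w])
    moreover have "w \<bullet> u = w \<bullet> w - norm w * (w \<bullet> b)"
      unfolding u_def inner_diff_right by simp
    ultimately have "u \<bullet> u = 2 * (w \<bullet> u)" by simp
    moreover have "u \<bullet> u \<noteq> 0" using False by simp
    ultimately have ratio: "2 * (w \<bullet> u) / (u \<bullet> u) = 1" by (metis divide_self)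
    have "T w = w - u" unfolding T_def ratio by simp
    then show ?thesis by (simp add: u_def)
  qed (simp add: T_def u_def)
qed

text \<open>\<open>T\<close> moves the direction \<open>w\<close> onto a basis vector, where the
  sets are symmetrised. The result is not turned back, since \<open>K\<close> and the centred balls
  are invariant under \<open>T\<close>. The shift by \<open>w\<close> becomes a shift along
  \<open>b\<close>, so \<open>steiner_gain\<close> applies to every column.\<close>

lemma symmetrise_towards_balls:
  fixes K :: "('i::finite \<Rightarrow> 'a::euclidean_space) set" and w :: 'a
  assumes Km[measurable]: "K \<in> sets lborel_PiM" and conv: "fun_convex K" and inv: "orth_invariant K"
    and A[measurable]: "\<And>i. A i \<in> sets borel" and bd: "\<And>i. A i \<subseteq> ball 0 R"
  obtains A' where "\<And>i. A' i \<in> sets borel" "\<And>i. A' i \<subseteq> ball 0 R"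
    "\<And>i. vol (A' i) = vol (A i)"
    "multi_volume K A \<le> multi_volume K A'"
    "\<And>i. vol (A i \<inter> ball 0 (r i))
        + vol ((A i - ball 0 (r i)) \<inter> {x. x + w \<in> ball 0 (r i) - A i})
      \<le> vol (A' i \<inter> ball 0 (r i))"
proof -
  obtain b :: 'a where b: "b \<in> Basis" using nonempty_Basis by blast
  obtain T where T: "orthogonal_transformation T" and TT: "\<And>x. T (T x) = x" and Tw: "T w = norm w *\<^sub>R b"
    using reflection_to_axis[OF b] by blast
  note Tm[measurable] = orthogonal_transformation_measurable[OF T]
  have pre: "{x. T x \<in> D} \<in> sets borel" if "D \<in> sets borel" for D
    using measurable_sets[OF Tm that] by (simp add: vimage_def)
  have nT: "norm (T x) = norm x" for x by (rule orthogonal_transformation_norm[OF T])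
  define TA where "TA i = {x. T x \<in> A i}" for i
  have TAm[measurable]: "TA i \<in> sets borel" for i unfolding TA_def by (rule pre[OF A])
  have TAb: "TA i \<subseteq> ball 0 R" for i
    using bd[of i] nT by (auto simp: TA_def subset_iff)
  show ?thesis
  proof (rule that[of "\<lambda>i. steiner b (TA i)"])
    show "steiner b (TA i) \<in> sets borel" for i by measurable
    show "steiner b (TA i) \<subseteq> ball 0 R" for i by (rule steiner_subset_ball[OF b TAb])
    show "vol (steiner b (TA i)) = vol (A i)" for i
      using emeasure_steiner[OF b TAm TAb, of i] emeasure_orthogonal_vimage[OF T A, of i]
      by (simp only: TA_def)
    have "multi_volume K A = multi_volume K TA"
      unfolding TA_def using multi_volume_orthogonal[OF Km inv T TT A] by simp
    also have "\<dots> \<le> multi_volume K (\<lambda>i. steiner b (TA i))"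
      by (rule multi_volume_steiner[OF Km conv inv b TAm TAb])
    finally show "multi_volume K A \<le> multi_volume K (\<lambda>i. steiner b (TA i))" .
    fix i
    let ?W = "(A i - ball 0 (r i)) \<inter> {x. x + w \<in> ball 0 (r i) - A i}"
    have Wm: "?W \<in> sets borel"
    proof -
      have "{x. x + w \<in> ball 0 (r i) - A i} \<in> sets borel"
        using measurable_sets[of "\<lambda>x. x + w" borel borel "ball 0 (r i) - A i"] by (simp add: vimage_def)
      then show ?thesis by simp
    qed
    have "vol (A i \<inter> ball 0 (r i)) + vol ?W
      = vol {x. T x \<in> A i \<inter> ball 0 (r i)} + vol {x. T x \<in> ?W}"
      by (subst (1 2) emeasure_orthogonal_vimage[OF T]) (use Wm in auto)
    also have "{x. T x \<in> A i \<inter> ball 0 (r i)} = TA i \<inter> ball 0 (r i)"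
      by (auto simp: TA_def nT)
    also have "vol (TA i \<inter> ball 0 (r i)) + vol {x. T x \<in> ?W}
       \<le> vol (steiner b (TA i) \<inter> ball 0 (r i))"
    proof (rule steiner_gain[OF b TAm TAb pre[OF Wm], where l="norm w"])
      show "{x. T x \<in> ?W} \<subseteq> TA i - ball 0 (r i)" by (auto simp: TA_def nT)
      fix x assume "x \<in> {x. T x \<in> ?W}"
      then have *: "T x + w \<in> ball 0 (r i) - A i" by simp
      have "T (x + norm w *\<^sub>R b) = T x + T (T w)"
        using orthogonal_transformation_linear[OF T] by (simp add: linear_add Tw)
      then have "T (x + norm w *\<^sub>R b) = T x + w" by (simp add: TT)
      then show "x + norm w *\<^sub>R b \<in> ball 0 (r i) - TA i"
        using * nT[of "x + norm w *\<^sub>R b"] by (simp add: TA_def)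
    qed
    finally show "vol (A i \<inter> ball 0 (r i)) + vol ?W
      \<le> vol (steiner b (TA i) \<inter> ball 0 (r i))" .
  qed
qed

text \<open>Averaging: by Fubini and translation invariance, the integral over \<open>w\<close> of
  the sum of overlaps is \<open>c\<close>, while the sum vanishes for \<open>w\<close> outside the
  ball of radius \<open>2 * R\<close>. All columns enter one sum because a single shift must serve
  them all. The factor 2 in the condition on \<open>g\<close> leaves room for a contradiction from
  non-strict estimates.\<close>

lemma exists_good_shift:
  fixes U V :: "'i::finite \<Rightarrow> 'a::euclidean_space set"
  assumes [measurable]: "\<And>i. U i \<in> sets borel" "\<And>i. V i \<in> sets borel"
    and bd: "\<And>i. U i \<subseteq> ball 0 R" "\<And>i. V i \<subseteq> ball 0 R"
    and c: "(\<Sum>i\<in>UNIV. vol (U i) * vol (V i)) = ennreal c" "0 < c"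
    and g: "2 * (g * measure lborel (ball (0::'a) (2 * R))) \<le> c" "0 \<le> g"
  shows "\<exists>w. ennreal g \<le> (\<Sum>i\<in>UNIV. vol (U i \<inter> {x. x + w \<in> V i}))"
proof (rule ccontr)
  let ?S = "\<lambda>w. \<Sum>i\<in>UNIV. vol (U i \<inter> {x. x + w \<in> V i})"
  assume "\<not> ?thesis"
  then have small: "?S w \<le> ennreal g" for w by (auto simp: not_le intro: less_imp_le)
  have [measurable]: "ball (0::'a) s \<in> sets borel" for s by simp
  have Wm: "U i \<inter> {x. x + w \<in> V i} \<in> sets borel" for i w
    using measurable_sets[of "\<lambda>x. x + w" borel borel "V i"] by (simp add: vimage_def)
  have W: "vol (U i \<inter> {x. x + w \<in> V i}) = (\<integral>\<^sup>+x. indicator (U i) x * indicator (V i) (x + w) \<partial>lborel)" for i w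
  proof -
    have "(\<integral>\<^sup>+x. indicator (U i) x * indicator (V i) (x + w) \<partial>lborel)
      = (\<integral>\<^sup>+x. indicator (U i \<inter> {x. x + w \<in> V i}) x \<partial>lborel)"
      by (intro nn_integral_cong) (auto simp: indicator_def)
    then show ?thesis using Wm by simp
  qed
  have one: "(\<integral>\<^sup>+w. vol (U i \<inter> {x. x + w \<in> V i}) \<partial>lborel) = vol (U i) * vol (V i)" for i
  proof -
    have "(\<integral>\<^sup>+w. vol (U i \<inter> {x. x + w \<in> V i}) \<partial>lborel)
      = (\<integral>\<^sup>+x. (\<integral>\<^sup>+w. indicator (U i) x * indicator (V i) (x + w) \<partial>lborel) \<partial>lborel)"
      unfolding W by (rule lborel_pair.Fubini') measurable
    also have "\<dots> = (\<integral>\<^sup>+x. indicator (U i) x * vol (V i) \<partial>lborel)"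
    proof (intro nn_integral_cong)
      fix x
      have "(\<integral>\<^sup>+w. indicator (V i) (x + w) \<partial>lborel) = (\<integral>\<^sup>+w. indicator (V i) w \<partial>lborel)"
        by (rule nn_integral_lborel_shift) measurable
      then show "(\<integral>\<^sup>+w. indicator (U i) x * indicator (V i) (x + w) \<partial>lborel) = indicator (U i) x * vol (V i)"
        by (subst nn_integral_cmult) auto
    qed
    also have "\<dots> = vol (U i) * vol (V i)"
      by (simp add: nn_integral_multc)
    finally show ?thesis .
  qed
  have far: "?S w = 0" if "w \<notin> ball 0 (2 * R)" for w
  proof (intro sum.neutral ballI)
    fix i
    have "U i \<inter> {x. x + w \<in> V i} = {}"
    proof (rule ccontr)
      assume "U i \<inter> {x. x + w \<in> V i} \<noteq> {}"
      then obtain x where "norm x < R" "norm (x + w) < R" using bd[of i] by fastforce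
      moreover have "norm w \<le> norm (x + w) + norm x"
        using norm_triangle_ineq4[of "x + w" x] by simp
      ultimately show False using that by simp
    qed
    then show "vol (U i \<inter> {x. x + w \<in> V i}) = 0" by simp
  qed
  have "ennreal c = (\<integral>\<^sup>+w. ?S w \<partial>lborel)"
    unfolding c(1)[symmetric] one[symmetric] W
    by (rule nn_integral_sum[symmetric]) measurable
  also have "\<dots> \<le> (\<integral>\<^sup>+w. ennreal g * indicator (ball (0::'a) (2 * R)) w \<partial>lborel)"
  proof (rule nn_integral_mono)
    fix w
    show "?S w \<le> ennreal g * indicator (ball 0 (2 * R)) w"
      using small[of w] far[of w] by (cases "w \<in> ball 0 (2 * R)") simp_all
  qed
  also have "\<dots> = ennreal g * vol (ball (0::'a) (2 * R))"
    by (simp add: nn_integral_cmult)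
  also have "vol (ball (0::'a) (2 * R)) = ennreal (measure lborel (ball (0::'a) (2 * R)))"
    using emeasure_lborel_ball_finite[of "0::'a" "2 * R"] by (intro emeasure_eq_ennreal_measure) auto
  also have "ennreal g * \<dots> = ennreal (g * measure lborel (ball (0::'a) (2 * R)))"
    using g by (simp add: ennreal_mult)
  finally have "c \<le> g * measure lborel (ball (0::'a) (2 * R))"
    using g c(2) by (subst (asm) ennreal_le_iff) auto
  then show False using g c(2) by linarith
qed

text \<open>A tuple of sets almost minimising the total measure of the parts missing from the balls can
  be improved by a fixed amount, so the infimum is zero.\<close>

lemma symmetrise_close_to_balls:
  fixes K :: "('i::finite \<Rightarrow> 'a::euclidean_space) set"
  assumes Km[measurable]: "K \<in> sets lborel_PiM" and conv: "fun_convex K" and inv: "orth_invariant K"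
    and A0[measurable]: "\<And>i. A0 i \<in> sets borel" and bd0: "\<And>i. A0 i \<subseteq> ball 0 R"
    and r: "\<And>i. vol (A0 i) = vol (ball (0::'a) (r i))" "\<And>i. r i \<le> R" and e: "0 < e"
  obtains A where "\<And>i. A i \<in> sets borel" "\<And>i. vol (A i) = vol (A0 i)"
    "multi_volume K A0 \<le> multi_volume K A" "(\<Sum>i\<in>UNIV. measure lborel (A i - ball 0 (r i))) < e"
proof -
  let ?B = "\<lambda>i. ball (0::'a) (r i)"
  have [measurable]: "ball (0::'a) s \<in> sets borel" for s by simp
  \<comment> \<open>Competitors with the measures of \<open>A0\<close> and no smaller volume inside
    \<open>K\<close>. All stay in the ball of radius \<open>R\<close>, which keeps the gain of a
    step uniform.\<close>
  define P where "P = {A. (\<forall>i. A i \<in> sets borel \<and> A i \<subseteq> ball 0 R \<and> vol (A i) = vol (A0 i))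
     \<and> multi_volume K A0 \<le> multi_volume K A}"
  define m where "m A i = measure lborel (A i - ?B i)" for A i
  define M where "M A = (\<Sum>i\<in>UNIV. m A i)" for A
  have m0: "0 \<le> m A i" for A i by (simp add: m_def)
  have PA: "A i \<in> sets borel" "A i \<subseteq> ball 0 R" "vol (A i) = vol (A0 i)"
    "vol (A i) = ennreal (measure lborel (?B i))"
    "multi_volume K A0 \<le> multi_volume K A" if "A \<in> P" for A i
    using that r(1)[of i] emeasure_lborel_ball_finite[of "0::'a" "r i"]
    by (auto simp: P_def emeasure_eq_ennreal_measure)
  \<comment> \<open>Since \<open>A i\<close> and its ball have equal measure, the excess of
    \<open>A i\<close> and the missing part of the ball have the same measure
    \<open>m A i\<close>.\<close>
  have parts: "vol (A i - ?B i) = ennreal (m A i)" "vol (?B i - A i) = ennreal (m A i)"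
    "vol (A i \<inter> ?B i) = ennreal (measure lborel (?B i) - m A i)"
    "m A i \<le> measure lborel (?B i)" if A: "A \<in> P" for A i
  proof -
    note [measurable] = PA(1)[OF A]
    have fin: "vol (A i) < \<infinity>" "vol (?B i) < \<infinity>"
      using PA(4)[OF A, of i] emeasure_lborel_ball_finite[of "0::'a" "r i"] by auto
    have fin': "vol D < \<infinity>" if "D \<subseteq> A i \<or> D \<subseteq> ?B i" for D
      using that fin emeasure_mono[of D "A i" lborel] emeasure_mono[of D "?B i" lborel]
      by (auto intro: le_less_trans)
    show 1: "vol (A i - ?B i) = ennreal (m A i)"
      unfolding m_def using fin'[of "A i - ?B i"] by (intro emeasure_eq_ennreal_measure) auto
    have AB: "measure lborel (A i) = measure lborel (?B i)"
      using PA(4)[OF A, of i] by (simp add: measure_def)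
    have split: "measure lborel E = measure lborel (E \<inter> F) + measure lborel (E - F)"
      if "E \<in> sets borel" "F \<in> sets borel" "vol E < \<infinity>" for E F :: "'a set"
    proof -
      have "vol (E \<inter> F) < \<infinity>" "vol (E - F) < \<infinity>"
        using that emeasure_mono[of "E \<inter> F" E lborel] emeasure_mono[of "E - F" E lborel]
        by (auto intro: le_less_trans)
      then have "measure lborel ((E \<inter> F) \<union> (E - F)) = measure lborel (E \<inter> F) + measure lborel (E - F)"
        using that by (intro measure_Union) auto
      then show ?thesis by (simp add: Int_Diff_Un)
    qed
    have d1: "measure lborel (A i) = measure lborel (A i \<inter> ?B i) + m A i"
      unfolding m_def using fin by (intro split) auto
    have d2: "measure lborel (?B i) = measure lborel (A i \<inter> ?B i) + measure lborel (?B i - A i)"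
      using split[of "?B i" "A i"] fin by (simp add: Int_commute)
    show "m A i \<le> measure lborel (?B i)" using d1 AB by (metis le_add_same_cancel2 measure_nonneg)
    show "vol (?B i - A i) = ennreal (m A i)"
      using d1 d2 AB fin'[of "?B i - A i"] by (subst emeasure_eq_ennreal_measure) auto
    show "vol (A i \<inter> ?B i) = ennreal (measure lborel (?B i) - m A i)"
      using d1 d2 AB fin'[of "A i \<inter> ?B i"] by (subst emeasure_eq_ennreal_measure) auto
  qed
  \<comment> \<open>Bounds the volume of the relevant shifts; the added 1 keeps it positive for
    every \<open>R\<close>.\<close>
  define D where "D = measure lborel (ball (0::'a) (2 * R)) + 1"
  have D: "D > 0" by (simp add: D_def add_nonneg_pos)
  define N where "N = real CARD('i)"
  have N: "N > 0" by (simp add: N_def)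
  \<comment> \<open>\<open>exists_good_shift\<close> yields a gain proportional to the sum of
    squares \<open>c\<close>. Cauchy--Schwarz bounds \<open>c\<close> below by
    \<open>(M A)\<^sup>2 / N\<close>, so the gain is controlled by \<open>M A\<close> alone.\<close>
  have step: "\<exists>A'\<in>P. M A' \<le> M A - (M A)\<^sup>2 / (2 * N * D)" if A: "A \<in> P" and pos: "M A > 0" for A
  proof -
    note [measurable] = PA(1)[OF A]
    define c where "c = (\<Sum>i\<in>UNIV. (m A i)\<^sup>2)"
    have c1: "(M A)\<^sup>2 \<le> N * c"
      unfolding M_def N_def c_def using sum_squared_le_sum_of_squares[of "m A" UNIV] by (simp add: mult.commute)
    then have c0: "c > 0" using pos N by (smt (verit) mult_nonneg_nonpos zero_less_power)
    have "\<exists>w. ennreal (c / (2 * D)) \<le> (\<Sum>i\<in>UNIV. vol ((A i - ?B i) \<inter> {x. x + w \<in> ?B i - A i}))"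
    proof (rule exists_good_shift)
      show "A i - ?B i \<subseteq> ball 0 R" "?B i - A i \<subseteq> ball 0 R" for i
        using PA(2)[OF A, of i] r(2)[of i] by auto
      show "(\<Sum>i\<in>UNIV. vol (A i - ?B i) * vol (?B i - A i)) = ennreal c"
        unfolding parts[OF A] c_def using m0 by (simp add: ennreal_mult[symmetric] sum_ennreal power2_eq_square)
      have "2 * (c / (2 * D) * measure lborel (ball (0::'a) (2 * R))) = c * (measure lborel (ball (0::'a) (2 * R)) / D)" by simp
      also have "\<dots> \<le> c * 1" using c0 D by (intro mult_left_mono) (auto simp: D_def)
      finally show "2 * (c / (2 * D) * measure lborel (ball (0::'a) (2 * R))) \<le> c" by simp
    qed (use c0 D in auto)
    then obtain w where w: "ennreal (c / (2 * D)) \<le> (\<Sum>i\<in>UNIV. vol ((A i - ?B i) \<inter> {x. x + w \<in> ?B i - A i}))"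
      by blast
    obtain A' where A': "\<And>i. A' i \<in> sets borel" "\<And>i. A' i \<subseteq> ball 0 R"
      "\<And>i. vol (A' i) = vol (A i)" "multi_volume K A \<le> multi_volume K A'"
      "\<And>i. vol (A i \<inter> ?B i)
        + vol ((A i - ?B i) \<inter> {x. x + w \<in> ?B i - A i}) \<le> vol (A' i \<inter> ?B i)"
      by (rule symmetrise_towards_balls[OF Km conv inv PA(1)[OF A] PA(2)[OF A], where w=w and r=r]) (rule that)
    have A'P: "A' \<in> P" using A' PA[OF A] by (auto simp: P_def)
    have "ennreal (\<Sum>i\<in>UNIV. measure lborel (?B i) - m A i) + ennreal (c / (2 * D))
      \<le> (\<Sum>i\<in>UNIV. vol (A i \<inter> ?B i)) + (\<Sum>i\<in>UNIV. vol ((A i - ?B i) \<inter> {x. x + w \<in> ?B i - A i}))"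
      unfolding parts[OF A] using w parts(4)[OF A] by (intro add_mono) (auto simp: sum_ennreal)
    also have "\<dots> \<le> (\<Sum>i\<in>UNIV. vol (A' i \<inter> ?B i))"
      unfolding sum.distrib[symmetric] by (intro sum_mono A')
    also have "\<dots> = ennreal (\<Sum>i\<in>UNIV. measure lborel (?B i) - m A' i)"
      unfolding parts[OF A'P] using parts(4)[OF A'P] by (simp add: sum_ennreal)
    finally have "(\<Sum>i\<in>UNIV. measure lborel (?B i) - m A i) + c / (2 * D) \<le> (\<Sum>i\<in>UNIV. measure lborel (?B i) - m A' i)"
      using parts(4)[OF A] parts(4)[OF A'P] c0 D
      by (simp add: sum_nonneg flip: ennreal_plus)
    then have "M A' \<le> M A - c / (2 * D)" by (simp add: sum_subtractf M_def)
    moreover have "(M A)\<^sup>2 / (2 * N * D) \<le> c / (2 * D)"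
    proof -
      have "(M A)\<^sup>2 / (2 * N * D) \<le> (N * c) / (2 * N * D)" using c1 N D by (intro divide_right_mono) auto
      also have "\<dots> = c / (2 * D)" using N by simp
      finally show ?thesis .
    qed
    ultimately show ?thesis using A'P by force
  qed
  define \<delta> where "\<delta> = Inf (M ` P)"
  have M0: "0 \<le> M A" for A unfolding M_def by (intro sum_nonneg m0)
  have A0P: "A0 \<in> P" using bd0 by (auto simp: P_def)
  have bdd: "bdd_below (M ` P)" using M0 by (intro bdd_belowI[of _ 0]) auto
  have low: "\<delta> \<le> M A" if "A \<in> P" for A unfolding \<delta>_def using that bdd by (intro cInf_lower) auto
  have "\<delta> < e"
  proof (rule ccontr)
    assume "\<not> \<delta> < e"
    then have \<delta>: "\<delta> > 0" using e by linarith
    define g where "g = \<delta>\<^sup>2 / (2 * N * D)"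
    have "g > 0" using \<delta> N D by (simp add: g_def)
    then have "Inf (M ` P) < \<delta> + g" by (simp add: \<delta>_def)
    then obtain A where A: "A \<in> P" "M A < \<delta> + g"
      using cInf_lessD[of "M ` P"] A0P by blast
    have "\<delta> \<le> M A" using low[OF A(1)] .
    then have "\<delta>\<^sup>2 \<le> (M A)\<^sup>2" using \<delta> by (intro power_mono) auto
    then have "g \<le> (M A)\<^sup>2 / (2 * N * D)" unfolding g_def using N D by (intro divide_right_mono) auto
    moreover obtain A' where "A' \<in> P" "M A' \<le> M A - (M A)\<^sup>2 / (2 * N * D)"
      using step[OF A(1)] \<delta> \<open>\<delta> \<le> M A\<close> by auto
    ultimately show False using low[of A'] A(2) by linarith
  qed
  then obtain A where "A \<in> P" "M A < e"
    using cInf_lessD[of "M ` P"] A0P unfolding \<delta>_def by blast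
  then show ?thesis using PA by (intro that[of A]) (auto simp: M_def m_def)
qed

section \<open>Centred balls as rearrangements of sets\<close>

lemma sym_rearr_set_ball:
  fixes A :: "'a::euclidean_space set"
  assumes "vol A < \<infinity>"
  obtains r where "0 \<le> r" "sym_rearr_set A = ball 0 r" "vol (ball (0::'a) r) = vol A"
  using theI'[OF ex1_radius[OF assms, where 'a = 'a]] that by (auto simp: sym_rearr_set_def)

lemma emeasure_ball_strict_mono:
  assumes "0 \<le> r" "r < s"
  shows "vol (ball (0::'a::euclidean_space) r) < vol (ball (0::'a) s)"
proof -
  have "r ^ DIM('a) < s ^ DIM('a)" using assms by (intro power_strict_mono) auto
  then have "unit_ball_vol (real DIM('a)) * r ^ DIM('a) < unit_ball_vol (real DIM('a)) * s ^ DIM('a)"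
    by (intro mult_strict_left_mono) auto
  then show ?thesis using assms by (simp add: emeasure_ball ennreal_less_iff)
qed

lemma sym_rearr_set_mono:
  fixes A B :: "'a::euclidean_space set"
  assumes "vol A \<le> vol B" "vol B < \<infinity>"
  shows "sym_rearr_set A \<subseteq> sym_rearr_set B"
proof -
  obtain r where r: "0 \<le> r" "sym_rearr_set A = ball 0 r" "vol (ball (0::'a) r) = vol A"
    using sym_rearr_set_ball[of A] assms by (auto intro: le_less_trans)
  obtain s where s: "0 \<le> s" "sym_rearr_set B = ball 0 s" "vol (ball (0::'a) s) = vol B"
    using sym_rearr_set_ball[OF assms(2)] by blast
  have "r \<le> s" using emeasure_ball_strict_mono[of s r, where 'a='a] r s assms by (metis leD linorder_not_le)
  then show ?thesis using r s by (simp add: subset_ball)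
qed

text \<open>The tuples from \<open>symmetrise_close_to_balls\<close> keep the measures of
  \<open>A\<close>, which therefore serve as the uniform bounds in
  \<open>multi_volume_approx\<close>.\<close>

lemma multi_volume_rearrange_bounded:
  fixes K :: "('i::finite \<Rightarrow> 'a::euclidean_space) set"
  assumes Km[measurable]: "K \<in> sets lborel_PiM" and conv: "fun_convex K" and inv: "orth_invariant K"
    and A[measurable]: "\<And>i. A i \<in> sets borel" and bd: "\<And>i. A i \<subseteq> ball 0 R"
  shows "multi_volume K A \<le> multi_volume K (\<lambda>i. sym_rearr_set (A i))"
proof -
  have fin: "vol (A i) < \<infinity>" for i
    using emeasure_mono[OF bd[of i], of lborel] emeasure_lborel_ball_finite[of "0::'a" R] by (auto intro: le_less_trans)
  have "\<exists>r. 0 \<le> r \<and> sym_rearr_set (A i) = ball 0 r \<and> vol (ball (0::'a) r) = vol (A i)" for i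
    using sym_rearr_set_ball[OF fin[of i]] by metis
  then obtain r where r: "\<And>i. 0 \<le> r i" "\<And>i. sym_rearr_set (A i) = ball 0 (r i)"
    "\<And>i. vol (ball (0::'a) (r i)) = vol (A i)" by metis
  \<comment> \<open>\<open>R\<close> may be negative, with every \<open>A i\<close> empty; comparing
    ball volumes needs a nonnegative radius.\<close>
  define R' where "R' = max 0 R"
  have bd': "A i \<subseteq> ball 0 R'" for i using bd[of i] by (auto simp: R'_def)
  have rR: "r i \<le> R'" for i
  proof (rule ccontr)
    assume "\<not> r i \<le> R'"
    then have "vol (ball (0::'a) R') < vol (ball (0::'a) (r i))"
      by (intro emeasure_ball_strict_mono) (auto simp: R'_def)
    moreover have "vol (A i) \<le> vol (ball (0::'a) R')"
      using bd' by (intro emeasure_mono) auto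
    ultimately show False using r(3)[of i] by simp
  qed
  define a where "a i = measure lborel (A i)" for i
  have a: "vol (A i) = ennreal (a i)" "0 \<le> a i" for i
    using fin[of i] by (auto simp: a_def emeasure_eq_ennreal_measure)
  show ?thesis
    unfolding r(2)
  proof (rule multi_volume_approx[OF Km, where b=a])
    fix d :: real assume d: "0 < d"
    obtain A' where A': "\<And>i. A' i \<in> sets borel" "\<And>i. vol (A' i) = vol (A i)"
      "multi_volume K A \<le> multi_volume K A'" "(\<Sum>i\<in>UNIV. measure lborel (A' i - ball 0 (r i))) < d"
      by (rule symmetrise_close_to_balls[OF Km conv inv A bd' r(3)[symmetric] rR d]) (rule that)
    have "vol (A' i - ball 0 (r i)) \<le> ennreal d" for i
    proof -
      have "vol (A' i - ball 0 (r i)) \<le> vol (A' i)" using A'(1) by (intro emeasure_mono) auto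
      also have "\<dots> < \<infinity>" using A'(2) fin by simp
      finally have "vol (A' i - ball 0 (r i)) = ennreal (measure lborel (A' i - ball 0 (r i)))"
        by (intro emeasure_eq_ennreal_measure) simp
      moreover have "measure lborel (A' i - ball 0 (r i)) \<le> (\<Sum>i\<in>UNIV. measure lborel (A' i - ball 0 (r i)))"
        by (rule member_le_sum) auto
      ultimately show ?thesis using A'(4) by (simp add: ennreal_leI)
    qed
    then show "\<exists>D. (\<forall>i. D i \<in> sets borel \<and> vol (D i) \<le> ennreal (a i) \<and> vol (D i - ball 0 (r i)) \<le> ennreal d) \<and>
        multi_volume K A \<le> multi_volume K D"
      using A' by (intro exI[of _ A']) (simp add: a(1))
  qed (use a(2) in auto)
qed

text \<open>The sets are truncated to balls of radius \<open>n\<close>. Rearrangement is monotone,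
  so each truncation obeys the bound for the full sets.\<close>

lemma multi_volume_rearrange:
  fixes K :: "('i::finite \<Rightarrow> 'a::euclidean_space) set"
  assumes Km[measurable]: "K \<in> sets lborel_PiM" and conv: "fun_convex K" and inv: "orth_invariant K"
    and A[measurable]: "\<And>i. A i \<in> sets borel" and fin: "\<And>i. vol (A i) < \<infinity>"
  shows "multi_volume K A \<le> multi_volume K (\<lambda>i. sym_rearr_set (A i))"
proof (rule multi_integral_le_eventually)
  let ?A = "\<lambda>n i. A i \<inter> ball 0 (real n)"
  show "indicator (?A n i) \<in> borel_measurable borel" for n i
    by (intro borel_measurable_indicator sets.Int A) simp
  fix n
  have "multi_volume K (?A n) \<le> multi_volume K (\<lambda>i. sym_rearr_set (?A n i))"
    using Km conv inv by (rule multi_volume_rearrange_bounded[where R="real n"]) auto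
  also have "\<dots> \<le> multi_volume K (\<lambda>i. sym_rearr_set (A i))"
    using fin by (intro multi_volume_mono sym_rearr_set_mono emeasure_mono) auto
  finally show "multi_volume K (?A n) \<le> multi_volume K (\<lambda>i. sym_rearr_set (A i))" .
next
  fix i and x :: 'a
  obtain m where "norm x < real m" using reals_Archimedean2 by blast
  then show "\<forall>\<^sub>F n in sequentially. indicator (A i) x \<le> (indicator (A i \<inter> ball 0 (real n)) x :: ennreal)"
    by (intro eventually_sequentiallyI[of m]) (auto simp: indicator_def)
qed (rule Km)

section \<open>Rearrangement of densities\<close>

text \<open>A product of one-dimensional integrals is one integral over \<open>\<tau>\<close>, with
  an independent parameter for each column, and Fubini moves it outside. In the layer-cake formula
  \<open>\<tau> i\<close> is the level for column \<open>i\<close>.\<close>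

lemma multi_integral_superpose:
  fixes K :: "('i::finite \<Rightarrow> 'a::euclidean_space) set" and h :: "'i \<Rightarrow> 'a \<Rightarrow> real \<Rightarrow> ennreal"
  assumes Km[measurable]: "K \<in> sets lborel_PiM"
    and h[measurable]: "\<And>i. (\<lambda>(x, t). h i x t) \<in> borel_measurable (borel \<Otimes>\<^sub>M borel)"
  shows "multi_integral K (\<lambda>i x. \<integral>\<^sup>+t. h i x t \<partial>lborel) =
    (\<integral>\<^sup>+\<tau>. multi_integral K (\<lambda>i x. h i x (\<tau> i)) \<partial>lborel_PiM)"
proof -
  interpret A: product_sigma_finite "\<lambda>_::'i. lborel :: 'a measure" by (rule product_sigma_finite_lborel)
  interpret R: product_sigma_finite "\<lambda>_::'i. lborel :: real measure" by (rule product_sigma_finite_lborel)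
  interpret AP: sigma_finite_measure "lborel_PiM :: ('i \<Rightarrow> 'a) measure"
    by (rule A.sigma_finite) simp
  interpret RP: sigma_finite_measure "lborel_PiM :: ('i \<Rightarrow> real) measure"
    by (rule R.sigma_finite) simp
  interpret P: pair_sigma_finite "lborel_PiM :: ('i \<Rightarrow> 'a) measure" "lborel_PiM :: ('i \<Rightarrow> real) measure" ..
  have h1: "h i x \<in> borel_measurable borel" for i x
    using measurable_compose_Pair1[OF _ h[of i], of x] by simp
  have "multi_integral K (\<lambda>i x. \<integral>\<^sup>+t. h i x t \<partial>lborel)
    = (\<integral>\<^sup>+x. (\<integral>\<^sup>+\<tau>. indicator K x * (\<Prod>i\<in>UNIV. h i (x i) (\<tau> i)) \<partial>lborel_PiM) \<partial>lborel_PiM)"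
    unfolding multi_integral_def
  proof (rule nn_integral_cong)
    fix x :: "'i \<Rightarrow> 'a"
    have hm: "h i (x i) \<in> borel_measurable lborel" for i using h1 by simp
    have "(\<integral>\<^sup>+\<tau>. (\<Prod>i\<in>UNIV. h i (x i) (\<tau> i)) \<partial>lborel_PiM) = (\<Prod>i\<in>UNIV. \<integral>\<^sup>+t. h i (x i) t \<partial>lborel)"
      using hm by (intro R.product_nn_integral_prod) auto
    moreover have "(\<lambda>\<tau>. \<Prod>i\<in>UNIV. h i (x i) (\<tau> i)) \<in> borel_measurable (lborel_PiM :: ('i \<Rightarrow> real) measure)"
      using h1 by (intro borel_measurable_prod_ennreal measurable_compose[OF measurable_component_singleton]) auto
    ultimately show "indicator K x * (\<Prod>i\<in>UNIV. \<integral>\<^sup>+t. h i (x i) t \<partial>lborel)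
      = (\<integral>\<^sup>+\<tau>. indicator K x * (\<Prod>i\<in>UNIV. h i (x i) (\<tau> i)) \<partial>lborel_PiM)"
      by (simp add: nn_integral_cmult)
  qed
  also have "\<dots> = (\<integral>\<^sup>+\<tau>. multi_integral K (\<lambda>i x. h i x (\<tau> i)) \<partial>lborel_PiM)"
    unfolding multi_integral_def
  proof (rule P.Fubini'[symmetric])
    have "(\<lambda>z. h i (fst z i) (snd z i)) \<in> borel_measurable
        ((lborel_PiM :: ('i \<Rightarrow> 'a) measure) \<Otimes>\<^sub>M (lborel_PiM :: ('i \<Rightarrow> real) measure))" for i
    proof -
      have "(\<lambda>z. (fst z i, snd z i)) \<in>
        (lborel_PiM :: ('i \<Rightarrow> 'a) measure) \<Otimes>\<^sub>M (lborel_PiM :: ('i \<Rightarrow> real) measure) \<rightarrow>\<^sub>M borel \<Otimes>\<^sub>M borel"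
        by measurable
      from measurable_compose[OF this h[of i]] show ?thesis by simp
    qed
    then have "(\<lambda>z. indicator K (fst z) * (\<Prod>i\<in>UNIV. h i (fst z i) (snd z i))) \<in> borel_measurable
        ((lborel_PiM :: ('i \<Rightarrow> 'a) measure) \<Otimes>\<^sub>M (lborel_PiM :: ('i \<Rightarrow> real) measure))"
      by (intro borel_measurable_times_ennreal borel_measurable_prod_ennreal) measurable
    then show "(\<lambda>(x, \<tau>). indicator K x * (\<Prod>i\<in>UNIV. h i (x i) (\<tau> i))) \<in> borel_measurable
        ((lborel_PiM :: ('i \<Rightarrow> 'a) measure) \<Otimes>\<^sub>M (lborel_PiM :: ('i \<Rightarrow> real) measure))"
      by (simp add: split_beta')
  qed
  finally show ?thesis .
qed

text \<open>Comparing volumes instead of radii eliminates the definite description in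
  \<open>sym_rearr_set\<close> and makes membership jointly measurable in the point and the
  level.\<close>

lemma mem_sym_rearr_set_iff:
  fixes A :: "'a::euclidean_space set"
  assumes "vol A < \<infinity>"
  shows "x \<in> sym_rearr_set A \<longleftrightarrow> vol (ball (0::'a) (norm x)) < vol A"
proof -
  obtain r where r: "0 \<le> r" "sym_rearr_set A = ball 0 r" "vol (ball (0::'a) r) = vol A"
    using sym_rearr_set_ball[OF assms] by blast
  have "norm x < r \<longleftrightarrow> vol (ball (0::'a) (norm x)) < vol (ball (0::'a) r)"
  proof
    assume "norm x < r"
    then show "vol (ball (0::'a) (norm x)) < vol (ball (0::'a) r)"
      by (intro emeasure_ball_strict_mono) auto
  next
    assume *: "vol (ball (0::'a) (norm x)) < vol (ball (0::'a) r)"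
    show "norm x < r"
    proof (rule ccontr)
      assume "\<not> norm x < r"
      then have "vol (ball (0::'a) r) \<le> vol (ball (0::'a) (norm x))"
        by (intro emeasure_mono) auto
      then show False using * by simp
    qed
  qed
  then show ?thesis by (simp add: r(2) r(3)[symmetric])
qed

lemma emeasure_superlevel_finite:
  assumes [measurable]: "f \<in> borel_measurable borel" and t: "0 < t"
    and fin: "(\<integral>\<^sup>+x. ennreal (f x) \<partial>lborel) < \<infinity>"
  shows "vol {x. t < f (x::'a::euclidean_space)} < \<infinity>"
proof -
  have [measurable]: "{x. t < f x} \<in> sets borel"
  proof -
    have "{x \<in> space borel. t < f x} \<in> sets borel" by measurable
    then show ?thesis by simp
  qed
  have "ennreal t * vol {x. t < f x} = (\<integral>\<^sup>+x. ennreal t * indicator {x. t < f x} x \<partial>lborel)"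
    by (simp add: nn_integral_cmult)
  also have "\<dots> \<le> (\<integral>\<^sup>+x. ennreal (f x) \<partial>lborel)"
    by (intro nn_integral_mono) (auto simp: indicator_def intro: ennreal_leI)
  also note fin
  finally have "ennreal t * vol {x. t < f x} < \<infinity>" .
  then show ?thesis using t by (auto simp: ennreal_mult_less_top)
qed

text \<open>Each \<open>f i\<close> and its rearrangement are superpositions of indicators over the
  same levels, and \<open>multi_volume_rearrange\<close> compares them for every tuple of positive
  levels.\<close>

lemma multi_integral_rearrange:
  fixes K :: "('i::finite \<Rightarrow> 'a::euclidean_space) set"
  assumes Km[measurable]: "K \<in> sets lborel_PiM" and conv: "fun_convex K" and inv: "orth_invariant K"
    and f[measurable]: "\<And>i. f i \<in> borel_measurable borel" and f0: "\<And>i x. 0 \<le> f i x"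
    and fin: "\<And>i. (\<integral>\<^sup>+x. ennreal (f i x) \<partial>lborel) < \<infinity>"
  shows "multi_integral K (\<lambda>i x. ennreal (f i x)) \<le> multi_integral K (\<lambda>i. sym_rearr (f i))"
proof -
  define g where "g i x t = (indicator {0<..} t * indicator {t. t < f i x} t :: ennreal)" for i x and t :: real
  define h where "h i x t = (indicator {0<..} t * indicator (sym_rearr_set {y. t < f i y}) x :: ennreal)" for i x and t :: real
  have f_eq: "ennreal (f i x) = (\<integral>\<^sup>+t. g i x t \<partial>lborel)" for i x
  proof -
    have "ennreal (f i x) = (\<integral>\<^sup>+t. indicator {0<..} t * indicator {t. ennreal t < ennreal (f i x)} t \<partial>lborel)"
      by (rule ennreal_layer_cake[symmetric])
    also have "\<dots> = (\<integral>\<^sup>+t. g i x t \<partial>lborel)"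
      unfolding g_def by (intro nn_integral_cong) (auto simp: indicator_def ennreal_less_iff)
    finally show ?thesis .
  qed
  have s_eq: "sym_rearr (f i) x = (\<integral>\<^sup>+t. h i x t \<partial>lborel)" for i x
    unfolding sym_rearr_def h_def by (intro nn_integral_cong) (simp add: mult.commute)
  have lev[measurable]: "{y. t < f i y} \<in> sets borel" for i t
  proof -
    have "{y \<in> space borel. t < f i y} \<in> sets borel" by measurable
    then show ?thesis by simp
  qed
  have levfin: "vol {y. t < f i y} < \<infinity>" if "0 < t" for i t
    using f that fin by (rule emeasure_superlevel_finite)
  have gm: "(\<lambda>(x, t). g i x t) \<in> borel_measurable (borel \<Otimes>\<^sub>M borel)" for i
  proof -
    have "(\<lambda>z. indicator {0<..} (snd z) * indicator {z. snd z < f i (fst z)} z :: ennreal) \<in> borel_measurable (borel \<Otimes>\<^sub>M borel)"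
      by measurable
    then show ?thesis by (simp add: g_def split_beta' indicator_def)
  qed
  \<comment> \<open>At positive levels membership is the comparison \<open>E x < L t\<close> of two
    measurable functions; \<open>L\<close> is measurable as an integral depending on a
    parameter.\<close>
  have hm: "(\<lambda>(x, t). h i x t) \<in> borel_measurable (borel \<Otimes>\<^sub>M borel)" for i
  proof -
    have "(\<lambda>t. vol {y. t < f i y}) = (\<lambda>t. \<integral>\<^sup>+y. indicator {z. fst z < f i (snd z)} (t, y) \<partial>lborel)"
    proof
      fix t
      have "(\<integral>\<^sup>+y. indicator {z. fst z < f i (snd z)} (t, y) \<partial>lborel) = (\<integral>\<^sup>+y. indicator {y. t < f i y} y \<partial>lborel)"
        by (intro nn_integral_cong) (auto simp: indicator_def)
      then show "vol {y. t < f i y} = (\<integral>\<^sup>+y. indicator {z. fst z < f i (snd z)} (t, y) \<partial>lborel)"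
        by simp
    qed
    also have "\<dots> \<in> borel_measurable borel" by measurable
    finally have L: "(\<lambda>t. vol {y. t < f i y}) \<in> borel_measurable borel" .
    define L where "L t = vol {y. t < f i y}" for t
    define E where "E x = vol (ball (0::'a) (norm x))" for x :: 'a
    have [measurable]: "L \<in> borel_measurable borel" using L by (simp add: L_def[abs_def])
    have [measurable]: "E \<in> borel_measurable borel"
      unfolding E_def[abs_def] by (simp add: emeasure_ball)
    have "(\<lambda>z. indicator {0<..} (snd z) *
        indicator {z. E (fst z) < L (snd z)} z :: ennreal)
      \<in> borel_measurable (borel \<Otimes>\<^sub>M borel)"
      by measurable
    also have "(\<lambda>z. indicator {0<..} (snd z) *
        indicator {z. E (fst z) < L (snd z)} z :: ennreal)
      = (\<lambda>z. h i (fst z) (snd z))"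
      unfolding h_def using levfin by (auto simp: fun_eq_iff indicator_def mem_sym_rearr_set_iff E_def L_def)
    finally show ?thesis by (simp add: split_beta')
  qed
  have "multi_integral K (\<lambda>i x. ennreal (f i x)) = (\<integral>\<^sup>+\<tau>. multi_integral K (\<lambda>i x. g i x (\<tau> i)) \<partial>lborel_PiM)"
    unfolding f_eq by (rule multi_integral_superpose[OF Km gm])
  also have "\<dots> \<le> (\<integral>\<^sup>+\<tau>. multi_integral K (\<lambda>i x. h i x (\<tau> i)) \<partial>lborel_PiM)"
  proof (rule nn_integral_mono)
    fix \<tau> :: "'i \<Rightarrow> real"
    show "multi_integral K (\<lambda>i x. g i x (\<tau> i)) \<le> multi_integral K (\<lambda>i x. h i x (\<tau> i))"
    proof (cases "\<forall>i. 0 < \<tau> i")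
      case True
      have "multi_integral K (\<lambda>i x. g i x (\<tau> i)) = multi_volume K (\<lambda>i. {y. \<tau> i < f i y})"
      proof -
        have "(\<lambda>i x. g i x (\<tau> i)) = (\<lambda>i. indicator {y. \<tau> i < f i y})"
          using True by (auto simp: g_def indicator_def fun_eq_iff)
        then show ?thesis by (simp only:)
      qed
      also have "\<dots> \<le> multi_volume K (\<lambda>i. sym_rearr_set {y. \<tau> i < f i y})"
        using True levfin by (intro multi_volume_rearrange[OF Km conv inv]) auto
      also have "\<dots> = multi_integral K (\<lambda>i x. h i x (\<tau> i))"
        using True by (simp add: h_def)
      finally show ?thesis .
    next
      \<comment> \<open>At a tuple with a nonpositive level the left side vanishes; superlevel sets
        at such levels may have infinite measure.\<close>
      case False
      then obtain i where "\<not> 0 < \<tau> i" by blast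
      then have 0: "(\<Prod>i\<in>UNIV. g i (x i) (\<tau> i)) = 0" for x
        by (intro prod_zero) (auto simp: g_def intro!: exI[of _ i])
      show ?thesis unfolding multi_integral_def 0 by simp
    qed
  qed
  also have "\<dots> = multi_integral K (\<lambda>i. sym_rearr (f i))"
    unfolding s_eq[abs_def] by (rule multi_integral_superpose[OF Km hm, symmetric])
  finally show ?thesis .
qed

text \<open>The increments of \<open>\<phi>\<close> are bounded by those of the ball volume
  \<open>G\<close>, a polynomial in the radius, so \<open>\<phi>\<close> is continuous. This lets
  \<open>bathtub\<close> take a part of prescribed measure out of a level set.\<close>

lemma emeasure_Int_ball_IVT:
  fixes S :: "'a::euclidean_space set"
  assumes [measurable]: "S \<in> sets borel" and S: "S \<subseteq> ball 0 R" and v: "0 \<le> v" "v \<le> measure lborel S"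
  obtains \<rho> where "measure lborel (S \<inter> ball 0 \<rho>) = v"
proof -
  define R' where "R' = max 0 R"
  define \<phi> where "\<phi> \<rho> = measure lborel (S \<inter> ball 0 \<rho>)" for \<rho>
  define G where "G \<rho> = measure lborel (ball (0::'a) \<rho>)" for \<rho>
  have fin: "vol (ball (0::'a) \<rho>) \<noteq> \<infinity>" for \<rho>
    using emeasure_lborel_ball_finite[of "0::'a" \<rho>] by auto
  have finI: "vol D \<noteq> \<infinity>" if "D \<subseteq> ball 0 \<rho>" for D :: "'a set" and \<rho>
    using emeasure_mono[OF that, of lborel] fin[of \<rho>] by (auto simp: top_unique)
  have fm: "ball (0::'a) \<rho> \<in> fmeasurable lborel" for \<rho>
    using emeasure_lborel_ball_finite[of "0::'a" \<rho>] by (auto simp: fmeasurable_def)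
  have d: "0 \<le> \<phi> b - \<phi> a \<and> \<phi> b - \<phi> a \<le> G b - G a" if "a \<le> b" for a b
  proof -
    have sub: "ball (0::'a) a \<subseteq> ball 0 b" using that by (rule subset_ball)
    have "\<phi> a \<le> \<phi> b" unfolding \<phi>_def
      using sub fm[of b] by (intro measure_mono_fmeasurable fmeasurableI2[OF fm[of b]]) auto
    have f1: "vol (S \<inter> ball 0 a) \<noteq> \<infinity>" "vol (S \<inter> ball 0 b - S \<inter> ball 0 a) \<noteq> \<infinity>"
      "vol (ball 0 b - ball (0::'a) a) \<noteq> \<infinity>"
    proof -
      show "vol (S \<inter> ball 0 a) \<noteq> \<infinity>" by (rule finI[of _ a]) blast
      show "vol (S \<inter> ball 0 b - S \<inter> ball 0 a) \<noteq> \<infinity>" by (rule finI[of _ b]) blast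
      show "vol (ball 0 b - ball (0::'a) a) \<noteq> \<infinity>" by (rule finI[of _ b]) blast
    qed
    have "measure lborel (S \<inter> ball 0 a \<union> (S \<inter> ball 0 b - S \<inter> ball 0 a)) = \<phi> a + measure lborel (S \<inter> ball 0 b - S \<inter> ball 0 a)"
      unfolding \<phi>_def using f1 by (intro measure_Union) auto
    moreover have "S \<inter> ball 0 a \<union> (S \<inter> ball 0 b - S \<inter> ball 0 a) = S \<inter> ball 0 b" using sub by auto
    ultimately have 1: "\<phi> b = \<phi> a + measure lborel (S \<inter> ball 0 b - S \<inter> ball 0 a)" by (simp add: \<phi>_def)
    have "measure lborel (ball 0 a \<union> (ball 0 b - ball (0::'a) a)) = G a + measure lborel (ball 0 b - ball (0::'a) a)"
      unfolding G_def using f1 fin by (intro measure_Union) auto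
    moreover have "ball 0 a \<union> (ball 0 b - ball (0::'a) a) = ball 0 b" using sub by auto
    ultimately have 2: "G b = G a + measure lborel (ball 0 b - ball (0::'a) a)" by (simp add: G_def)
    have "ball 0 b - ball (0::'a) a \<in> fmeasurable lborel" using fm by (intro fmeasurable_Diff) auto
    then have "measure lborel (S \<inter> ball 0 b - S \<inter> ball 0 a) \<le> measure lborel (ball 0 b - ball (0::'a) a)"
      by (intro measure_mono_fmeasurable) auto
    then show ?thesis using 1 2 \<open>\<phi> a \<le> \<phi> b\<close> by linarith
  qed
  have dist: "dist (\<phi> b) (\<phi> a) \<le> dist (G b) (G a)" for a b
    using d[of a b] d[of b a] by (cases "a \<le> b") (auto simp: dist_real_def)
  have Gc: "continuous_on {0..R'} G"
  proof -
    have "continuous_on {0..R'} (\<lambda>\<rho>. unit_ball_vol (real DIM('a)) * \<rho> ^ DIM('a))" by (intro continuous_intros)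
    then show ?thesis
      by (rule continuous_on_eq) (simp add: G_def content_ball)
  qed
  have "continuous_on {0..R'} \<phi>"
    unfolding continuous_on_def
  proof
    fix a assume "a \<in> {0..R'}"
    then have "(G \<longlongrightarrow> G a) (at a within {0..R'})" using Gc by (auto simp: continuous_on_def)
    then show "(\<phi> \<longlongrightarrow> \<phi> a) (at a within {0..R'})"
      by (rule metric_tendsto_imp_tendsto) (simp add: dist)
  qed
  moreover have "\<phi> 0 \<le> v" using v by (simp add: \<phi>_def)
  moreover have "S \<inter> ball 0 R' = S" using S by (auto simp: R'_def)
  then have "v \<le> \<phi> R'" using v by (simp add: \<phi>_def)
  ultimately obtain \<rho> where "\<phi> \<rho> = v"
    using IVT'[of \<phi> 0 v R'] by (auto simp: R'_def)
  then show ?thesis by (intro that[of \<rho>]) (simp add: \<phi>_def)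
qed

section \<open>Densities bounded by one\<close>

text \<open>Mass is best placed where \<open>F\<close> is largest. So \<open>A\<close> consists of
  the points of the ball with \<open>F x > s\<close> and of enough points with
  \<open>F x = s\<close> to make the measure exact; then
  \<open>(F x - s) * (indicator A x - f x)\<close> is nowhere negative. The support in a ball keeps
  the level sets finite.\<close>

lemma bathtub:
  fixes F f :: "'a::euclidean_space \<Rightarrow> real"
  assumes F[measurable]: "F \<in> borel_measurable borel" and F0: "\<And>x. 0 \<le> F x" "\<And>x. F x \<le> 1"
    and f[measurable]: "f \<in> borel_measurable borel" and f0: "\<And>x. 0 \<le> f x" "\<And>x. f x \<le> 1"
    and supp: "\<And>x. x \<notin> ball 0 R \<Longrightarrow> f x = 0"
  obtains A where "A \<in> sets borel" "A \<subseteq> ball 0 R"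
    "vol A = (\<integral>\<^sup>+x. ennreal (f x) \<partial>lborel)"
    "(\<integral>\<^sup>+x. ennreal (F x) * ennreal (f x) \<partial>lborel) \<le> (\<integral>\<^sup>+x. ennreal (F x) * indicator A x \<partial>lborel)"
proof -
  define D where "D = ball (0::'a) R"
  have [measurable]: "D \<in> sets borel" by (simp add: D_def)
  have Dfin: "vol D \<noteq> \<infinity>" using emeasure_lborel_ball_finite[of "0::'a" R] by (auto simp: D_def)
  have sub_fin: "vol E \<noteq> \<infinity>" if "E \<subseteq> D" for E
    using emeasure_mono[OF that, of lborel] Dfin by (auto simp: top_unique)
  have sub_fm: "E \<in> fmeasurable lborel" if "E \<subseteq> D" "E \<in> sets borel" for E
    using sub_fin[OF that(1)] that(2) by (auto simp: fmeasurable_def less_top)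
  have "(\<integral>\<^sup>+x. ennreal (f x) \<partial>lborel) \<le> (\<integral>\<^sup>+x. indicator D x \<partial>lborel)"
    using f0 supp by (intro nn_integral_mono) (auto simp: indicator_def D_def simp del: mem_ball)
  then have cD: "(\<integral>\<^sup>+x. ennreal (f x) \<partial>lborel) \<le> vol D" by simp
  define c where "c = enn2real (\<integral>\<^sup>+x. ennreal (f x) \<partial>lborel)"
  have c: "(\<integral>\<^sup>+x. ennreal (f x) \<partial>lborel) = ennreal c" "0 \<le> c"
    using cD Dfin by (auto simp: c_def top_unique less_top)
  have cD': "c \<le> measure lborel D"
    using cD unfolding c(1) emeasure_eq_ennreal_measure[OF Dfin[unfolded infinity_ennreal_def]] by simp
  define U where "U s = {x \<in> D. s < F x}" for s
  define V where "V s = {x \<in> D. s \<le> F x}" for s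
  have Um[measurable]: "U s \<in> sets borel" for s
  unfolding U_def by measurable
  have Vm[measurable]: "V s \<in> sets borel" for s
  unfolding V_def by measurable
  have UD: "U s \<subseteq> D" and VD: "V s \<subseteq> D" for s by (auto simp: U_def V_def)
  \<comment> \<open>\<open>s\<close> will be the least level whose strict superlevel set has measure
    at most \<open>c\<close>; level 1 qualifies because \<open>F\<close> is at most 1. Continuity of
    the measure from below and from above gives \<open>Us\<close> and \<open>Vs\<close>.\<close>
  define T where "T = {s. 0 \<le> s \<and> measure lborel (U s) \<le> c}"
  have "U 1 = {}" using F0(2) by (auto simp: U_def not_less)
  then have T1: "1 \<in> T" using c(2) by (simp add: T_def)
  have Tb: "bdd_below T" by (rule bdd_belowI[of _ 0]) (simp add: T_def)
  define s where "s = Inf T"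
  have s0: "0 \<le> s" unfolding s_def using T1 by (intro cInf_greatest) (blast, simp add: T_def)
  have up: "measure lborel (U t) \<le> c" if "s < t" for t
  proof -
    have "T \<noteq> {}" using T1 by blast
    then have "\<exists>t'\<in>T. t' < t" using that unfolding s_def by (rule cInf_lessD)
    then obtain t' where t': "t' \<in> T" "t' < t" by blast
    then have "measure lborel (U t) \<le> measure lborel (U t')"
      using UD by (intro measure_mono_fmeasurable sub_fm) (auto simp: U_def)
    then show ?thesis using t' by (simp add: T_def)
  qed
  have Us: "measure lborel (U s) \<le> c"
  proof -
    have inc: "incseq (\<lambda>n. U (s + 1 / real (Suc n)))"
    proof (rule incseq_SucI)
      fix n
      have "1 / real (Suc (Suc n)) \<le> 1 / real (Suc n)" by (intro divide_left_mono) auto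
      then show "U (s + 1 / real (Suc n)) \<subseteq> U (s + 1 / real (Suc (Suc n)))" by (auto simp: U_def)
    qed
    have un: "(\<Union>n. U (s + 1 / real (Suc n))) = U s"
    proof
      show "(\<Union>n. U (s + 1 / real (Suc n))) \<subseteq> U s"
        by (auto simp: U_def) (smt (verit) divide_pos_pos of_nat_0_le_iff)
      show "U s \<subseteq> (\<Union>n. U (s + 1 / real (Suc n)))"
      proof
        fix x assume x: "x \<in> U s"
        then have "0 < F x - s" by (simp add: U_def)
        then obtain n where "1 / real (Suc n) < F x - s" by (rule nat_approx_posE)
        then have "x \<in> U (s + 1 / real (Suc n))" using x by (simp add: U_def)
        then show "x \<in> (\<Union>n. U (s + 1 / real (Suc n)))" by blast
      qed
    qed
    have "(\<lambda>n. measure lborel (U (s + 1 / real (Suc n)))) \<longlonglongrightarrow> measure lborel (\<Union>n. U (s + 1 / real (Suc n)))"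
      by (rule Lim_measure_incseq[OF _ inc]) (use sub_fin[OF UD] un in auto)
    then have "(\<lambda>n. measure lborel (U (s + 1 / real (Suc n)))) \<longlonglongrightarrow> measure lborel (U s)" by (simp only: un)
    then show ?thesis by (rule LIMSEQ_le_const2) (auto intro!: up exI[of _ 0])
  qed
  have Vs: "c \<le> measure lborel (V s)"
  proof (cases "s = 0")
    \<comment> \<open>There are no levels below 0 to approach from, but \<open>V s\<close> is all of
      \<open>D\<close>, whose measure is at least \<open>c\<close> because \<open>f\<close> is at
      most its indicator.\<close>
    case True
    then have "V s = D" using F0 by (auto simp: V_def)
    then show ?thesis using cD' by simp
  next
    case False
    then have spos: "0 < s" using s0 by simp
    have low: "c \<le> measure lborel (U t)" if "0 \<le> t" "t < s" for t
    proof (rule ccontr)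
      assume "\<not> c \<le> measure lborel (U t)"
      then have "t \<in> T" using that by (simp add: T_def)
      then have "s \<le> t" unfolding s_def using Tb by (intro cInf_lower)
      then show False using that by simp
    qed
    define q where "q n = s - s / real (Suc n)" for n
    have q: "0 \<le> q n" "q n < s" for n using spos by (auto simp: q_def field_simps)
    have dec: "decseq (\<lambda>n. U (q n))"
    proof (rule decseq_SucI)
      fix n
      have "s / real (Suc (Suc n)) \<le> s / real (Suc n)" using spos by (intro divide_left_mono) auto
      then show "U (q (Suc n)) \<subseteq> U (q n)" by (auto simp: U_def q_def)
    qed
    have int: "(\<Inter>n. U (q n)) = V s"
    proof
      show "V s \<subseteq> (\<Inter>n. U (q n))" using q by (auto simp: U_def V_def intro: less_le_trans)
      show "(\<Inter>n. U (q n)) \<subseteq> V s"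
      proof
        fix x assume x: "x \<in> (\<Inter>n. U (q n))"
        have "s \<le> F x"
        proof (rule ccontr)
          assume "\<not> s \<le> F x"
          then have "0 < (s - F x) / s" using spos by simp
          then obtain n where "1 / real (Suc n) < (s - F x) / s" by (rule nat_approx_posE)
          then have "s / real (Suc n) < s - F x" using spos by (simp add: field_simps)
          then have "F x < q n" by (simp add: q_def)
          moreover have "q n < F x" using x by (auto simp: U_def)
          ultimately show False by simp
        qed
        then show "x \<in> V s" using x by (auto simp: U_def V_def)
      qed
    qed
    have "(\<lambda>n. measure lborel (U (q n))) \<longlonglongrightarrow> measure lborel (\<Inter>n. U (q n))"
      by (rule Lim_measure_decseq[OF _ dec]) (use sub_fin[OF UD] in auto)
    then have "(\<lambda>n. measure lborel (U (q n))) \<longlonglongrightarrow> measure lborel (V s)" by (simp only: int)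
    then show ?thesis by (rule LIMSEQ_le_const) (auto intro!: low q exI[of _ 0])
  qed
  have VU: "V s - U s \<in> sets borel" "V s - U s \<subseteq> D" using VD by auto
  have mV: "measure lborel (V s) = measure lborel (U s) + measure lborel (V s - U s)"
  proof -
    have "measure lborel (U s \<union> (V s - U s)) = measure lborel (U s) + measure lborel (V s - U s)"
      using sub_fin[OF UD] sub_fin[OF VU(2)] by (intro measure_Union) auto
    moreover have "U s \<union> (V s - U s) = V s" by (auto simp: U_def V_def)
    ultimately show ?thesis by simp
  qed
  have "0 \<le> c - measure lborel (U s)" "c - measure lborel (U s) \<le> measure lborel (V s - U s)"
    using Us Vs mV by auto
  then obtain \<rho> where \<rho>: "measure lborel ((V s - U s) \<inter> ball 0 \<rho>) = c - measure lborel (U s)"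
    using emeasure_Int_ball_IVT[OF VU(1) VU(2)[unfolded D_def]] by blast
  define A where "A = U s \<union> (V s - U s) \<inter> ball 0 \<rho>"
  have Am[measurable]: "A \<in> sets borel" by (simp add: A_def)
  have AD: "A \<subseteq> D" using UD VD by (auto simp: A_def)
  have "measure lborel A = measure lborel (U s) + measure lborel ((V s - U s) \<inter> ball 0 \<rho>)"
  proof -
    have "(V s - U s) \<inter> ball 0 \<rho> \<subseteq> D" using VU by auto
    then show ?thesis unfolding A_def
      using sub_fin[OF UD] sub_fin by (intro measure_Union) auto
  qed
  then have mA: "measure lborel A = c" by (simp add: \<rho>)
  have eA: "vol A = ennreal c"
    using sub_fin[OF AD] mA by (simp add: emeasure_eq_ennreal_measure)
  \<comment> \<open>Written with sums on both sides, so that it integrates in \<open>ennreal\<close>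
    without subtraction; the common term \<open>s * c\<close> is finite and cancels.\<close>
  have point: "ennreal (F x) * ennreal (f x) + ennreal s * indicator A x \<le> ennreal (F x) * indicator A x + ennreal s * ennreal (f x)" for x
  proof -
    have *: "F x * f x + s * indicator A x \<le> F x * indicator A x + s * f x"
    proof (cases "x \<in> A")
      case True
      then have "s \<le> F x" by (auto simp: A_def U_def V_def)
      then have "0 \<le> (F x - s) * (1 - f x)" using f0 by simp
      then show ?thesis using True by (simp add: algebra_simps)
    next
      case False
      show ?thesis
      proof (cases "x \<in> D")
        case True
        then have "F x \<le> s" using False by (auto simp: A_def U_def)
        then show ?thesis using False f0(1)[of x] by (simp add: mult_right_mono)
      next
        case F: False
        then show ?thesis using False supp[of x] by (simp add: D_def)
      qed
    qed
    have "ennreal (F x) * ennreal (f x) + ennreal s * indicator A x = ennreal (F x * f x + s * indicator A x)"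
      using F0 f0 s0 by (cases "x \<in> A") (auto simp: ennreal_mult)
    moreover have "ennreal (F x) * indicator A x + ennreal s * ennreal (f x) = ennreal (F x * indicator A x + s * f x)"
      using F0 f0 s0 by (cases "x \<in> A") (auto simp: ennreal_mult)
    ultimately show ?thesis using * by (simp add: ennreal_leI)
  qed
  have "(\<integral>\<^sup>+x. ennreal (F x) * ennreal (f x) \<partial>lborel) + ennreal s * ennreal c
    = (\<integral>\<^sup>+x. ennreal (F x) * ennreal (f x) + ennreal s * indicator A x \<partial>lborel)"
    by (subst nn_integral_add) (auto simp: nn_integral_cmult eA)
  also have "\<dots> \<le> (\<integral>\<^sup>+x. ennreal (F x) * indicator A x + ennreal s * ennreal (f x) \<partial>lborel)"
    by (intro nn_integral_mono point)
  also have "\<dots> = (\<integral>\<^sup>+x. ennreal (F x) * indicator A x \<partial>lborel) + ennreal s * ennreal c"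
    by (subst nn_integral_add) (auto simp: nn_integral_cmult c(1))
  finally have le: "ennreal s * ennreal c + (\<integral>\<^sup>+x. ennreal (F x) * ennreal (f x) \<partial>lborel)
     \<le> ennreal s * ennreal c + (\<integral>\<^sup>+x. ennreal (F x) * indicator A x \<partial>lborel)" by (simp add: add.commute)
  have "ennreal s * ennreal c \<noteq> \<infinity>" by (simp add: ennreal_mult_eq_top_iff)
  with le have "(\<integral>\<^sup>+x. ennreal (F x) * ennreal (f x) \<partial>lborel) \<le> (\<integral>\<^sup>+x. ennreal (F x) * indicator A x \<partial>lborel)"
    by (metis ennreal_add_left_cancel_le infinity_ennreal_def)
  then show ?thesis using that[of A] Am AD eA c(1) by (simp add: D_def)
qed

text \<open>Linearity in one density: \<open>F z\<close> integrates out the other columns with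
  column \<open>k\<close> held at \<open>z\<close>. It is at most 1 because each of those columns
  has mass at most 1, and this is the range that \<open>bathtub\<close> expects.\<close>

lemma multi_integral_coordinate:
  fixes K :: "('i::finite \<Rightarrow> 'a::euclidean_space) set"
  assumes Km[measurable]: "K \<in> sets lborel_PiM" and g[measurable]: "\<And>i. g i \<in> borel_measurable borel"
    and g1: "\<And>i. (\<integral>\<^sup>+x. g i x \<partial>lborel) \<le> 1"
  obtains F where "F \<in> borel_measurable borel" "\<And>z. F z \<le> 1"
    "\<And>\<phi>. \<phi> \<in> borel_measurable borel \<Longrightarrow> multi_integral K (g(k := \<phi>)) = (\<integral>\<^sup>+z. F z * \<phi> z \<partial>lborel)"
proof -
  interpret product_sigma_finite "\<lambda>_::'i. lborel :: 'a measure" by (rule product_sigma_finite_lborel)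
  let ?I = "UNIV - {k}"
  let ?P = "\<Pi>\<^sub>M i\<in>?I. (lborel :: 'a measure)"
  interpret P: sigma_finite_measure ?P by (rule sigma_finite) simp
  have ins: "UNIV = insert k ?I" by auto
  have upd: "(\<lambda>(x, z). x(k := z)) \<in> ?P \<Otimes>\<^sub>M (lborel :: 'a measure) \<rightarrow>\<^sub>M lborel_PiM"
    using measurable_add_dim[of k ?I "\<lambda>_. lborel :: 'a measure"] by (simp add: insert_absorb)
  have updc: "(\<lambda>w. (snd w)(k := fst w)) \<in> (borel :: 'a measure) \<Otimes>\<^sub>M ?P \<rightarrow>\<^sub>M lborel_PiM"
  proof -
    have "(\<lambda>w. (snd w, fst w)) \<in> (borel :: 'a measure) \<Otimes>\<^sub>M ?P \<rightarrow>\<^sub>M ?P \<Otimes>\<^sub>M lborel" by measurable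
    from measurable_compose[OF this upd] show ?thesis by simp
  qed
  define h where "h z x = indicator K (x(k := z)) * (\<Prod>i\<in>?I. g i (x i))" for z x
  have hm: "(\<lambda>w. h (fst w) (snd w)) \<in> borel_measurable ((borel :: 'a measure) \<Otimes>\<^sub>M ?P)"
  proof -
    have 1: "(\<lambda>w. indicator K ((snd w)(k := fst w)) :: ennreal) \<in> borel_measurable ((borel :: 'a measure) \<Otimes>\<^sub>M ?P)"
      by (rule measurable_compose[OF updc]) measurable
    have 2: "(\<lambda>w. \<Prod>i\<in>?I. g i (snd w i)) \<in> borel_measurable ((borel :: 'a measure) \<Otimes>\<^sub>M ?P)"
    proof (rule borel_measurable_prod_ennreal)
      fix i assume i: "i \<in> ?I"
      have "(\<lambda>w. snd w i) \<in> (borel :: 'a measure) \<Otimes>\<^sub>M ?P \<rightarrow>\<^sub>M lborel"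
        by (rule measurable_compose[OF measurable_snd measurable_component_singleton[OF i]])
      from measurable_compose[OF this, of "g i" borel] show "(\<lambda>w. g i (snd w i)) \<in> borel_measurable ((borel :: 'a measure) \<Otimes>\<^sub>M ?P)"
        using g[of i] by simp
    qed
    show ?thesis unfolding h_def using 1 2 by (rule borel_measurable_times_ennreal)
  qed
  have hz: "h z \<in> borel_measurable ?P" for z
    using measurable_compose[OF measurable_Pair1' hm, of z] by simp
  define F where "F z = (\<integral>\<^sup>+x. h z x \<partial>?P)" for z
  have Fm: "F \<in> borel_measurable borel"
    unfolding F_def[abs_def]
    by (rule P.borel_measurable_nn_integral) (simp add: split_beta' hm)
  have "F z \<le> 1" for z
  proof -
    have "F z \<le> (\<integral>\<^sup>+x. (\<Prod>i\<in>?I. g i (x i)) \<partial>?P)"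
      unfolding F_def h_def by (intro nn_integral_mono) (auto simp: indicator_def)
    also have "\<dots> = (\<Prod>i\<in>?I. \<integral>\<^sup>+x. g i x \<partial>lborel)"
      by (intro product_nn_integral_prod) auto
    also have "\<dots> \<le> (\<Prod>i\<in>?I. 1)" by (intro prod_mono_ennreal g1)
    finally show ?thesis by simp
  qed
  moreover have "multi_integral K (g(k := \<phi>)) = (\<integral>\<^sup>+z. F z * \<phi> z \<partial>lborel)"
    if [measurable]: "\<phi> \<in> borel_measurable borel" for \<phi>
  proof -
    define G where "G x = indicator K x * (\<Prod>i\<in>UNIV. (g(k := \<phi>)) i (x i))" for x
    have Gm: "G \<in> borel_measurable (\<Pi>\<^sub>M i\<in>insert k ?I. lborel)"
    proof -
      have "(\<lambda>x. (g(k := \<phi>)) i (x i)) \<in> borel_measurable (lborel_PiM :: ('i \<Rightarrow> 'a) measure)" for i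
        by (cases "i = k") auto
      then have "G \<in> borel_measurable lborel_PiM"
        unfolding G_def by (intro borel_measurable_times_ennreal borel_measurable_prod_ennreal) auto
      then show ?thesis by (simp add: insert_absorb)
    qed
    have "multi_integral K (g(k := \<phi>)) = (\<integral>\<^sup>+x. G x \<partial>(\<Pi>\<^sub>M i\<in>insert k ?I. lborel))"
      unfolding multi_integral_def G_def by (simp add: insert_absorb)
    also have "\<dots> = (\<integral>\<^sup>+z. (\<integral>\<^sup>+x. G (x(k := z)) \<partial>?P) \<partial>lborel)"
      by (rule product_nn_integral_insert_rev[OF _ _ Gm]) auto
    also have "\<dots> = (\<integral>\<^sup>+z. F z * \<phi> z \<partial>lborel)"
    proof (rule nn_integral_cong)
      fix z
      have "G (x(k := z)) = h z x * \<phi> z" for x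
      proof -
        have "(\<Prod>i\<in>UNIV. (g(k := \<phi>)) i ((x(k := z)) i)) = \<phi> z * (\<Prod>i\<in>?I. g i (x i))"
          by (subst prod.remove[of UNIV k]) (auto intro!: arg_cong2[where f="(*)"] prod.cong)
        then show ?thesis by (simp add: G_def h_def ac_simps)
      qed
      then show "(\<integral>\<^sup>+x. G (x(k := z)) \<partial>?P) = F z * \<phi> z"
        unfolding F_def using hz[of z] by (simp add: nn_integral_multc)
    qed
    finally show ?thesis .
  qed
  ultimately show ?thesis using that Fm by blast
qed

text \<open>Columns are replaced one at a time, \<open>S\<close> being those already done. With the
  others fixed, the bathtub set for the weight \<open>F\<close> does not lower the functional. Its
  measure equals the mass of \<open>f k\<close>, so all masses remain at most 1 for the next
  column.\<close>

lemma multi_integral_le_multi_volume: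
  fixes K :: "('i::finite \<Rightarrow> 'a::euclidean_space) set"
  assumes Km[measurable]: "K \<in> sets lborel_PiM"
    and f[measurable]: "\<And>i. f i \<in> borel_measurable borel" and f0: "\<And>i x. 0 \<le> f i x" "\<And>i x. f i x \<le> 1"
    and supp: "\<And>i x. x \<notin> ball 0 R \<Longrightarrow> f i x = 0" and int: "\<And>i. (\<integral>\<^sup>+x. ennreal (f i x) \<partial>lborel) \<le> 1"
  obtains A where "\<And>i. A i \<in> sets borel" "\<And>i. vol (A i) \<le> 1"
    "multi_integral K (\<lambda>i x. ennreal (f i x)) \<le> multi_volume K A"
proof -
  have "\<exists>A. (\<forall>i. A i \<in> sets borel \<and> vol (A i) \<le> 1) \<and>
    multi_integral K (\<lambda>i x. ennreal (f i x)) \<le> multi_integral K (\<lambda>i. if i \<in> S then indicator (A i) else (\<lambda>x. ennreal (f i x)))"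
    if "finite S" for S
    using that
  proof induction
    case empty
    show ?case by (intro exI[of _ "\<lambda>_. {}"]) simp
  next
    case (insert k S)
    then obtain A where A: "\<And>i. A i \<in> sets borel" "\<And>i. vol (A i) \<le> 1"
      "multi_integral K (\<lambda>i x. ennreal (f i x)) \<le> multi_integral K (\<lambda>i. if i \<in> S then indicator (A i) else (\<lambda>x. ennreal (f i x)))"
      by auto
    note [measurable] = A(1)
    define g where "g i = (if i \<in> S then indicator (A i) else (\<lambda>x. ennreal (f i x)))" for i
    have gm: "g i \<in> borel_measurable borel" for i by (cases "i \<in> S") (simp_all add: g_def)
    have g1: "(\<integral>\<^sup>+x. g i x \<partial>lborel) \<le> 1" for i
      using A int by (cases "i \<in> S") (simp_all add: g_def)
    obtain F where F: "F \<in> borel_measurable borel" "\<And>z. F z \<le> 1"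
      "\<And>\<phi>. \<phi> \<in> borel_measurable borel \<Longrightarrow> multi_integral K (g(k := \<phi>)) = (\<integral>\<^sup>+z. F z * \<phi> z \<partial>lborel)"
      by (rule multi_integral_coordinate[OF Km gm g1, where k=k]) (rule that)
    define F' where "F' z = enn2real (F z)" for z
    have FF': "F z = ennreal (F' z)" for z
      using F(2)[of z] by (simp add: F'_def) (metis ennreal_enn2real ennreal_one_less_top le_less_trans)
    have F': "F' \<in> borel_measurable borel" "\<And>z. 0 \<le> F' z" "\<And>z. F' z \<le> 1"
    proof -
      show "F' \<in> borel_measurable borel" unfolding F'_def[abs_def] using F(1) by measurable
      show "0 \<le> F' z" for z by (simp add: F'_def)
      show "F' z \<le> 1" for z using F(2)[of z] by (simp add: FF')
    qed
    obtain B where B: "B \<in> sets borel" "B \<subseteq> ball 0 R" "vol B = (\<integral>\<^sup>+x. ennreal (f k x) \<partial>lborel)"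
      "(\<integral>\<^sup>+x. ennreal (F' x) * ennreal (f k x) \<partial>lborel) \<le> (\<integral>\<^sup>+x. ennreal (F' x) * indicator B x \<partial>lborel)"
      by (rule bathtub[where f="f k" and F=F' and R=R, OF F' f f0 supp]) (assumption | rule that)+
    define A' where "A' = A(k := B)"
    have "multi_integral K (\<lambda>i x. ennreal (f i x)) \<le> multi_integral K g"
      using A(3) by (simp add: g_def[abs_def])
    also have "g = g(k := (\<lambda>x. ennreal (f k x)))" using insert.hyps by (auto simp: g_def)
    also have "multi_integral K \<dots> = (\<integral>\<^sup>+z. F z * ennreal (f k z) \<partial>lborel)" by (rule F(3)) simp
    also have "\<dots> \<le> (\<integral>\<^sup>+z. F z * indicator B z \<partial>lborel)" using B(4) by (simp add: FF')
    also have "\<dots> = multi_integral K (g(k := indicator B))" by (rule F(3)[symmetric]) (use B in simp)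
    also have "g(k := indicator B) = (\<lambda>i. if i \<in> insert k S then indicator (A' i) else (\<lambda>x. ennreal (f i x)))"
      by (auto simp: g_def A'_def fun_eq_iff)
    finally have "multi_integral K (\<lambda>i x. ennreal (f i x)) \<le>
      multi_integral K (\<lambda>i. if i \<in> insert k S then indicator (A' i) else (\<lambda>x. ennreal (f i x)))" .
    moreover have "A' i \<in> sets borel \<and> vol (A' i) \<le> 1" for i
      using A B int[of k] by (simp add: A'_def)
    ultimately show ?case by blast
  qed
  from this[of UNIV] show ?thesis using that by auto
qed

text \<open>An open ball is compared with a closed one through volumes: a point outside the closed
  ball would have a norm whose open ball contains it and so has volume at least 1.\<close>

lemma sym_rearr_set_subset_unit_volume_ball:
  fixes A :: "'a::euclidean_space set"
  assumes "vol A \<le> 1"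
  shows "sym_rearr_set A \<subseteq> unit_volume_ball"
proof -
  obtain \<rho> where \<rho>: "unit_volume_ball = cball (0::'a) \<rho>" by (simp add: unit_volume_ball_def)
  have fin: "vol A < \<infinity>" using assms by (auto intro: le_less_trans)
  show ?thesis
  proof
    fix x assume "x \<in> sym_rearr_set A"
    then have *: "vol (ball (0::'a) (norm x)) < 1"
      using assms by (auto simp: mem_sym_rearr_set_iff[OF fin] intro: less_le_trans)
    show "x \<in> unit_volume_ball"
    proof (rule ccontr)
      assume "x \<notin> unit_volume_ball"
      then have "cball (0::'a) \<rho> \<subseteq> ball 0 (norm x)" by (auto simp: \<rho>)
      then have "vol (cball (0::'a) \<rho>) \<le> vol (ball (0::'a) (norm x))"
        by (intro emeasure_mono) auto
      then show False using * emeasure_unit_volume_ball[where 'a='a] by (simp add: \<rho>)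
    qed
  qed
qed

text \<open>Truncating to \<open>min (f i x) 1\<close> on a ball turns the almost-everywhere bound
  into a pointwise one and bounds the support, as \<open>bathtub\<close> requires. The truncation
  may lower the mass, so the sets obtained have measure at most 1 rather than exactly 1.\<close>

lemma multi_integral_le_unit_balls:
  fixes K :: "('i::finite \<Rightarrow> 'a::euclidean_space) set"
  assumes Km[measurable]: "K \<in> sets lborel_PiM" and conv: "fun_convex K" and inv: "orth_invariant K"
    and f[measurable]: "\<And>i. f i \<in> borel_measurable borel" and f0: "\<And>i x. 0 \<le> f i x"
    and int: "\<And>i. (\<integral>\<^sup>+x. ennreal (f i x) \<partial>lborel) \<le> 1" and f1: "\<And>i. AE x in lborel. f i x \<le> 1"
  shows "multi_integral K (\<lambda>i x. ennreal (f i x)) \<le> multi_volume K (\<lambda>_. unit_volume_ball)"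
proof -
  have [measurable]: "ball (0::'a) s \<in> sets borel" for s by simp
  define g where "g n i x = min (f i x) 1 * indicator (ball 0 (real n)) x" for n i x
  have gm[measurable]: "g n i \<in> borel_measurable borel" for n i unfolding g_def[abs_def] by measurable
  have g: "0 \<le> g n i x" "g n i x \<le> 1" "g n i x \<le> f i x" "x \<notin> ball 0 (real n) \<Longrightarrow> g n i x = 0" for n i x
    using f0[of i x] by (auto simp: g_def indicator_def)
  have step: "multi_integral K (\<lambda>i x. ennreal (g n i x)) \<le> multi_volume K (\<lambda>_. unit_volume_ball)" for n
  proof -
    have int': "(\<integral>\<^sup>+x. ennreal (g n i x) \<partial>lborel) \<le> 1" for i
      using g(3) by (intro order_trans[OF nn_integral_mono int[of i]]) (simp add: ennreal_leI)
    obtain A where A: "\<And>i. A i \<in> sets borel" "\<And>i. vol (A i) \<le> 1"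
      "multi_integral K (\<lambda>i x. ennreal (g n i x)) \<le> multi_volume K A"
      by (rule multi_integral_le_multi_volume[where f="g n" and R="real n", OF Km gm g(1,2,4) int']) (assumption | rule that)+
    have "vol (A i) < \<infinity>" for i by (rule le_less_trans[OF A(2)]) simp
    then have "multi_volume K A \<le> multi_volume K (\<lambda>i. sym_rearr_set (A i))"
      using A(1) by (intro multi_volume_rearrange[OF Km conv inv])
    also have "\<dots> \<le> multi_volume K (\<lambda>_. unit_volume_ball)"
      using A by (intro multi_volume_mono sym_rearr_set_subset_unit_volume_ball)
    finally show ?thesis using A(3) by simp
  qed
  have "multi_integral K (\<lambda>i x. ennreal (f i x)) \<le> multi_integral K (\<lambda>i x. ennreal (min (f i x) 1))"
  proof (rule multi_integral_mono_AE)
    show "AE x in lborel. ennreal (f i x) \<le> ennreal (min (f i x) 1)" for i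
      using f1[of i] by eventually_elim simp
  qed
  also have "\<dots> \<le> multi_volume K (\<lambda>_. unit_volume_ball)"
  proof (rule multi_integral_le_eventually[OF Km _ _ step])
    fix i and x :: 'a
    obtain m where "norm x < real m" using reals_Archimedean2 by blast
    then show "\<forall>\<^sub>F n in sequentially. ennreal (min (f i x) 1) \<le> ennreal (g n i x)"
      by (intro eventually_sequentiallyI[of m]) (auto simp: g_def)
  qed measurable
  finally show ?thesis .
qed

section \<open>The operator norm of a random matrix\<close>

text \<open>\<open>c\<close> picks the subfamily \<open>X\<close>, \<open>Xs\<close> or
  \<open>Z\<close> out of one independent family. The law of the tuple and the measure with the
  product density both equal the product of the marginal laws, because they agree with it on
  boxes.\<close>

lemma (in prob_space) emeasure_indep_family:
  fixes Y :: "'k \<Rightarrow> 'a \<Rightarrow> 'b::euclidean_space" and c :: "'i::finite \<Rightarrow> 'k"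
  assumes indep: "indep_vars (\<lambda>_. borel) Y UNIV" and c: "inj c"
    and dens: "\<And>i. distributed M lborel (Y (c i)) (g i)" and Km[measurable]: "K \<in> sets lborel_PiM"
  shows "emeasure M {\<omega> \<in> space M. (\<lambda>i. Y (c i) \<omega>) \<in> K} = multi_integral K g"
proof -
  have Ym[measurable]: "random_variable borel (Y (c i))" for i
    using distributed_measurable[OF dens[of i]] by simp
  have gm[measurable]: "g i \<in> borel_measurable borel" for i
    using distributed_borel_measurable[OF dens[of i]] by simp
  have distr: "distr M lborel (Y (c i)) = density lborel (g i)" for i
    using distributed_distr_eq_density[OF dens[of i]] .
  have "prob_space (density lborel (g i))" for i
    unfolding distr[of i, symmetric] by (rule prob_space_distr) simp
  then interpret D: product_sigma_finite "\<lambda>i. density lborel (g i)"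
    unfolding product_sigma_finite_def using prob_space_imp_sigma_finite by blast
  interpret L: product_sigma_finite "\<lambda>_::'i. lborel :: 'b measure" by (rule product_sigma_finite_lborel)
  have sets: "sets (\<Pi>\<^sub>M i\<in>UNIV. density lborel (g i)) = sets lborel_PiM"
    by (rule sets_PiM_cong) auto
  have vec: "(\<lambda>\<omega> i. Y (c i) \<omega>) \<in> M \<rightarrow>\<^sub>M lborel_PiM"
    by (rule measurable_PiM_single') auto
  have density_box: "(\<integral>\<^sup>+x. (\<Prod>i\<in>UNIV. g i (x i)) * indicator {x. \<forall>i. x i \<in> A i} x \<partial>lborel_PiM)
     = (\<Prod>i\<in>UNIV. emeasure (density lborel (g i)) (A i))"
    if [measurable]: "\<And>i. A i \<in> sets borel" for A
  proof -
    have "(\<integral>\<^sup>+x. (\<Prod>i\<in>UNIV. g i (x i)) * indicator {x. \<forall>i. x i \<in> A i} x \<partial>lborel_PiM)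
      = (\<integral>\<^sup>+x. (\<Prod>i\<in>UNIV. g i (x i) * indicator (A i) (x i)) \<partial>lborel_PiM)"
      by (intro nn_integral_cong) (simp add: prod.distrib prod_indicator)
    also have "\<dots> = (\<Prod>i\<in>UNIV. \<integral>\<^sup>+x. g i x * indicator (A i) x \<partial>lborel)"
      by (intro L.product_nn_integral_prod) auto
    finally show ?thesis by (simp add: emeasure_density)
  qed
  have box: "Pi\<^sub>E UNIV A = {x. \<forall>i. x i \<in> A i}" for A :: "'i \<Rightarrow> 'b set" by (auto simp: PiE_def Pi_def)
  have 1: "distr M lborel_PiM (\<lambda>\<omega> i. Y (c i) \<omega>) = (\<Pi>\<^sub>M i\<in>UNIV. density lborel (g i))"
  proof (rule D.PiM_eqI)
    fix A :: "'i \<Rightarrow> 'b set" assume "\<And>i. i \<in> UNIV \<Longrightarrow> A i \<in> sets (density lborel (g i))"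
    then have A[measurable]: "A i \<in> sets borel" for i by simp
    \<comment> \<open>Reindexes the sides of the box by the large index set; on the range of
      \<open>c\<close> this inverts \<open>c\<close>.\<close>
    define B where "B k = A (inv c k)" for k
    have Bc: "B (c i) = A i" for i using c by (simp add: B_def)
    have "emeasure (distr M lborel_PiM (\<lambda>\<omega> i. Y (c i) \<omega>)) (Pi\<^sub>E UNIV A)
      = emeasure M ((\<lambda>\<omega> i. Y (c i) \<omega>) -` {x. \<forall>i. x i \<in> A i} \<inter> space M)"
      unfolding box by (rule emeasure_distr[OF vec]) auto
    also have "(\<lambda>\<omega> i. Y (c i) \<omega>) -` {x. \<forall>i. x i \<in> A i} \<inter> space M = (\<Inter>k\<in>range c. Y k -` B k \<inter> space M)"
      by (auto simp: Bc)
    also have "emeasure M \<dots> = ennreal (prob (\<Inter>k\<in>range c. Y k -` B k \<inter> space M))"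
      by (rule emeasure_eq_measure)
    also have "prob (\<Inter>k\<in>range c. Y k -` B k \<inter> space M) = (\<Prod>k\<in>range c. prob (Y k -` B k \<inter> space M))"
      by (rule indep_varsD[OF indep]) (auto simp: B_def)
    also have "\<dots> = (\<Prod>i\<in>UNIV. prob (Y (c i) -` A i \<inter> space M))"
      by (subst prod.reindex[OF c]) (simp add: Bc)
    also have "ennreal \<dots> = (\<Prod>i\<in>UNIV. emeasure M (Y (c i) -` A i \<inter> space M))"
      by (simp add: emeasure_eq_measure prod_ennreal)
    also have "\<dots> = (\<Prod>i\<in>UNIV. emeasure (density lborel (g i)) (A i))"
      unfolding distr[symmetric] by (intro prod.cong refl) (subst emeasure_distr, auto)
    finally show "emeasure (distr M lborel_PiM (\<lambda>\<omega> i. Y (c i) \<omega>)) (Pi\<^sub>E UNIV A)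
      = (\<Prod>i\<in>UNIV. emeasure (density lborel (g i)) (A i))" .
  qed (auto simp: sets)
  have prodm: "(\<lambda>x. \<Prod>i\<in>UNIV. g i (x i)) \<in> borel_measurable (lborel_PiM :: ('i \<Rightarrow> 'b) measure)"
    by measurable
  have 2: "density lborel_PiM (\<lambda>x. \<Prod>i\<in>UNIV. g i (x i)) = (\<Pi>\<^sub>M i\<in>UNIV. density lborel (g i))"
  proof (rule D.PiM_eqI)
    fix A :: "'i \<Rightarrow> 'b set" assume "\<And>i. i \<in> UNIV \<Longrightarrow> A i \<in> sets (density lborel (g i))"
    then have A[measurable]: "A i \<in> sets borel" for i by simp
    show "emeasure (density lborel_PiM (\<lambda>x. \<Prod>i\<in>UNIV. g i (x i))) (Pi\<^sub>E UNIV A)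
      = (\<Prod>i\<in>UNIV. emeasure (density lborel (g i)) (A i))"
      unfolding box by (subst emeasure_density[OF prodm]) (auto simp: density_box)
  qed (auto simp: sets)
  have "emeasure M {\<omega> \<in> space M. (\<lambda>i. Y (c i) \<omega>) \<in> K} = emeasure M ((\<lambda>\<omega> i. Y (c i) \<omega>) -` K \<inter> space M)"
    by (rule arg_cong[where f="emeasure M"]) auto
  also have "\<dots> = emeasure (distr M lborel_PiM (\<lambda>\<omega> i. Y (c i) \<omega>)) K"
    by (rule emeasure_distr[OF vec Km, symmetric])
  also have "\<dots> = emeasure (density lborel_PiM (\<lambda>x. \<Prod>i\<in>UNIV. g i (x i))) K" by (simp only: 1 2)
  also have "\<dots> = multi_integral K g"
    by (subst emeasure_density[OF prodm Km]) (simp add: multi_integral_def mult.commute)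
  finally show ?thesis .
qed

section \<open>Sets of matrices with bounded operator norm\<close>

lemma matrix_of_columns_mult: "matrix_of_columns x *v v = (\<Sum>i\<in>UNIV. v $ i *\<^sub>R x i)"
  by (simp add: vec_eq_iff matrix_vector_mult_def matrix_of_columns_def mult.commute)

text \<open>Equivalence with the Euclidean norm, without which the supremum in the operator norm could
  be a junk value.\<close>

lemma is_norm_unit_ball_bounded:
  fixes p :: "real ^ 'N \<Rightarrow> real"
  assumes p: "is_norm p"
  obtains C where "\<And>v. p v \<le> 1 \<Longrightarrow> norm v \<le> C"
proof -
  have nonneg: "0 \<le> p v" and zero: "p v = 0 \<longleftrightarrow> v = 0" and hom: "p (a *\<^sub>R v) = \<bar>a\<bar> * p v"
    and tri: "p (v + w) \<le> p v + p w" for v w a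
    using p by (auto simp: is_norm_def)
  have psum: "p (\<Sum>i\<in>I. h i) \<le> (\<Sum>i\<in>I. p (h i))" if "finite I" for I :: "'N set" and h
    using that
  proof induction
    case empty then show ?case using zero[of 0] by simp
  next
    case (insert i I) then show ?case using tri[of "h i" "\<Sum>i\<in>I. h i"] by simp
  qed
  \<comment> \<open>Bounding \<open>p\<close> by a multiple of the Euclidean norm makes it
    Lipschitz, so it attains a minimum \<open>p u\<close> on the unit sphere. Definiteness makes
    this minimum positive, and \<open>1 / p u\<close> is the constant sought.\<close>
  define L where "L = (\<Sum>i\<in>UNIV. p (axis i 1))"
  have upper: "p v \<le> L * norm v" for v
  proof -
    have "(\<Sum>i\<in>UNIV. v $ i *\<^sub>R axis i 1) = v"
      using basis_expansion[of v] by (simp add: scalar_mult_eq_scaleR)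
    then have "p v = p (\<Sum>i\<in>UNIV. v $ i *\<^sub>R axis i 1)" by simp
    also have "\<dots> \<le> (\<Sum>i\<in>UNIV. p (v $ i *\<^sub>R axis i 1))" by (rule psum) simp
    also have "\<dots> = (\<Sum>i\<in>UNIV. \<bar>v $ i\<bar> * p (axis i 1))" by (simp only: hom)
    also have "\<dots> \<le> (\<Sum>i\<in>UNIV. norm v * p (axis i 1))"
      by (intro sum_mono mult_right_mono component_le_norm_cart nonneg)
    finally show ?thesis by (simp add: L_def sum_distrib_left mult.commute)
  qed
  have L0: "0 \<le> L" unfolding L_def by (intro sum_nonneg nonneg)
  have lip: "\<bar>p v - p w\<bar> \<le> L * norm (v - w)" for v w
  proof -
    have "p v \<le> p w + p (v - w)" using tri[of w "v - w"] by simp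
    moreover have "p w \<le> p v + p (w - v)" using tri[of v "w - v"] by simp
    moreover have "p (w - v) = p (v - w)" using hom[of "-1" "v - w"] by simp
    ultimately show ?thesis using upper[of "v - w"] by linarith
  qed
  have cont: "continuous_on (sphere 0 1) p"
  proof (rule continuous_on_subset[OF lipschitz_on_continuous_on])
    show "L-lipschitz_on UNIV p"
      using lip L0 by (intro lipschitz_onI) (auto simp: dist_norm)
  qed simp
  have "sphere (0::real^'N) 1 \<noteq> {}"
    by (metis norm_axis_1 dist_0_norm mem_sphere empty_iff)
  then obtain u where u: "u \<in> sphere 0 1" "\<And>v. v \<in> sphere 0 1 \<Longrightarrow> p u \<le> p v"
    using continuous_attains_inf[OF compact_sphere _ cont] by blast
  have "u \<noteq> 0" using u(1) by auto
  then have pu: "0 < p u" using nonneg[of u] zero[of u] by simp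
  show ?thesis
  proof (rule that[of "1 / p u"])
    fix v assume v: "p v \<le> 1"
    show "norm v \<le> 1 / p u"
    proof (cases "v = 0")
      case True then show ?thesis using pu by simp
    next
      case False
      have "p u \<le> p ((1 / norm v) *\<^sub>R v)" using False by (intro u(2)) simp
      also have "\<dots> = p v / norm v" by (simp add: hom)
      also have "\<dots> \<le> 1 / norm v" using v by (intro divide_right_mono) auto
      finally show ?thesis using False pu by (simp add: field_simps)
    qed
  qed
qed

lemma op_norm_le_iff:
  fixes p :: "real ^ 'N \<Rightarrow> real" and x :: "'N \<Rightarrow> real ^ 'n"
  assumes p: "is_norm p"
  shows "op_norm p (matrix_of_columns x) \<le> \<alpha> \<longleftrightarrow> (\<forall>v. p v \<le> 1 \<longrightarrow> norm (\<Sum>i\<in>UNIV. v $ i *\<^sub>R x i) \<le> \<alpha>)"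
proof -
  obtain C where C: "\<And>v. p v \<le> 1 \<Longrightarrow> norm v \<le> C"
    using is_norm_unit_ball_bounded[OF p] by metis
  have "p 0 = 0" using p by (simp add: is_norm_def)
  then have ne: "{v. p v \<le> 1} \<noteq> {}" by (metis (mono_tags) empty_iff mem_Collect_eq zero_le_one)
  have "norm (matrix_of_columns x *v v) \<le> (\<Sum>i\<in>UNIV. C * norm (x i))" if "p v \<le> 1" for v
  proof -
    have "norm (matrix_of_columns x *v v) \<le> (\<Sum>i\<in>UNIV. norm (v $ i *\<^sub>R x i))"
      unfolding matrix_of_columns_mult by (rule norm_sum)
    also have "\<dots> \<le> (\<Sum>i\<in>UNIV. C * norm (x i))"
    proof (rule sum_mono)
      fix i
      have "\<bar>v $ i\<bar> \<le> C" using component_le_norm_cart[of v i] C[OF that] by linarith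
      then show "norm (v $ i *\<^sub>R x i) \<le> C * norm (x i)" by (simp add: mult_right_mono)
    qed
    finally show ?thesis .
  qed
  then have "bdd_above ((\<lambda>v. norm (matrix_of_columns x *v v)) ` {v. p v \<le> 1})"
    by (auto intro!: bdd_aboveI2)
  then show ?thesis
    unfolding op_norm_def by (subst cSUP_le_iff[OF ne]) (auto simp: matrix_of_columns_mult)
qed

text \<open>The set \<open>K\<close> to which everything is applied. Stating one closed convex
  condition for each \<open>v\<close> avoids the real supremum.\<close>

definition contraction_body :: "(real ^ 'N \<Rightarrow> real) \<Rightarrow> real \<Rightarrow> ('N \<Rightarrow> real ^ 'n) set" where
  "contraction_body p \<alpha> = {x. \<forall>v. p v \<le> 1 \<longrightarrow> norm (\<Sum>i\<in>UNIV. v $ i *\<^sub>R x i) \<le> \<alpha>}"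

text \<open>The intersection is uncountable, so measurability goes through closedness; on a finite
  product the Borel sets are those of the product sigma-algebra.\<close>

lemma contraction_body_measurable: "contraction_body p \<alpha> \<in> sets lborel_PiM"
proof -
  have "closed {x :: 'a \<Rightarrow> real ^ 'b. norm (\<Sum>i\<in>UNIV. v $ i *\<^sub>R x i) \<le> \<alpha>}" for v :: "real ^ 'a"
    by (intro closed_Collect_le continuous_intros) auto
  moreover have "contraction_body p \<alpha> = (\<Inter>v\<in>{v. p v \<le> 1}. {x :: 'a \<Rightarrow> real ^ 'b. norm (\<Sum>i\<in>UNIV. v $ i *\<^sub>R x i) \<le> \<alpha>})"
    by (auto simp: contraction_body_def)
  ultimately have "closed (contraction_body p \<alpha> :: ('a \<Rightarrow> real ^ 'b) set)" by auto
  then have "(contraction_body p \<alpha> :: ('a \<Rightarrow> real ^ 'b) set) \<in> sets (\<Pi>\<^sub>M i\<in>UNIV. borel)"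
    by (simp add: sets_PiM_equal_borel)
  also have "sets (\<Pi>\<^sub>M i\<in>(UNIV::'a set). (borel :: (real ^ 'b) measure)) = sets lborel_PiM"
    by (intro sets_PiM_cong) auto
  finally show ?thesis .
qed

lemma contraction_body_convex: "fun_convex (contraction_body p \<alpha>)"
  unfolding fun_convex_def
proof (intro ballI)
  fix x y :: "'a \<Rightarrow> real ^ 'b" and u :: real
  assume x: "x \<in> contraction_body p \<alpha>" and y: "y \<in> contraction_body p \<alpha>" and u: "u \<in> {0..1}"
  have "norm (\<Sum>i\<in>UNIV. v $ i *\<^sub>R ((1 - u) *\<^sub>R x i + u *\<^sub>R y i)) \<le> \<alpha>" if v: "p v \<le> 1" for v
  proof -
    have "(\<Sum>i\<in>UNIV. v $ i *\<^sub>R ((1 - u) *\<^sub>R x i + u *\<^sub>R y i))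
      = (1 - u) *\<^sub>R (\<Sum>i\<in>UNIV. v $ i *\<^sub>R x i) + u *\<^sub>R (\<Sum>i\<in>UNIV. v $ i *\<^sub>R y i)"
      by (simp add: scaleR_sum_right sum.distrib[symmetric] scaleR_add_right mult.commute)
    also have "norm \<dots> \<le> (1 - u) * norm (\<Sum>i\<in>UNIV. v $ i *\<^sub>R x i) + u * norm (\<Sum>i\<in>UNIV. v $ i *\<^sub>R y i)"
      using u by (intro order_trans[OF norm_triangle_ineq]) simp
    also have "\<dots> \<le> (1 - u) * \<alpha> + u * \<alpha>"
      using x y u v by (intro add_mono mult_left_mono) (auto simp: contraction_body_def)
    finally show ?thesis by (simp add: algebra_simps)
  qed
  then show "(\<lambda>i. (1 - u) *\<^sub>R x i + u *\<^sub>R y i) \<in> contraction_body p \<alpha>"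
    by (simp add: contraction_body_def)
qed

lemma contraction_body_orth_invariant: "orth_invariant (contraction_body p \<alpha>)"
  unfolding orth_invariant_def
proof (intro allI impI ballI)
  fix T :: "real ^ 'b \<Rightarrow> real ^ 'b" and x :: "'a \<Rightarrow> real ^ 'b"
  assume T: "orthogonal_transformation T" and x: "x \<in> contraction_body p \<alpha>"
  have "(\<Sum>i\<in>UNIV. v $ i *\<^sub>R T (x i)) = T (\<Sum>i\<in>UNIV. v $ i *\<^sub>R x i)" for v :: "real ^ 'a"
    using orthogonal_transformation_linear[OF T] by (simp add: linear_sum linear_scale)
  then show "(\<lambda>i. T (x i)) \<in> contraction_body p \<alpha>"
    using x by (simp add: contraction_body_def orthogonal_transformation_norm[OF T])
qed

theorem theorem6p1:
  fixes p :: "real ^ 'N \<Rightarrow> real"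
    and f :: "'N \<Rightarrow> real ^ 'n \<Rightarrow> real"
    and M :: "'w measure"
    and X Xs Z :: "'N \<Rightarrow> 'w \<Rightarrow> real ^ 'n"
  assumes norm_p: "is_norm p"
    and f_borel: "\<And>i. f i \<in> borel_measurable borel"
    and f_nonneg: "\<And>i x. 0 \<le> f i x"
    and f_density: "\<And>i. (\<integral>\<^sup>+x. ennreal (f i x) \<partial>lborel) = 1"
    and prob: "prob_space M"
    and indep: "prob_space.indep_vars M (\<lambda>_. borel)
        (\<lambda>k. case k of Inl i \<Rightarrow> X i | Inr (Inl i) \<Rightarrow> Xs i | Inr (Inr i) \<Rightarrow> Z i)
        (UNIV :: ('N + 'N + 'N) set)"
    and X_density: "\<And>i. distributed M lborel (X i) (\<lambda>x. ennreal (f i x))"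
    and Xs_density: "\<And>i. distributed M lborel (Xs i) (sym_rearr (f i))"
    and Z_uniform: "\<And>i. distr M lborel (Z i) = uniform_measure lborel unit_volume_ball"
  shows "(\<forall>\<alpha>\<ge>0.
            measure M {\<omega> \<in> space M. op_norm p (matrix_of_columns (\<lambda>i. X i \<omega>)) \<le> \<alpha>}
          \<le> measure M {\<omega> \<in> space M. op_norm p (matrix_of_columns (\<lambda>i. Xs i \<omega>)) \<le> \<alpha>}) \<and>
         ((\<forall>i. esssup lborel (\<lambda>x. ereal \<bar>f i x\<bar>) \<le> 1) \<longrightarrow>
          (\<forall>\<alpha>\<ge>0.
            measure M {\<omega> \<in> space M. op_norm p (matrix_of_columns (\<lambda>i. X i \<omega>)) \<le> \<alpha>}
          \<le> measure M {\<omega> \<in> space M. op_norm p (matrix_of_columns (\<lambda>i. Z i \<omega>)) \<le> \<alpha>}))"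
proof -
  interpret prob_space M by (rule prob)
  let ?K = "\<lambda>\<alpha>. contraction_body p \<alpha> :: ('N \<Rightarrow> real ^ 'n) set"
  note K = contraction_body_measurable contraction_body_convex contraction_body_orth_invariant
  have event: "{\<omega> \<in> space M. op_norm p (matrix_of_columns (\<lambda>i. W i \<omega>)) \<le> \<alpha>}
      = {\<omega> \<in> space M. (\<lambda>i. W i \<omega>) \<in> ?K \<alpha>}" for W and \<alpha>
    by (simp add: op_norm_le_iff[OF norm_p] contraction_body_def)
  define B where "B = (unit_volume_ball :: (real ^ 'n) set)"
  have Bm[measurable]: "B \<in> sets borel" by (simp add: B_def unit_volume_ball_def)
  have B1: "vol B = 1" by (simp add: B_def emeasure_unit_volume_ball)
  have Zm: "random_variable borel (Z i)" for i
  proof -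
    have "\<forall>k. random_variable borel (case k of Inl i \<Rightarrow> X i | Inr (Inl i) \<Rightarrow> Xs i | Inr (Inr i) \<Rightarrow> Z i)"
      using indep unfolding indep_vars_def by blast
    from spec[OF this, of "Inr (Inr i)"] show ?thesis by simp
  qed
  have div1: "y / 1 = y" for y :: ennreal
    using mult_divide_eq_ennreal[of 1 y] by simp
  \<comment> \<open>The uniform density is the indicator divided by the volume, which is 1.\<close>
  have Z_density: "distributed M lborel (Z i) (indicator B)" for i
    unfolding distributed_def
    using Zm[of i] Z_uniform[of i] B1 by (simp add: uniform_measure_def B_def[symmetric] div1)
  have PX: "emeasure M {\<omega> \<in> space M. (\<lambda>i. X i \<omega>) \<in> ?K \<alpha>} = multi_integral (?K \<alpha>) (\<lambda>i x. ennreal (f i x))" for \<alpha>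
    using emeasure_indep_family[OF indep, of Inl, OF inj_Inl, of "\<lambda>i x. ennreal (f i x)"] X_density by (simp add: K(1))
  have PXs: "emeasure M {\<omega> \<in> space M. (\<lambda>i. Xs i \<omega>) \<in> ?K \<alpha>} = multi_integral (?K \<alpha>) (\<lambda>i. sym_rearr (f i))" for \<alpha>
    using emeasure_indep_family[OF indep, of "\<lambda>i. Inr (Inl i)" "\<lambda>i. sym_rearr (f i)"] Xs_density
    by (simp add: inj_def K(1))
  have PZ: "emeasure M {\<omega> \<in> space M. (\<lambda>i. Z i \<omega>) \<in> ?K \<alpha>} = multi_volume (?K \<alpha>) (\<lambda>_. B)" for \<alpha>
    using emeasure_indep_family[OF indep, of "\<lambda>i. Inr (Inr i)" "\<lambda>_. indicator B"] Z_density
    by (simp add: inj_def K(1))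
  have "emeasure M {\<omega> \<in> space M. (\<lambda>i. X i \<omega>) \<in> ?K \<alpha>} \<le> emeasure M {\<omega> \<in> space M. (\<lambda>i. Xs i \<omega>) \<in> ?K \<alpha>}" for \<alpha>
    unfolding PX PXs using f_borel f_nonneg f_density by (intro multi_integral_rearrange K) auto
  moreover have "emeasure M {\<omega> \<in> space M. (\<lambda>i. X i \<omega>) \<in> ?K \<alpha>} \<le> emeasure M {\<omega> \<in> space M. (\<lambda>i. Z i \<omega>) \<in> ?K \<alpha>}"
    if ess: "\<forall>i. esssup lborel (\<lambda>x. ereal \<bar>f i x\<bar>) \<le> 1" for \<alpha>
  proof -
    have "AE x in lborel. f i x \<le> 1" for i
      using esssup_AE[of "\<lambda>x. ereal \<bar>f i x\<bar>" lborel]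
    proof eventually_elim
      case (elim x)
      also have "esssup lborel (\<lambda>x. ereal \<bar>f i x\<bar>) \<le> 1" using ess by blast
      finally show ?case by simp
    qed
    then show ?thesis
      unfolding PX PZ B_def using f_borel f_nonneg f_density by (intro multi_integral_le_unit_balls K) auto
  qed
  ultimately show ?thesis
    unfolding event by (simp add: emeasure_eq_measure)
qed

end
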